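(* Every Thaler function $f:I\to I$, $I=[0,1]$, has historical behavior almost everywhere, that is, for Lebesgue-a.e. $x\in I$ there is a continuous $\varphi:I\to\mathbb R$ such that $\lim_{n\to\infty}\frac1n\sum_{j=0}^{n-1}\varphi(f^j(x))$ does not exist. Moreover, $$\mathcal L(x)=\{\lambda\delta_0+(1-\lambda)\delta_1:\lambda\in[0,1]\}\quad\text{for Lebesgue-a.e. }x\in(0,1).$$
   Context: A function $f:I\to I$ is a Thaler function if there exist $c\in(0,1)$ and $p>1$ such that: (T1) $f$ is full branch: the restrictions $f|_{(0,c)}:(0,c)\to(0,1)$ and $f|_{(c,1)}:(c,1)\to(0,1)$ are increasing, onto and $C^2$, and admit $C^2$-extensions to the closed intervals $[0,c]$ and $[c,1]$, respectively; (T2) $f$ is almost expanding: $f'(x)>1$ for every $x\in(0,c^-]\cup[c^+,1)$ (at $c$ the derivatives are those of the left and right extensions), $f'(0)=f'(1)=1$, and $f$ is convex in a neighborhood of $0$ and concave in a neighborhood of $1$; (T3) $f(x)-x=h(x)x^{p+1}$ for $x\in(0,c)$, where $h(kx)\sim h(x)$ as $x\to0$ for every $k>0$; (T4) there exists $a\in(0,\infty)$ such that $(1-x)-f(1-x)\sim a^p(f(x)-x)$ as $x\to0$. $\mathcal L(x)$ is the set of weak$^*$ accumulation points of the empirical measures $\frac1n(\delta_x+\dots+\delta_{f^{n-1}(x)})$, $n\ge1$. *)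

theory Defs
  imports "HOL-Probability.Probability" "HOL-Library.Landau_Symbols"
begin

section \<open>Thaler functions\<close>

text \<open>
  A self-map of the unit interval is a function \<open>f :: real \<Rightarrow> real\<close> mapping \<open>{0..1}\<close> into itself;
  its values outside \<open>{0..1}\<close> play no role. Its value at the branch point \<open>c\<close> is arbitrary.
\<close>

text \<open>Derivatives at end points contained in \<open>S\<close> are one-sided.\<close>

definition C2_on :: "real set \<Rightarrow> (real \<Rightarrow> real) \<Rightarrow> bool" where
  "C2_on S g \<longleftrightarrow> (\<exists>g' g''.
     (\<forall>x\<in>S. (g has_real_derivative g' x) (at x within S)) \<and>
     (\<forall>x\<in>S. (g' has_real_derivative g'' x) (at x within S)) \<and>
     continuous_on S g'')"

text \<open>
  \<open>fl\<close> and \<open>fr\<close> are the \<open>C\<^sup>2\<close> extensions of the two branches to the closed intervals; they are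
  uniquely determined there by \<open>f\<close> and \<open>c\<close>.
\<close>

definition full_branch ::
    "(real \<Rightarrow> real) \<Rightarrow> real \<Rightarrow> (real \<Rightarrow> real) \<Rightarrow> (real \<Rightarrow> real) \<Rightarrow> bool" where
  "full_branch f c fl fr \<longleftrightarrow>
     strict_mono_on {0<..<c} f \<and> f ` {0<..<c} = {0<..<1} \<and> C2_on {0<..<c} f \<and>
     strict_mono_on {c<..<1} f \<and> f ` {c<..<1} = {0<..<1} \<and> C2_on {c<..<1} f \<and>
     C2_on {0..c} fl \<and> (\<forall>x\<in>{0<..<c}. fl x = f x) \<and>
     C2_on {c..1} fr \<and> (\<forall>x\<in>{c<..<1}. fr x = f x)"

definition almost_expanding ::
    "(real \<Rightarrow> real) \<Rightarrow> real \<Rightarrow> (real \<Rightarrow> real) \<Rightarrow> (real \<Rightarrow> real) \<Rightarrow> bool" where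
  "almost_expanding f c fl fr \<longleftrightarrow>
     (\<forall>x\<in>{0<..<c} \<union> {c<..<1}. deriv f x > 1) \<and>
     (\<exists>d>1. (fl has_real_derivative d) (at c within {0..c})) \<and>
     (\<exists>d>1. (fr has_real_derivative d) (at c within {c..1})) \<and>
     (f has_real_derivative 1) (at 0 within {0..1}) \<and>
     (f has_real_derivative 1) (at 1 within {0..1}) \<and>
     (\<exists>e>0. convex_on {0..<e} f) \<and>
     (\<exists>e>0. concave_on {1-e<..1} f)"

definition regular_contact_at_0 :: "(real \<Rightarrow> real) \<Rightarrow> real \<Rightarrow> real \<Rightarrow> bool" where
  "regular_contact_at_0 f c p \<longleftrightarrow> (\<exists>h.
     (\<forall>x\<in>{0<..<c}. f x - x = h x * x powr (p + 1)) \<and>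
     (\<forall>k>0. (\<lambda>x. h (k * x)) \<sim>[at_right 0] h))"

definition comparable_contacts :: "(real \<Rightarrow> real) \<Rightarrow> real \<Rightarrow> bool" where
  "comparable_contacts f p \<longleftrightarrow> (\<exists>a>0.
     (\<lambda>x. (1 - x) - f (1 - x)) \<sim>[at_right 0] (\<lambda>x. a powr p * (f x - x)))"

definition thaler_function :: "(real \<Rightarrow> real) \<Rightarrow> bool" where
  "thaler_function f \<longleftrightarrow> f \<in> {0..1} \<rightarrow> {0..1} \<and>
     (\<exists>c\<in>{0<..<1}. \<exists>p>1.
        (\<exists>fl fr. full_branch f c fl fr \<and> almost_expanding f c fl fr) \<and>
        regular_contact_at_0 f c p \<and>
        comparable_contacts f p)"


section \<open>Historical behavior\<close>

definition historical_point :: "(real \<Rightarrow> real) \<Rightarrow> real \<Rightarrow> bool" where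
  "historical_point f x \<longleftrightarrow> (\<exists>\<phi> :: real \<Rightarrow> real. continuous_on {0..1} \<phi> \<and>
     \<not> convergent (\<lambda>n. (\<Sum>j<n. \<phi> ((f ^^ j) x)) / real n))"


section \<open>Empirical measures and their weak* accumulation points\<close>

abbreviation borel_I :: "real measure" where
  "borel_I \<equiv> restrict_space borel {0..1}"

definition empirical_measure :: "(real \<Rightarrow> real) \<Rightarrow> real \<Rightarrow> nat \<Rightarrow> real measure" where
  "empirical_measure f x n = measure_of {0..1} (sets borel_I)
     (\<lambda>A. ennreal (1 / real n) * (\<Sum>j<n. emeasure (return borel_I ((f ^^ j) x)) A))"

text \<open>The measure \<open>l \<delta>\<^sub>0 + (1 - l) \<delta>\<^sub>1\<close>.\<close>

definition endpoint_mixture :: "real \<Rightarrow> real measure" where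
  "endpoint_mixture l = measure_of {0..1} (sets borel_I)
     (\<lambda>A. ennreal l * emeasure (return borel_I 0) A + ennreal (1 - l) * emeasure (return borel_I 1) A)"

definition prob_measures_I :: "real measure set" where
  "prob_measures_I = {M. prob_space M \<and> sets M = sets borel_I}"

definition continuous_I :: "(real \<Rightarrow> real) set" where
  "continuous_I = {\<phi>. continuous_on {0..1} \<phi>}"

text \<open>
  The weak* topology is the initial topology on the Borel probability measures for the maps
  \<open>M \<mapsto> \<integral>\<phi> dM\<close>, where \<open>\<phi>\<close> ranges over the continuous functions on \<open>{0..1}\<close>.
\<close>

definition weak_star_topology :: "real measure topology" where
  "weak_star_topology = pullback_topology prob_measures_I
     (\<lambda>M. \<lambda>\<phi>\<in>continuous_I. integral\<^sup>L M \<phi>)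
     (product_topology (\<lambda>_. euclideanreal) continuous_I)"

text \<open>
  Accumulation points are those of the sequence \<open>n \<mapsto> empirical_measure f x n\<close>, not of its range,
  so an eventually constant sequence accumulates at its limit.
\<close>

definition limit_measures :: "(real \<Rightarrow> real) \<Rightarrow> real \<Rightarrow> real measure set" where
  "limit_measures f x = {M \<in> topspace weak_star_topology.
     \<forall>U. openin weak_star_topology U \<longrightarrow> M \<in> U \<longrightarrow>
       (\<exists>\<^sub>\<infinity>n. n \<ge> 1 \<and> empirical_measure f x n \<in> U)}"

lemma topspace_weak_star_topology: "topspace weak_star_topology = prob_measures_I"
  by (auto simp: weak_star_topology_def topspace_pullback_topology)

lemma space_borel_I: "space borel_I = {0..1}"
  by (simp add: space_restrict_space)

lemma sets_empirical_measure [simp]: "sets (empirical_measure f x n) = sets borel_I"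
  using sets.sets_measure_of_eq[of borel_I] by (simp add: empirical_measure_def space_borel_I)

lemma sets_endpoint_mixture [simp]: "sets (endpoint_mixture l) = sets borel_I"
  using sets.sets_measure_of_eq[of borel_I] by (simp add: endpoint_mixture_def space_borel_I)

lemma emeasure_empirical_measure:
  assumes "A \<in> sets borel_I"
  shows "emeasure (empirical_measure f x n) A =
    ennreal (1 / real n) * (\<Sum>j<n. indicator A ((f ^^ j) x))"
proof -
  let ?m = "\<lambda>A. ennreal (1 / real n) * (\<Sum>j<n. emeasure (return borel_I ((f ^^ j) x)) A)"
  have "countably_additive (sets borel_I) ?m"
  proof (rule countably_additiveI)
    fix B :: "nat \<Rightarrow> real set"
    assume B: "range B \<subseteq> sets borel_I" "disjoint_family B" "\<Union> (range B) \<in> sets borel_I"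
    have *: "(\<Sum>i. emeasure (return borel_I y) (B i)) = emeasure (return borel_I y) (\<Union> (range B))" for y
      using B by (intro suminf_emeasure) auto
    show "(\<Sum>i. ?m (B i)) = ?m (\<Union> (range B))"
      by (simp only: ennreal_suminf_cmult suminf_sum[OF summableI] *)
  qed
  then have "emeasure (empirical_measure f x n) A = ?m A"
    using assms sets.sigma_algebra_axioms[of borel_I] unfolding empirical_measure_def
    by (intro emeasure_measure_of_sigma) (auto simp: positive_def space_borel_I)
  then show ?thesis
    using assms by simp
qed

lemma emeasure_endpoint_mixture:
  assumes "A \<in> sets borel_I"
  shows "emeasure (endpoint_mixture l) A =
    ennreal l * indicator A 0 + ennreal (1 - l) * indicator A 1"
proof -
  let ?m = "\<lambda>A. ennreal l * emeasure (return borel_I 0) A + ennreal (1 - l) * emeasure (return borel_I 1) A"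
  have "countably_additive (sets borel_I) ?m"
  proof (rule countably_additiveI)
    fix B :: "nat \<Rightarrow> real set"
    assume B: "range B \<subseteq> sets borel_I" "disjoint_family B" "\<Union> (range B) \<in> sets borel_I"
    have *: "(\<Sum>i. emeasure (return borel_I y) (B i)) = emeasure (return borel_I y) (\<Union> (range B))" for y
      using B by (intro suminf_emeasure) auto
    show "(\<Sum>i. ?m (B i)) = ?m (\<Union> (range B))"
      by (simp only: ennreal_suminf_cmult suminf_add[OF summableI summableI, symmetric] *)
  qed
  then have "emeasure (endpoint_mixture l) A = ?m A"
    using assms sets.sigma_algebra_axioms[of borel_I] unfolding endpoint_mixture_def
    by (intro emeasure_measure_of_sigma) (auto simp: positive_def space_borel_I)
  then show ?thesis
    using assms by simp
qed

end

theory Submission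
  imports Defs "HOL-Real_Asymp.Real_Asymp"
begin

text \<open>
  Let \<open>u\<close> and \<open>v\<close> be the inverses of the left and of the right branch, and \<open>c\<close> the branch point. Both
  fixed points are indifferent, so an orbit that comes close to \<open>0\<close> or to \<open>1\<close> needs a long time to leave.
  An orbit is therefore a succession of excursions, alternately on the left and on the right of \<open>c\<close>.
  
  Almost every orbit visits \<open>(c, v c)\<close>, the set of the points on the right whose image is on the
  left, infinitely often. The first return map to this interval has the full branches that are inverse to
  \<open>v \<circ> u ^^ Suc i \<circ> v ^^ j\<close>; the pair \<open>(i, j)\<close> records the lengths of the next left and right excursions.
  Distortion is controlled by the total length of the intermediate images of an interval. During one cycle these
  images are disjoint, and from one cycle to the next they shrink geometrically, because \<open>v\<close> contracts \<open>{0..c}\<close>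
  uniformly. So all compositions of these branches have uniformly bounded distortion (\<open>cw_distortion\<close>), and
  the successive pairs form an independent sequence up to bounded factors (\<open>quasi_bernoulli_X\<close>).
  
  The probability that the left excursion lasts at least \<open>n\<close> steps is comparable to \<open>(u ^^ n) 1\<close>.
  This sequence solves a discrete version of \<open>x' = - g x\<close>, where \<open>g x = f x - x\<close> varies regularly with
  exponent \<open>p + 1\<close>. It follows that it decays essentially like \<open>n powr (- 1 / p)\<close>, where \<open>1 / p < 1\<close>, so that the
  excursions have infinite mean; and the comparability of the two contacts makes the right tails comparable to the
  left ones (\<open>tails_regular\<close>).
  
  With such tails the time of the \<open>k\<close>-th return grows faster than any multiple
  of \<open>k\<close> (\<open>S_superlinear\<close>). Moreover, as for sums of independent variables in the domain of attraction
  of a stable law of index less than one, a single excursion exceeds any given multiple of the whole elapsed time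
  infinitely often, on the left as well as on the right (\<open>frequently_hits\<close>).
  
  The sum of the displacements \<open>\<bar>f y - y\<bar>\<close> along an orbit is at most
  proportional to the number of returns, hence is of smaller order than the time; so the fraction of the time spent
  away from the fixed points tends to zero, and the \<open>n\<close>-th empirical measure is asymptotic to
  \<open>(1 - r n) \<delta>\<^sub>0 + r n \<delta>\<^sub>1\<close>, where \<open>r n\<close> is the fraction of the time spent on the right
  (\<open>averages_near_mixture\<close>). By the domination of the past by single excursions, \<open>r\<close> has the lower limit \<open>0\<close> and
  the upper limit \<open>1\<close>. As \<open>r\<close> varies by at most \<open>1 / n\<close> at time \<open>n\<close>, it accumulates at every point of \<open>{0..1}\<close>.
\<close>

section \<open>Quasi-independent sequences\<close>

text \<open>
  This passes from single symbols and single words to sets of them: the countably many pieces are compared one by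
  one. The factors on both sides avoid a division by a measure that may vanish.
\<close>

lemma (in finite_measure) scaled_measure_UN_mono:
  fixes a b :: real
  assumes I: "countable I" and ab: "a \<ge> 0" "b \<ge> 0"
    and A: "\<And>i. i \<in> I \<Longrightarrow> A i \<in> sets M" "disjoint_family_on A I"
    and B: "\<And>i. i \<in> I \<Longrightarrow> B i \<in> sets M" "disjoint_family_on B I"
    and le: "\<And>i. i \<in> I \<Longrightarrow> a * measure M (A i) \<le> b * measure M (B i)"
  shows "a * measure M (\<Union>i\<in>I. A i) \<le> b * measure M (\<Union>i\<in>I. B i)"
proof -
  have "ennreal a * emeasure M (\<Union>i\<in>I. A i) = (\<integral>\<^sup>+i. ennreal a * emeasure M (A i) \<partial>count_space I)"
    using A I by (subst emeasure_UN_countable) (auto simp: nn_integral_cmult)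
  also have "\<dots> \<le> (\<integral>\<^sup>+i. ennreal b * emeasure M (B i) \<partial>count_space I)"
    using le ab by (intro nn_integral_mono)
      (auto simp: emeasure_eq_measure ennreal_mult'[symmetric] intro!: ennreal_leI)
  also have "\<dots> = ennreal b * emeasure M (\<Union>i\<in>I. B i)"
    using B I by (subst emeasure_UN_countable) (auto simp: nn_integral_cmult)
  finally show ?thesis
    using ab by (simp add: emeasure_eq_measure ennreal_mult'[symmetric])
qed

text \<open>
  Given any finite past, the next symbol is distributed like the first one, up to the factors \<open>\<kappa>\<close> and \<open>K\<close>. The
  measure is not normalized; its total mass is absorbed by the two factors.
\<close>

locale quasi_bernoulli = finite_measure M for M :: "'a measure" +
  fixes X :: "nat \<Rightarrow> 'a \<Rightarrow> 'e :: countable" and \<kappa> K :: real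
  assumes X_measurable [measurable]: "\<And>k. X k \<in> M \<rightarrow>\<^sub>M count_space UNIV"
    and \<kappa>_pos: "\<kappa> > 0" and K_pos: "K > 0"
    and cylinder_lower: "\<And>w e. \<kappa> * \<P>(x in M. map (\<lambda>i. X i x) [0..<length w] = w)
        * \<P>(x in M. X 0 x = e)
      \<le> \<P>(x in M. map (\<lambda>i. X i x) [0..<length w] = w \<and> X (length w) x = e)"
    and cylinder_upper: "\<And>w e. \<P>(x in M. map (\<lambda>i. X i x) [0..<length w] = w \<and> X (length w) x = e)
      \<le> K * \<P>(x in M. map (\<lambda>i. X i x) [0..<length w] = w)
          * \<P>(x in M. X 0 x = e)"
begin

definition hist :: "nat \<Rightarrow> 'a \<Rightarrow> 'e list" where
  "hist k x = map (\<lambda>i. X i x) [0..<k]"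

definition q :: "'e set \<Rightarrow> real" where
  "q E = \<P>(x in M. X 0 x \<in> E)"

lemma length_hist [simp]: "length (hist k x) = k"
  by (simp add: hist_def)

lemma hist_Suc: "hist (Suc k) x = hist k x @ [X k x]"
  by (simp add: hist_def)

lemma take_hist: "j \<le> k \<Longrightarrow> take j (hist k x) = hist j x"
  by (simp add: hist_def take_map)

lemma hist_measurable [measurable]: "hist k \<in> M \<rightarrow>\<^sub>M count_space UNIV"
proof (induction k)
  case 0
  show ?case by (simp add: hist_def)
next
  case (Suc k)
  note [measurable] = Suc
  have "(\<lambda>x. (\<lambda>p. fst p @ [snd p]) (hist k x, X k x)) \<in> M \<rightarrow>\<^sub>M count_space UNIV"
    by (rule measurable_compose[of _ _ "count_space UNIV \<Otimes>\<^sub>M count_space UNIV"])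
       (auto simp: pair_measure_countable)
  then show ?case by (simp add: hist_Suc)
qed

lemma q_nonneg: "q E \<ge> 0"
  by (simp add: q_def)

lemma word_upper:
  "\<P>(x in M. hist (length w) x = w \<and> X (length w) x \<in> E)
     \<le> K * \<P>(x in M. hist (length w) x = w) * q E"
proof -
  let ?A = "\<lambda>e. {x \<in> space M. hist (length w) x = w \<and> X (length w) x = e}"
  let ?B = "\<lambda>e. {x \<in> space M. X 0 x = e}"
  have "1 * measure M (\<Union>e\<in>E. ?A e) \<le> (K * \<P>(x in M. hist (length w) x = w)) * measure M (\<Union>e\<in>E. ?B e)"
    using cylinder_upper[of w] K_pos
    by (intro scaled_measure_UN_mono) (auto simp: disjoint_family_on_def hist_def[symmetric])
  moreover have "(\<Union>e\<in>E. ?A e) = {x \<in> space M. hist (length w) x = w \<and> X (length w) x \<in> E}" by auto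
  moreover have "(\<Union>e\<in>E. ?B e) = {x \<in> space M. X 0 x \<in> E}" by auto
  ultimately show ?thesis by (simp add: q_def)
qed

lemma word_lower:
  "\<kappa> * \<P>(x in M. hist (length w) x = w) * q E
     \<le> \<P>(x in M. hist (length w) x = w \<and> X (length w) x \<in> E)"
proof -
  let ?A = "\<lambda>e. {x \<in> space M. hist (length w) x = w \<and> X (length w) x = e}"
  let ?B = "\<lambda>e. {x \<in> space M. X 0 x = e}"
  have "(\<kappa> * \<P>(x in M. hist (length w) x = w)) * measure M (\<Union>e\<in>E. ?B e) \<le> 1 * measure M (\<Union>e\<in>E. ?A e)"
    using cylinder_lower[of w] \<kappa>_pos
    by (intro scaled_measure_UN_mono) (auto simp: disjoint_family_on_def hist_def[symmetric])
  moreover have "(\<Union>e\<in>E. ?A e) = {x \<in> space M. hist (length w) x = w \<and> X (length w) x \<in> E}" by auto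
  moreover have "(\<Union>e\<in>E. ?B e) = {x \<in> space M. X 0 x \<in> E}" by auto
  ultimately show ?thesis by (simp add: q_def)
qed

text \<open>
  Every event that depends only on the first \<open>k\<close> symbols can serve as the past, since it is a countable disjoint union
  of cylinders.
\<close>

lemma history_upper:
  "\<P>(x in M. hist k x \<in> W \<and> X k x \<in> E) \<le> K * q E * \<P>(x in M. hist k x \<in> W)"
proof -
  let ?I = "{w \<in> W. length w = k}"
  let ?A = "\<lambda>w. {x \<in> space M. hist k x = w \<and> X k x \<in> E}"
  let ?B = "\<lambda>w. {x \<in> space M. hist k x = w}"
  have "1 * measure M (\<Union>w\<in>?I. ?A w) \<le> (K * q E) * measure M (\<Union>w\<in>?I. ?B w)"
    using word_upper[of _ E] K_pos q_nonneg
    by (intro scaled_measure_UN_mono) (auto simp: disjoint_family_on_def ac_simps)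
  moreover have "(\<Union>e\<in>?I. ?A e) = {x \<in> space M. hist k x \<in> W \<and> X k x \<in> E}" by auto
  moreover have "(\<Union>e\<in>?I. ?B e) = {x \<in> space M. hist k x \<in> W}" by auto
  ultimately show ?thesis by simp
qed

lemma history_lower:
  "\<kappa> * q E * \<P>(x in M. hist k x \<in> W) \<le> \<P>(x in M. hist k x \<in> W \<and> X k x \<in> E)"
proof -
  let ?I = "{w \<in> W. length w = k}"
  let ?A = "\<lambda>w. {x \<in> space M. hist k x = w \<and> X k x \<in> E}"
  let ?B = "\<lambda>w. {x \<in> space M. hist k x = w}"
  have "(\<kappa> * q E) * measure M (\<Union>w\<in>?I. ?B w) \<le> 1 * measure M (\<Union>w\<in>?I. ?A w)"
    using word_lower[of _ E] \<kappa>_pos q_nonneg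
    by (intro scaled_measure_UN_mono) (auto simp: disjoint_family_on_def ac_simps)
  moreover have "(\<Union>e\<in>?I. ?A e) = {x \<in> space M. hist k x \<in> W \<and> X k x \<in> E}" by auto
  moreover have "(\<Union>e\<in>?I. ?B e) = {x \<in> space M. hist k x \<in> W}" by auto
  ultimately show ?thesis by simp
qed

text \<open>
  Each further symbol avoids \<open>E\<close> with conditional probability at most \<open>1 - \<kappa> * q E\<close>, and \<open>1 - t \<le> exp (- t)\<close>.
\<close>

lemma avoidance_bound:
  "\<P>(x in M. \<forall>i<k. X i x \<notin> E) \<le> exp (- \<kappa> * q E * real k) * measure M (space M)"
proof (induction k)
  case 0
  show ?case by simp
next
  case (Suc k)
  let ?W = "{w. \<forall>i<k. w ! i \<notin> E}"
  let ?N = "{x \<in> space M. \<forall>i<k. X i x \<notin> E}"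
  have eq: "{x \<in> space M. hist k x \<in> ?W} = ?N"
    by (auto simp: hist_def)
  have eq2: "{x \<in> space M. hist k x \<in> ?W \<and> X k x \<in> E} = {x \<in> space M. (\<forall>i<k. X i x \<notin> E) \<and> X k x \<in> E}"
    by (auto simp: hist_def)
  have "{x \<in> space M. \<forall>i<Suc k. X i x \<notin> E} = ?N - {x \<in> space M. (\<forall>i<k. X i x \<notin> E) \<and> X k x \<in> E}"
    by (auto simp: less_Suc_eq)
  then have "\<P>(x in M. \<forall>i<Suc k. X i x \<notin> E)
      = measure M ?N - \<P>(x in M. (\<forall>i<k. X i x \<notin> E) \<and> X k x \<in> E)"
    by (simp add: finite_measure_Diff subset_eq)
  also have "\<dots> \<le> measure M ?N - \<kappa> * q E * measure M ?N"
    using history_lower[of E k ?W] unfolding eq eq2 by simp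
  also have "\<dots> = (1 - \<kappa> * q E) * measure M ?N" by (simp add: algebra_simps)
  also have "\<dots> \<le> exp (- \<kappa> * q E) * measure M ?N"
    using exp_ge_add_one_self[of "- \<kappa> * q E"] by (intro mult_right_mono) auto
  also have "\<dots> \<le> exp (- \<kappa> * q E) * (exp (- \<kappa> * q E * real k) * measure M (space M))"
    by (intro mult_left_mono Suc) auto
  also have "\<dots> = exp (- \<kappa> * q E * real (Suc k)) * measure M (space M)"
    by (simp add: exp_add[symmetric] mult.assoc[symmetric]) (simp add: algebra_simps)
  finally show ?case .
qed

end

text \<open>
  Symbols have lengths; \<open>\<tau>\<close> is a reference tail. The assumption \<open>truncated_mean\<close> says that the mean of the lengths
  truncated at \<open>s\<close> is at most of the order \<open>s * \<tau> s\<close>. This is the behavior of a regularly varying tail of index less than one: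
  the truncated mean is governed by the lengths close to the truncation level.
\<close>

locale heavy_tailed_lengths = quasi_bernoulli M X \<kappa> K
  for M :: "'a measure" and X :: "nat \<Rightarrow> 'a \<Rightarrow> 'e :: countable" and \<kappa> K +
  fixes len :: "'e \<Rightarrow> nat" and \<tau> :: "nat \<Rightarrow> real" and C \<gamma> \<eta> :: real
  assumes len_ge_1: "\<And>e. len e \<ge> 1"
    and \<tau>_pos: "\<And>r. \<tau> r > 0" and \<tau>_lim: "\<tau> \<longlonglongrightarrow> 0"
    and C_pos: "C > 0" and truncated_mean: "\<And>s. s \<ge> 1 \<Longrightarrow> (\<Sum>r=1..s. q {e. len e \<ge> r}) \<le> C * real s * \<tau> s"
    and \<gamma>: "\<gamma> < 1" and \<eta>: "\<eta> > 0"
    and heavy_tail: "\<And>r. r \<ge> 1 \<Longrightarrow> \<eta> * real r powr - \<gamma> \<le> q {e. len e \<ge> r}"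
begin

definition S :: "nat \<Rightarrow> 'a \<Rightarrow> nat" where
  "S k x = (\<Sum>i<k. len (X i x))"

lemma S_hist: "S k x = sum_list (map len (hist k x))"
  by (simp add: S_def hist_def sum_list_distinct_conv_sum_set comp_def atLeast0LessThan)

lemma S_Suc: "S (Suc k) x = S k x + len (X k x)"
  by (simp add: S_def)

lemma S_ge: "S k x \<ge> k"
  using len_ge_1 by (induction k) (auto simp: S_Suc S_def intro: le_trans add_mono Suc_leI)

lemma S_measurable [measurable]: "S k \<in> M \<rightarrow>\<^sub>M count_space UNIV"
  unfolding S_hist[abs_def] by measurable

lemma hit_measurable [measurable]: "{x \<in> space M. X k x \<in> E (m * S k x)} \<in> sets M"
proof -
  have "{x \<in> space M. X k x \<in> E (m * S k x)}
    = (\<Union>r. {x \<in> space M. X k x \<in> E (m * r)} \<inter> (S k -` {r} \<inter> space M))" by auto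
  also have "\<dots> \<in> sets M" by measurable
  finally show ?thesis .
qed

lemma hist_eqD:
  assumes "hist k x = hist k y" "j < k"
  shows "X j x = X j y" "S j x = S j y"
proof -
  show "X j x = X j y"
    using arg_cong[OF assms(1), of "\<lambda>w. w ! j"] assms(2) by (simp add: hist_def)
  have "hist j x = hist j y"
    using arg_cong[OF assms(1), of "take j"] assms(2) by (simp add: take_hist)
  then show "S j x = S j y" by (simp add: S_hist)
qed

text \<open>
  The largest of the first \<open>k\<close> lengths already exceeds \<open>m * k\<close>: the probability of the contrary is at most
  \<open>exp (- const * k powr (1 - \<gamma>))\<close>, which is summable because \<open>\<gamma> < 1\<close>.
\<close>

lemma S_superlinear: "AE x in M. \<forall>m::nat. \<forall>\<^sub>F k in sequentially. m * k \<le> S k x"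
proof -
  have "AE x in M. \<forall>\<^sub>F k in sequentially. m * k \<le> S k x" if m: "m \<ge> 1" for m :: nat
  proof -
    let ?A = "\<lambda>k. {x \<in> space M. \<forall>i<k. X i x \<notin> {e. len e \<ge> m * k}}"
    let ?b = "\<lambda>k::nat. exp (- (\<kappa> * \<eta> * real m powr - \<gamma>) * real k powr (1 - \<gamma>)) * measure M (space M)"
    have bound: "measure M (?A k) \<le> ?b k" if "k \<ge> 1" for k
    proof -
      have "\<kappa> * (\<eta> * real (m * k) powr - \<gamma>) * real k \<le> \<kappa> * q {e. len e \<ge> m * k} * real k"
        using heavy_tail[of "m * k"] m that \<kappa>_pos by (intro mult_right_mono mult_left_mono) auto
      moreover have "\<kappa> * (\<eta> * real (m * k) powr - \<gamma>) * real k = (\<kappa> * \<eta> * real m powr - \<gamma>) * real k powr (1 - \<gamma>)"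
        using m that by (simp add: powr_mult powr_diff powr_minus field_simps)
      ultimately have "exp (- \<kappa> * q {e. len e \<ge> m * k} * real k) \<le> exp (- (\<kappa> * \<eta> * real m powr - \<gamma>) * real k powr (1 - \<gamma>))"
        unfolding exp_le_cancel_iff mult_minus_left neg_le_iff_le by linarith
      then have "exp (- \<kappa> * q {e. len e \<ge> m * k} * real k) * measure M (space M) \<le> ?b k"
        by (intro mult_right_mono) auto
      with avoidance_bound[of k "{e. len e \<ge> m * k}"] show ?thesis by linarith
    qed
    have "summable ?b"
    proof (rule summable_mult2)
      define c where "c = \<kappa> * \<eta> * real m powr - \<gamma>"
      have c: "c > 0" using \<kappa>_pos \<eta> m by (simp add: c_def)
      define b where "b = 1 - \<gamma>"
      have b: "b > 0" using \<gamma> by (simp add: b_def)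
      have "(\<lambda>k. exp (- c * real k powr b)) \<in> O(\<lambda>k. real k powr - 2)"
        using c b by real_asymp
      then have "summable (\<lambda>k. exp (- c * real k powr b))"
        by (rule summable_comparison_test_bigo[rotated]) (simp add: summable_real_powr_iff)
      then show "summable (\<lambda>k. exp (- (\<kappa> * \<eta> * real m powr - \<gamma>) * real k powr (1 - \<gamma>)))"
        by (simp add: c_def b_def)
    qed
    then have summ: "summable (\<lambda>k. measure M (?A k))"
      by (rule summable_comparison_test'[where N = 1]) (use bound in auto)
    have "AE x in M. \<forall>\<^sub>F k in sequentially. x \<in> space M - ?A k"
    proof (rule borel_cantelli_AE1[OF _ _ summ])
      show "?A k \<in> sets M" for k by measurable
      show "emeasure M (?A k) < \<infinity>" for k
        by (simp only: emeasure_eq_measure infinity_ennreal_def ennreal_less_top)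
    qed
    then show ?thesis
    proof (rule AE_mp, intro AE_I2 impI)
      fix x assume "\<forall>\<^sub>F k in sequentially. x \<in> space M - ?A k"
      then show "\<forall>\<^sub>F k in sequentially. m * k \<le> S k x"
      proof eventually_elim
        case (elim k)
        then obtain i where "i < k" "m * k \<le> len (X i x)" by auto
        moreover have "len (X i x) \<le> S k x"
          unfolding S_def using \<open>i < k\<close> by (intro member_le_sum) auto
        ultimately show ?case by linarith
      qed
    qed
  qed
  then have "AE x in M. \<forall>\<^sub>F k in sequentially. m * k \<le> S k x" for m :: nat
    by (cases "m = 0") auto
  then show ?thesis by (simp add: AE_all_countable)
qed

text \<open>
  Markov's inequality for the lengths truncated at \<open>s\<close>. If the sum of the lengths exceeds \<open>s\<close>, then the sum of the
  truncated lengths is still at least \<open>s\<close>, whether or not one of the lengths exceeds \<open>s\<close>.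
\<close>

lemma expected_excess:
  assumes s: "s \<ge> 1"
  shows "\<P>(x in M. hist k x = w \<and> (\<Sum>j<i. len (X (k+j) x)) > s)
    \<le> real i * K * C * \<tau> s * \<P>(x in M. hist k x = w)"
proof -
  let ?w = "{x \<in> space M. hist k x = w}"
  let ?B = "{x \<in> space M. hist k x = w \<and> (\<Sum>j<i. len (X (k+j) x)) > s}"
  let ?E = "\<lambda>j r. {x \<in> space M. hist k x = w \<and> len (X (k+j) x) \<ge> r}"
  have le: "measure M (?E j r) \<le> K * q {e. len e \<ge> r} * measure M ?w" for j r
  proof -
    have "{x \<in> space M. hist (k+j) x \<in> {v. take k v = w}} = ?w"
      by (auto simp: take_hist)
    moreover have "{x \<in> space M. hist (k+j) x \<in> {v. take k v = w} \<and> X (k+j) x \<in> {e. len e \<ge> r}} = ?E j r"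
      by (auto simp: take_hist)
    ultimately show ?thesis
      using history_upper[of "k+j" "{v. take k v = w}" "{e. len e \<ge> r}"] by simp
  qed
  have ind: "real s * indicator ?B x \<le> (\<Sum>j<i. \<Sum>r=1..s. indicator (?E j r) x :: real)" for x
  proof (cases "x \<in> ?B")
    case True
    have min_eq: "(\<Sum>r=1..s. indicator (?E j r) x :: real) = real (min (len (X (k+j) x)) s)" for j
    proof -
      have "(\<Sum>r=1..s. indicator (?E j r) x :: real) = (\<Sum>r\<in>{1..s}. if r \<le> len (X (k+j) x) then 1 else 0)"
        using True by (intro sum.cong) (auto simp: indicator_def)
      also have "\<dots> = real (card ({1..s} \<inter> {r. r \<le> len (X (k+j) x)}))"
        by (simp add: sum.If_cases)
      also have "{1..s} \<inter> {r. r \<le> len (X (k+j) x)} = {1..min (len (X (k+j) x)) s}"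
        by auto
      finally show ?thesis by simp
    qed
    have "s \<le> (\<Sum>j<i. min (len (X (k+j) x)) s)"
    proof (cases "\<exists>j<i. len (X (k+j) x) \<ge> s")
      case True
      then obtain j where "j < i" "len (X (k+j) x) \<ge> s" by auto
      then show ?thesis
        using member_le_sum[of j "{..<i}" "\<lambda>j. min (len (X (k+j) x)) s"] by auto
    next
      case False
      then have "(\<Sum>j<i. min (len (X (k+j) x)) s) = (\<Sum>j<i. len (X (k+j) x))"
        by (intro sum.cong) (auto simp: not_le)
      then show ?thesis using \<open>x \<in> ?B\<close> by simp
    qed
    then have "real s \<le> (\<Sum>j<i. real (min (len (X (k+j) x)) s))"
      unfolding of_nat_sum[symmetric] of_nat_le_iff .
    then show ?thesis using True unfolding min_eq by simp
  qed (auto intro!: sum_nonneg)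
  have "real s * measure M ?B = (\<integral>x. real s * indicator ?B x \<partial>M)"
    by simp
  also have "\<dots> \<le> (\<integral>x. (\<Sum>j<i. \<Sum>r=1..s. indicator (?E j r) x) \<partial>M)"
    by (intro integral_mono ind) (auto simp: integrable_real_indicator emeasure_eq_measure)
  also have "\<dots> = (\<Sum>j<i. \<Sum>r=1..s. measure M (?E j r))"
    by (simp add: emeasure_eq_measure)
  also have "\<dots> \<le> (\<Sum>j<i. \<Sum>r=1..s. K * q {e. len e \<ge> r} * measure M ?w)"
    by (intro sum_mono le)
  also have "\<dots> = real i * K * measure M ?w * (\<Sum>r=1..s. q {e. len e \<ge> r})"
    by (simp add: sum_distrib_left sum_distrib_right ac_simps)
  also have "\<dots> \<le> real i * K * measure M ?w * (C * real s * \<tau> s)"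
    using K_pos by (intro mult_left_mono truncated_mean s) auto
  finally have "real s * measure M ?B \<le> real s * (real i * K * C * \<tau> s * measure M ?w)"
    by (simp add: ac_simps)
  then show ?thesis using s by simp
qed

text \<open>
  From elapsed time \<open>s\<close> on, about \<open>1 / \<tau> s\<close> further symbols are considered. Their lengths sum up to at most \<open>s\<close> with
  probability at least one half, and as long as they do, each new symbol lies in \<open>E (2 * m * s)\<close> with
  probability at least of the order \<open>\<tau> s\<close>. These events are disjoint for different symbols, so one of them occurs with a
  probability that is bounded from below. At this moment the elapsed time is at most \<open>2 * s\<close>.
\<close>

lemma uniform_hitting:
  fixes E :: "nat \<Rightarrow> 'e set" and m :: nat
  assumes E_len: "\<And>r e. e \<in> E r \<Longrightarrow> len e \<ge> r"
    and E_mono: "\<And>r r'. r \<le> r' \<Longrightarrow> E r' \<subseteq> E r"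
    and \<theta>: "\<theta> > 0" "\<And>s. s \<ge> 1 \<Longrightarrow> \<theta> * \<tau> s \<le> q (E (2 * m * s))"
    and m: "m \<ge> 1"
  shows "\<exists>k0\<ge>1. \<exists>\<delta>\<in>{0<..1}. \<forall>k\<ge>k0. \<forall>w. \<exists>n. 
           \<delta> * \<P>(x in M. hist k x = w)
           \<le> \<P>(x in M. hist k x = w \<and> (\<exists>i<n. X (k+i) x \<in> E (m * S (k+i) x)))"
proof -
  \<comment> \<open>With \<open>n \<le> \<epsilon> / \<tau> s\<close> further symbols, \<open>expected_excess\<close> gives an excess probability of at most one half.\<close>
  define \<epsilon> where "\<epsilon> = 1 / (2 * K * C)"
  have \<epsilon>: "\<epsilon> > 0" using K_pos C_pos by (simp add: \<epsilon>_def)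
  have "\<forall>\<^sub>F s in sequentially. \<tau> s < \<epsilon>"
    using order_tendstoD(2)[OF \<tau>_lim \<epsilon>] .
  then obtain k0 where k0: "\<And>s. s \<ge> k0 \<Longrightarrow> \<tau> s < \<epsilon>"
    by (auto simp: eventually_sequentially)
  define \<delta> where "\<delta> = min 1 (\<epsilon> / 2 * (\<kappa> * \<theta> / 2))"
  have \<delta>: "\<delta> \<in> {0<..1}" using \<epsilon> \<kappa>_pos \<theta> by (auto simp: \<delta>_def)
  have "\<exists>n. \<delta> * \<P>(x in M. hist k x = w)
           \<le> \<P>(x in M. hist k x = w \<and> (\<exists>i<n. X (k+i) x \<in> E (m * S (k+i) x)))"
    if k: "k \<ge> max 1 k0" for k w
  proof -
    let ?w = "{x \<in> space M. hist k x = w}"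
    define s where "s = sum_list (map len w)"
    show ?thesis
    proof (cases "?w = {}")
      case True
      then have "measure M ?w = 0" by (metis measure_empty)
      then show ?thesis by (auto intro!: exI[of _ 0])
    next
      case False
      then obtain x where "hist k x = w" by auto
      then have "s = S k x" by (simp add: s_def S_hist)
      then have s: "s \<ge> k" using S_ge by simp
      then have s1: "s \<ge> 1" and \<tau>s: "\<tau> s < \<epsilon>" using k k0 by auto
      have Sk: "S k x = s" if "hist k x = w" for x using that by (simp add: S_hist s_def)
      have S_add: "S (k+i) x = S k x + (\<Sum>j<i. len (X (k+j) x))" for i x
        by (induction i) (auto simp: S_Suc)
      define n where "n = nat \<lfloor>\<epsilon> / \<tau> s\<rfloor>"
      have n_le: "real n \<le> \<epsilon> / \<tau> s" using \<epsilon> \<tau>_pos[of s] by (simp add: n_def)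
      have ge1: "\<epsilon> / \<tau> s \<ge> 1" using \<tau>s \<tau>_pos[of s] by simp
      have n_ge: "real n \<ge> \<epsilon> / \<tau> s / 2"
      proof -
        have "\<lfloor>\<epsilon> / \<tau> s\<rfloor> \<ge> 1" using ge1 by (simp only: one_le_floor)
        then have "real n \<ge> 1" and "real n = of_int \<lfloor>\<epsilon> / \<tau> s\<rfloor>" by (simp_all add: n_def)
        moreover have "\<epsilon> / \<tau> s < of_int \<lfloor>\<epsilon> / \<tau> s\<rfloor> + 1" by linarith
        ultimately have "\<epsilon> / \<tau> s < real n + 1" "real n \<ge> 1" by simp_all
        then show ?thesis by simp
      qed
      let ?T = "\<lambda>i. {x \<in> space M. hist k x = w \<and> (\<Sum>j<i. len (X (k+j) x)) \<le> s}"
      let ?D = "\<lambda>i. {x \<in> space M. hist k x = w \<and> (\<Sum>j<i. len (X (k+j) x)) \<le> s \<and> X (k+i) x \<in> E (2 * m * s)}"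
      let ?V = "\<lambda>i. {v. take k v = w \<and> sum_list (map len (drop k v)) \<le> s}"
      have drop_sum: "sum_list (map len (drop k (hist (k+i) x))) = (\<Sum>j<i. len (X (k+j) x))" for i x
      proof -
        have "hist (k+i) x = hist k x @ map (\<lambda>j. X (k+j) x) [0..<i]"
          by (induction i) (simp_all add: hist_Suc)
        then show ?thesis
          by (simp add: sum_list_distinct_conv_sum_set comp_def atLeast0LessThan)
      qed
      have T: "measure M (?T i) \<ge> measure M ?w / 2" if i: "i < n" for i
      proof -
        let ?B = "{x \<in> space M. hist k x = w \<and> (\<Sum>j<i. len (X (k+j) x)) > s}"
        have "?T i = ?w - ?B" by auto
        then have "measure M (?T i) = measure M ?w - measure M ?B"
          by (simp add: finite_measure_Diff subset_eq)
        moreover have "measure M ?B \<le> real i * (K * C * \<tau> s) * measure M ?w"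
          using expected_excess[OF s1, of k w i] by (simp add: ac_simps)
        moreover have "real i * (K * C * \<tau> s) * measure M ?w \<le> (\<epsilon> / \<tau> s) * (K * C * \<tau> s) * measure M ?w"
          using i n_le K_pos C_pos \<tau>_pos[of s] by (intro mult_right_mono) auto
        moreover have half: "(\<epsilon> / \<tau> s) * (K * C * \<tau> s) = 1 / 2"
          using \<tau>_pos[of s] K_pos C_pos by (simp add: \<epsilon>_def)
        ultimately show ?thesis unfolding half by linarith
      qed
      have D: "measure M (?D i) \<ge> \<kappa> * \<theta> / 2 * \<tau> s * measure M ?w" if i: "i < n" for i
      proof -
        have e1: "{x \<in> space M. hist (k+i) x \<in> ?V i} = ?T i"
          by (auto simp: take_hist drop_sum)
        have e2: "{x \<in> space M. hist (k+i) x \<in> ?V i \<and> X (k+i) x \<in> E (2 * m * s)} = ?D i"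
          by (auto simp: take_hist drop_sum)
        have "\<kappa> * (\<theta> * \<tau> s) * (measure M ?w / 2) \<le> \<kappa> * q (E (2 * m * s)) * measure M (?T i)"
          using \<kappa>_pos \<theta> \<tau>_pos[of s] T[OF i] s1 q_nonneg by (intro mult_mono) auto
        also have "\<dots> \<le> measure M (?D i)"
          using history_lower[of "E (2 * m * s)" "k+i" "?V i"] unfolding e1 e2 .
        finally show ?thesis by (simp add: ac_simps)
      qed
      \<comment> \<open>A symbol in \<open>E (2 * m * s)\<close> is longer than \<open>s\<close>, so no later sum of lengths is at most \<open>s\<close>.\<close>
      have disj: "disjoint_family_on ?D {..<n}"
      proof -
        have lt: "?D i \<inter> ?D j = {}" if "i < j" for i j
        proof -
          have "False" if x: "x \<in> ?D i" "x \<in> ?D j" for x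
          proof -
            have "len (X (k+i) x) \<ge> 2 * m * s" using x E_len by auto
            moreover have "2 * m * s > s" using m s1 by simp
            moreover have "(\<Sum>j<j. len (X (k+j) x)) \<le> s" using x by simp
            moreover have "len (X (k+i) x) \<le> (\<Sum>j<j. len (X (k+j) x))"
              using \<open>i < j\<close> by (intro member_le_sum[of i _ "\<lambda>j. len (X (k+j) x)"]) auto
            ultimately show False by linarith
          qed
          then show ?thesis by (meson disjoint_iff)
        qed
        show ?thesis
          unfolding disjoint_family_on_def
        proof (intro ballI impI)
          fix i j :: nat assume "i \<noteq> j"
          then consider "i < j" | "j < i" by linarith
          then show "?D i \<inter> ?D j = {}"
          proof cases
            case 2
            then show ?thesis using lt[of j i] by (simp only: Int_commute)
          qed (rule lt)
        qed
      qed
      have "\<delta> * measure M ?w \<le> (\<epsilon> / 2 * (\<kappa> * \<theta> / 2)) * measure M ?w"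
        by (intro mult_right_mono) (auto simp: \<delta>_def)
      also have "\<dots> = (\<epsilon> / \<tau> s / 2) * (\<kappa> * \<theta> / 2 * \<tau> s * measure M ?w)"
        using \<tau>_pos[of s] by simp
      also have "\<dots> \<le> real n * (\<kappa> * \<theta> / 2 * \<tau> s * measure M ?w)"
        using n_ge \<kappa>_pos \<theta> \<tau>_pos[of s] by (intro mult_right_mono) auto
      also have "\<dots> = (\<Sum>i<n. \<kappa> * \<theta> / 2 * \<tau> s * measure M ?w)" by simp
      also have "\<dots> \<le> (\<Sum>i<n. measure M (?D i))" by (intro sum_mono D) auto
      also have "\<dots> = measure M (\<Union>i<n. ?D i)"
        using disj by (intro finite_measure_finite_Union[symmetric]) auto
      also have "\<dots> \<le> \<P>(x in M. hist k x = w \<and> (\<exists>i<n. X (k+i) x \<in> E (m * S (k+i) x)))"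
      proof (rule finite_measure_mono)
        show "(\<Union>i<n. ?D i) \<subseteq> {x \<in> space M. hist k x = w \<and> (\<exists>i<n. X (k+i) x \<in> E (m * S (k+i) x))}"
        proof safe
          fix i x assume *: "i < n" "w = hist k x" "(\<Sum>j<i. len (X (k+j) x)) \<le> s" "X (k+i) x \<in> E (2 * m * s)"
          have "S (k+i) x \<le> 2 * s" using * S_add[of i x] Sk[of x] by simp
          then have "m * S (k+i) x \<le> 2 * m * s" by simp
          then show "\<exists>i<n. X (k+i) x \<in> E (m * S (k+i) x)" using * E_mono by blast
        qed
        have "{x \<in> space M. hist k x = w \<and> (\<exists>i<n. X (k+i) x \<in> E (m * S (k+i) x))}
          = ?w \<inter> (\<Union>i<n. {x \<in> space M. X (k+i) x \<in> E (m * S (k+i) x)})" by auto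
        also have "\<dots> \<in> sets M" by measurable
        finally show "{x \<in> space M. hist k x = w \<and> (\<exists>i<n. X (k+i) x \<in> E (m * S (k+i) x))} \<in> sets M" .
      qed
      finally show ?thesis by blast
    qed
  qed
  then show ?thesis using \<delta> by (intro exI[of _ "max 1 k0"] conjI bexI[of _ \<delta>]) auto
qed

text \<open>
  By \<open>uniform_hitting\<close>, the part of a cylinder that is never hit is covered by cylinders which have not been hit so far
  and carry only the fraction \<open>1 - \<delta>\<close> of its measure. Iteration shows that it is a null set.
\<close>

lemma frequently_hits:
  fixes E :: "nat \<Rightarrow> 'e set"
  assumes E_len: "\<And>r e. e \<in> E r \<Longrightarrow> len e \<ge> r"
    and E_mono: "\<And>r r'. r \<le> r' \<Longrightarrow> E r' \<subseteq> E r"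
    and E_heavy: "\<And>m. m \<ge> 1 \<Longrightarrow> \<exists>\<theta>>0. \<forall>s\<ge>1. \<theta> * \<tau> s \<le> q (E (m * s))"
  shows "AE x in M. \<forall>m::nat. \<exists>\<^sub>\<infinity>k. X k x \<in> E (m * S k x)"
proof -
  have large_m: "AE x in M. \<exists>\<^sub>\<infinity>k. X k x \<in> E (m * S k x)" if m: "m \<ge> 1" for m :: nat
  proof -
    obtain \<theta> where \<theta>: "\<theta> > 0" "\<And>s. s \<ge> 1 \<Longrightarrow> \<theta> * \<tau> s \<le> q (E (2 * m * s))"
      using E_heavy[of "2 * m"] m by auto
    obtain k0 \<delta> where k0: "k0 \<ge> 1" and \<delta>: "\<delta> \<in> {0<..1}" and hit: "\<And>k w. k \<ge> k0 \<Longrightarrow> \<exists>n.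
           \<delta> * \<P>(x in M. hist k x = w)
           \<le> \<P>(x in M. hist k x = w \<and> (\<exists>i<n. X (k+i) x \<in> E (m * S (k+i) x)))"
      using uniform_hitting[OF E_len E_mono \<theta> m] by blast
    have "AE x in M. \<exists>k\<ge>k1. X k x \<in> E (m * S k x)" if k1: "k1 \<ge> k0" for k1
    proof -
      let ?A = "\<lambda>k w. {x \<in> space M. hist k x = w \<and> (\<forall>k\<ge>k1. X k x \<notin> E (m * S k x))}"
      have A_meas [measurable]: "?A k w \<in> sets M" for k w
      proof -
        have "?A k w = {x \<in> space M. hist k x = w} - (\<Union>k\<in>{k1..}. {x \<in> space M. X k x \<in> E (m * S k x)})"
          by auto
        then show ?thesis by simp
      qed
      have decay: "measure M (?A k w) \<le> (1 - \<delta>) ^ N * \<P>(x in M. hist k x = w)" 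
        if "k \<ge> k1" for N k w
        using that
      proof (induction N arbitrary: k w)
        case 0
        show ?case by (auto intro!: finite_measure_mono)
      next
        case (Suc N)
        let ?w = "{x \<in> space M. hist k x = w}"
        obtain n where n: "\<delta> * measure M ?w
            \<le> \<P>(x in M. hist k x = w \<and> (\<exists>i<n. X (k+i) x \<in> E (m * S (k+i) x)))"
          (is "_ \<le> measure M ?H")
          using hit[of k w] Suc.prems k1 by auto
        have H_meas: "?H \<in> sets M"
        proof -
          have "?H = ?w \<inter> (\<Union>i<n. {x \<in> space M. X (k+i) x \<in> E (m * S (k+i) x)})" by auto
          then show ?thesis by simp
        qed
        \<comment> \<open>The continuations of \<open>w\<close> by \<open>n\<close> symbols that have not been hit.\<close>
        define I where "I = hist (k+n) ` (?w - ?H)"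
        have I: "x \<in> ?w - ?H" if xI: "x \<in> space M" "hist (k+n) x \<in> I" for x
        proof -
          obtain y where y: "y \<in> ?w - ?H" "hist (k+n) x = hist (k+n) y"
            using xI(2) unfolding I_def by blast
          have "hist k x = hist k y"
            using arg_cong[OF y(2), of "take k"] by (simp add: take_hist)
          then show ?thesis
            using y xI(1) hist_eqD[OF y(2)] by auto
        qed
        have w'_eq: "(\<Union>w'\<in>I. {x \<in> space M. hist (k+n) x = w'}) = ?w - ?H"
        proof (intro equalityI subsetI)
          fix x assume "x \<in> (\<Union>w'\<in>I. {x \<in> space M. hist (k+n) x = w'})"
          then have "x \<in> space M" "hist (k+n) x \<in> I" by blast+
          then show "x \<in> ?w - ?H" by (rule I)
        next
          fix x assume x: "x \<in> ?w - ?H"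
          then have "hist (k+n) x \<in> I" unfolding I_def by (rule imageI)
          with x show "x \<in> (\<Union>w'\<in>I. {x \<in> space M. hist (k+n) x = w'})" by blast
        qed
        have sub: "?A k w \<subseteq> (\<Union>w'\<in>I. ?A (k+n) w')"
        proof
          fix x assume x: "x \<in> ?A k w"
          then have "x \<in> ?w - ?H" using Suc.prems by (simp add: trans_le_add1)
          then have "hist (k+n) x \<in> I" unfolding I_def by (rule imageI)
          with x show "x \<in> (\<Union>w'\<in>I. ?A (k+n) w')" by blast
        qed
        have "measure M (?A k w) \<le> 1 * measure M (\<Union>w'\<in>I. ?A (k+n) w')"
          using sub by (auto intro!: finite_measure_mono)
        also have "\<dots> \<le> (1 - \<delta>) ^ N * measure M (\<Union>w'\<in>I. {x \<in> space M. hist (k+n) x = w'})"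
          using Suc.IH Suc.prems \<delta>
          by (intro scaled_measure_UN_mono) (auto simp: disjoint_family_on_def)
        also have "\<dots> = (1 - \<delta>) ^ N * (measure M ?w - measure M ?H)"
          unfolding w'_eq using H_meas by (subst finite_measure_Diff) auto
        also have "\<dots> \<le> (1 - \<delta>) ^ N * ((1 - \<delta>) * measure M ?w)"
          using n \<delta> by (intro mult_left_mono) (auto simp: algebra_simps)
        finally show ?case by (simp add: ac_simps)
      qed
      have "measure M (?A k1 w) = 0" for w
      proof -
        have "(\<lambda>N. (1 - \<delta>) ^ N * \<P>(x in M. hist k1 x = w)) \<longlonglongrightarrow> 0 * \<P>(x in M. hist k1 x = w)"
          using \<delta> by (intro tendsto_mult_right LIMSEQ_power_zero) auto
        then have "measure M (?A k1 w) \<le> 0"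
          using decay[of k1 w] by (intro LIMSEQ_le_const) auto
        then show ?thesis by (simp add: measure_le_0_iff)
      qed
      then have "AE x in M. x \<notin> ?A k1 w" for w
        by (intro AE_not_in) (simp add: null_sets_def emeasure_eq_measure)
      then have "AE x in M. \<forall>w. x \<notin> ?A k1 w"
        by (simp only: AE_all_countable) blast
      then show ?thesis by (rule AE_mp) (intro AE_I2, auto)
    qed
    then have "AE x in M. \<forall>k1\<ge>k0. \<exists>k\<ge>k1. X k x \<in> E (m * S k x)"
      by (simp add: AE_all_countable AE_ball_countable)
    then show ?thesis
    proof (rule AE_mp, intro AE_I2 impI)
      fix x assume *: "\<forall>k1\<ge>k0. \<exists>k\<ge>k1. X k x \<in> E (m * S k x)"
      show "\<exists>\<^sub>\<infinity>k. X k x \<in> E (m * S k x)"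
        unfolding INFM_nat_le
        using * by (metis le_cases le_trans)
    qed
  qed
  have "AE x in M. \<exists>\<^sub>\<infinity>k. X k x \<in> E (Suc m * S k x)" for m :: nat
    by (rule large_m) simp
  then have "AE x in M. \<forall>m::nat. \<exists>\<^sub>\<infinity>k. X k x \<in> E (Suc m * S k x)"
    by (simp only: AE_all_countable) blast
  then show ?thesis
  proof (rule AE_mp, intro AE_I2 impI allI)
    fix x m assume "\<forall>m::nat. \<exists>\<^sub>\<infinity>k. X k x \<in> E (Suc m * S k x)"
    then have "\<exists>\<^sub>\<infinity>k. X k x \<in> E (Suc m * S k x)" by blast
    then show "\<exists>\<^sub>\<infinity>k. X k x \<in> E (m * S k x)"
    proof (rule INFM_mono)
      fix k assume "X k x \<in> E (Suc m * S k x)"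
      moreover have "E (Suc m * S k x) \<subseteq> E (m * S k x)" by (rule E_mono) simp
      ultimately show "X k x \<in> E (m * S k x)" by blast
    qed
  qed
qed

end

section \<open>Distortion of compositions of inverse branches\<close>

text \<open>
  Bounded distortion without derivatives: the difference quotients of \<open>\<phi>\<close> over subintervals of \<open>D\<close> agree up to the factor
  \<open>exp L\<close>.
\<close>

definition distortion_le :: "real \<Rightarrow> real set \<Rightarrow> (real \<Rightarrow> real) \<Rightarrow> bool" where
  "distortion_le L D \<phi> \<longleftrightarrow> (\<forall>x\<in>D. \<forall>y\<in>D. \<forall>z\<in>D. \<forall>w\<in>D. x \<le> y \<longrightarrow> z \<le> w \<longrightarrow>
     (\<phi> y - \<phi> x) * (w - z) \<le> exp L * ((\<phi> w - \<phi> z) * (y - x)))"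

lemma distortion_leD:
  "distortion_le L D \<phi> \<Longrightarrow> x \<in> D \<Longrightarrow> y \<in> D \<Longrightarrow> z \<in> D \<Longrightarrow> w \<in> D \<Longrightarrow> x \<le> y \<Longrightarrow> z \<le> w \<Longrightarrow>
     (\<phi> y - \<phi> x) * (w - z) \<le> exp L * ((\<phi> w - \<phi> z) * (y - x))"
  by (simp add: distortion_le_def)

lemma distortion_le_mono:
  assumes "distortion_le L D \<phi>" "L \<le> L'" "mono_on D \<phi>"
  shows "distortion_le L' D \<phi>"
  unfolding distortion_le_def
proof (intro ballI impI)
  fix x y z w assume *: "x \<in> D" "y \<in> D" "z \<in> D" "w \<in> D" "x \<le> y" "z \<le> w"
  have "(\<phi> y - \<phi> x) * (w - z) \<le> exp L * ((\<phi> w - \<phi> z) * (y - x))"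
    using * assms(1) by (intro distortion_leD)
  also have "\<dots> \<le> exp L' * ((\<phi> w - \<phi> z) * (y - x))"
    using * assms(2) mono_onD[OF assms(3), of z w] by (intro mult_right_mono) auto
  finally show "(\<phi> y - \<phi> x) * (w - z) \<le> exp L' * ((\<phi> w - \<phi> z) * (y - x))" .
qed

text \<open>
  The properties of an inverse branch of the map that are used below. If the derivative of the branch is Lipschitz and
  at least one, then its logarithm is Lipschitz, which is why the distortion is bounded by the length of the image.
\<close>

locale branch_map =
  fixes h :: "real \<Rightarrow> real" and \<Lambda> B :: real
  assumes strict_mono: "strict_mono_on {0..1} h"
    and range: "\<And>x. x \<in> {0..1} \<Longrightarrow> h x \<in> {0..1}"
    and contraction: "\<And>x y. 0 \<le> x \<Longrightarrow> x \<le> y \<Longrightarrow> y \<le> 1 \<Longrightarrow> h y - h x \<le> y - x"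
    and lower: "\<And>x y. 0 \<le> x \<Longrightarrow> x \<le> y \<Longrightarrow> y \<le> 1 \<Longrightarrow> y - x \<le> B * (h y - h x)"
    and distortion: "\<And>s t. 0 \<le> s \<Longrightarrow> s \<le> t \<Longrightarrow> t \<le> 1 \<Longrightarrow> distortion_le (\<Lambda> * (h t - h s)) {s..t} h"
begin

lemma less: "0 \<le> x \<Longrightarrow> x < y \<Longrightarrow> y \<le> 1 \<Longrightarrow> h x < h y"
  using strict_mono by (auto simp: strict_mono_on_def)

lemma le: "0 \<le> x \<Longrightarrow> x \<le> y \<Longrightarrow> y \<le> 1 \<Longrightarrow> h x \<le> h y"
  using less[of x y] by (cases "x = y") auto

lemma less_iff: "x \<in> {0..1} \<Longrightarrow> y \<in> {0..1} \<Longrightarrow> h x < h y \<longleftrightarrow> x < y"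
  by (metis le less atLeastAtMost_iff linorder_not_le)

lemma continuous: "continuous_on {0..1} h"
proof (rule lipschitz_on_continuous_on, rule lipschitz_onI)
  fix x y :: real assume "x \<in> {0..1}" "y \<in> {0..1}"
  then show "dist (h x) (h y) \<le> 1 * dist x y"
    using contraction[of x y] contraction[of y x] le[of x y] le[of y x]
    by (cases "x \<le> y") (auto simp: dist_real_def)
qed simp

lemma distortion_compose:
  assumes st: "s \<le> t" and \<phi>: "\<And>x. x \<in> {s..t} \<Longrightarrow> \<phi> x \<in> {0..1}" "strict_mono_on {s..t} \<phi>"
    and L: "distortion_le L {s..t} \<phi>"
  shows "distortion_le (\<Lambda> * (h (\<phi> t) - h (\<phi> s)) + L) {s..t} (h \<circ> \<phi>)"
  unfolding distortion_le_def
proof (intro ballI impI)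
  fix x y z w assume *: "x \<in> {s..t}" "y \<in> {s..t}" "z \<in> {s..t}" "w \<in> {s..t}" "x \<le> y" "z \<le> w"
  let ?d = "\<Lambda> * (h (\<phi> t) - h (\<phi> s))"
  have \<phi>_le: "\<phi> a \<le> \<phi> b" if "a \<in> {s..t}" "b \<in> {s..t}" "a \<le> b" for a b
    using strict_mono_on_leD[OF \<phi>(2)] that by auto
  show "((h \<circ> \<phi>) y - (h \<circ> \<phi>) x) * (w - z) \<le> exp (?d + L) * (((h \<circ> \<phi>) w - (h \<circ> \<phi>) z) * (y - x))"
  proof (cases "z = w")
    case False
    then have pos: "\<phi> w - \<phi> z > 0" using * \<phi>(2) by (auto simp: strict_mono_on_def)
    have hwz: "h (\<phi> w) - h (\<phi> z) \<ge> 0"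
      using \<phi>_le[of z w] \<phi>(1)[of z] \<phi>(1)[of w] * by (auto intro!: le)
    have 1: "(h (\<phi> y) - h (\<phi> x)) * (\<phi> w - \<phi> z) \<le> exp ?d * ((h (\<phi> w) - h (\<phi> z)) * (\<phi> y - \<phi> x))"
      using * st \<phi>(1) \<phi>_le by (intro distortion_leD[OF distortion, of "\<phi> s" "\<phi> t"]) auto
    have 2: "(\<phi> y - \<phi> x) * (w - z) \<le> exp L * ((\<phi> w - \<phi> z) * (y - x))"
      using * by (intro distortion_leD[OF L])
    have "((h (\<phi> y) - h (\<phi> x)) * (w - z)) * (\<phi> w - \<phi> z)
        = ((h (\<phi> y) - h (\<phi> x)) * (\<phi> w - \<phi> z)) * (w - z)" by (simp add: ac_simps)
    also have "\<dots> \<le> (exp ?d * ((h (\<phi> w) - h (\<phi> z)) * (\<phi> y - \<phi> x))) * (w - z)"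
      using * by (intro mult_right_mono 1) auto
    also have "\<dots> = exp ?d * (h (\<phi> w) - h (\<phi> z)) * ((\<phi> y - \<phi> x) * (w - z))" by (simp add: ac_simps)
    also have "\<dots> \<le> exp ?d * (h (\<phi> w) - h (\<phi> z)) * (exp L * ((\<phi> w - \<phi> z) * (y - x)))"
      using hwz by (intro mult_left_mono 2) auto
    also have "\<dots> = (exp (?d + L) * ((h (\<phi> w) - h (\<phi> z)) * (y - x))) * (\<phi> w - \<phi> z)"
      by (simp add: exp_add ac_simps)
    finally show ?thesis using pos by simp
  qed simp
qed

end

text \<open>
  The inverses \<open>u\<close> and \<open>v\<close> of the left and of the right branch. Because of the indifferent fixed points, neither of
  them contracts uniformly on \<open>{0..1}\<close>. But \<open>v\<close> contracts \<open>{0..c}\<close> uniformly, as the image is away from the fixed point of \<open>v\<close>,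
  and every passage from the right to the left uses \<open>v\<close> on this set.
\<close>

locale two_branches = left: branch_map u \<Lambda> B + right: branch_map v \<Lambda> B
  for u v :: "real \<Rightarrow> real" and \<Lambda> B :: real +
  fixes c \<rho> :: real
  assumes c: "0 < c" "c < 1"
    and u_0: "u 0 = 0" and u_1: "u 1 = c" and v_0: "v 0 = c" and v_1: "v 1 = 1"
    and u_less: "\<And>x. x \<in> {0<..<1} \<Longrightarrow> u x < x" and v_greater: "\<And>x. x \<in> {0<..<1} \<Longrightarrow> x < v x"
    and \<Lambda>_nonneg: "\<Lambda> \<ge> 0" and \<rho>: "\<rho> > 1"
    and v_contracts: "\<And>x y. 0 \<le> x \<Longrightarrow> x \<le> y \<Longrightarrow> y \<le> c \<Longrightarrow> v y - v x \<le> (y - x) / \<rho>"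
begin

fun br :: "bool \<Rightarrow> real \<Rightarrow> real" where
  "br False = u" | "br True = v"

text \<open>
  In a word, \<open>False\<close> stands for left and \<open>True\<close> for right. The last letter acts first, so the points in the
  range of \<open>wmap w\<close> are those whose itinerary starts with \<open>w\<close>.
\<close>

primrec wmap :: "bool list \<Rightarrow> real \<Rightarrow> real" where
  "wmap [] = id" | "wmap (b # w) = br b \<circ> wmap w"

text \<open>
  The total length of the images of \<open>{s..t}\<close> under the nonempty suffixes of the word. These images are the successive
  forward iterates of the image under the whole word.
\<close>

primrec wsum :: "bool list \<Rightarrow> real \<Rightarrow> real \<Rightarrow> real" where
  "wsum [] s t = 0"
| "wsum (b # w) s t = (br b (wmap w t) - br b (wmap w s)) + wsum w s t"

lemma wmap_append: "wmap (w @ w') x = wmap w (wmap w' x)"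
  by (induction w) auto

lemma wsum_append: "wsum (w @ w') s t = wsum w (wmap w' s) (wmap w' t) + wsum w' s t"
  by (induction w) (auto simp: wmap_append)

lemma br_branch: "branch_map (br b) \<Lambda> B"
  using left.branch_map_axioms right.branch_map_axioms by (cases b) simp_all

lemma br_range: "x \<in> {0..1} \<Longrightarrow> br b x \<in> {0..1}"
  using branch_map.range[OF br_branch] .

lemma br_less: "0 \<le> x \<Longrightarrow> x < y \<Longrightarrow> y \<le> 1 \<Longrightarrow> br b x < br b y"
  using branch_map.less[OF br_branch] .

lemma br_contraction: "0 \<le> x \<Longrightarrow> x \<le> y \<Longrightarrow> y \<le> 1 \<Longrightarrow> br b y - br b x \<le> y - x"
  using branch_map.contraction[OF br_branch] .

lemma wmap_range: "x \<in> {0..1} \<Longrightarrow> wmap w x \<in> {0..1}"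
  by (induction w) (simp_all add: br_range del: atLeastAtMost_iff)

lemma wmap_less: "0 \<le> x \<Longrightarrow> x < y \<Longrightarrow> y \<le> 1 \<Longrightarrow> wmap w x < wmap w y"
proof (induction w)
  case (Cons b w)
  then show ?case
    using wmap_range[of x w] wmap_range[of y w] by (simp add: br_less)
qed simp

lemma wmap_le: "0 \<le> x \<Longrightarrow> x \<le> y \<Longrightarrow> y \<le> 1 \<Longrightarrow> wmap w x \<le> wmap w y"
  using wmap_less[of x y w] by (cases "x = y") auto

lemma wmap_contraction: "0 \<le> x \<Longrightarrow> x \<le> y \<Longrightarrow> y \<le> 1 \<Longrightarrow> wmap w y - wmap w x \<le> y - x"
proof (induction w)
  case (Cons b w)
  have "br b (wmap w y) - br b (wmap w x) \<le> wmap w y - wmap w x"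
    using Cons.prems wmap_range[of x w] wmap_range[of y w] by (intro br_contraction wmap_le) auto
  with Cons show ?case by simp
qed auto

lemma wmap_continuous: "continuous_on {0..1} (wmap w)"
proof (induction w)
  case (Cons b w)
  show ?case unfolding wmap.simps
    using Cons wmap_range branch_map.continuous[OF br_branch, of b]
    by (intro continuous_on_compose) (auto intro: continuous_on_subset)
qed (auto simp: continuous_on_id)

lemma wsum_nonneg: "0 \<le> x \<Longrightarrow> x \<le> y \<Longrightarrow> y \<le> 1 \<Longrightarrow> wsum w x y \<ge> 0"
proof (induction w)
  case (Cons b w)
  have "wmap (b # w) x \<le> wmap (b # w) y" using Cons.prems by (intro wmap_le)
  with Cons show ?case by simp
qed auto

lemma wmap_distortion:
  assumes "0 \<le> s" "s \<le> t" "t \<le> 1"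
  shows "distortion_le (\<Lambda> * wsum w s t) {s..t} (wmap w)"
proof (induction w)
  case Nil
  show ?case by (auto simp: distortion_le_def)
next
  case (Cons b w)
  have "strict_mono_on {s..t} (wmap w)"
    using assms by (auto simp: strict_mono_on_def intro!: wmap_less)
  moreover have "wmap w x \<in> {0..1}" if "x \<in> {s..t}" for x using that assms by (intro wmap_range) auto
  ultimately have "distortion_le (\<Lambda> * (br b (wmap w t) - br b (wmap w s)) + \<Lambda> * wsum w s t) {s..t} (br b \<circ> wmap w)"
    using assms Cons by (intro branch_map.distortion_compose[OF br_branch]) auto
  then show ?case by (simp only: wsum.simps wmap.simps distrib_left)
qed

text \<open>
  If the images of \<open>{s..t}\<close> have total length at most one, then the distortion on \<open>{s..t}\<close> is at most \<open>exp \<Lambda>\<close>, so the images of a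
  subinterval have total length proportional to that of the subinterval.
\<close>

lemma wsum_proportional:
  assumes st: "0 \<le> s" "s \<le> t" "t \<le> 1" and xy: "s \<le> x" "x \<le> y" "y \<le> t" and le: "wsum w s t \<le> 1"
  shows "wsum w x y * (t - s) \<le> exp \<Lambda> * (wsum w s t * (y - x))"
  using le
proof (induction w)
  case (Cons b w)
  let ?\<phi> = "wmap (b # w)"
  have mono: "?\<phi> s \<le> ?\<phi> t" using st by (intro wmap_le)
  with Cons.prems have "wsum w s t \<le> 1" by simp
  note IH = Cons.IH[OF this]
  have "(?\<phi> y - ?\<phi> x) * (t - s) \<le> exp (\<Lambda> * wsum (b # w) s t) * ((?\<phi> t - ?\<phi> s) * (y - x))"
    using st xy by (intro distortion_leD[OF wmap_distortion]) auto
  also have "\<dots> \<le> exp \<Lambda> * ((?\<phi> t - ?\<phi> s) * (y - x))"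
    using mono xy Cons.prems \<Lambda>_nonneg mult_left_mono[OF Cons.prems \<Lambda>_nonneg]
    by (intro mult_right_mono) auto
  finally show ?case using IH by (simp add: algebra_simps)
qed auto

subsection \<open>Cycles\<close>

lemma wmap_replicate: "wmap (replicate n b) x = (br b ^^ n) x"
  by (induction n) auto

lemma vc: "c < v c" "v c < 1"
  using right.less[of 0 c] right.less[of c 1] c v_0 v_1 by auto

lemma funpow_v_Suc: "(v ^^ n) (v x) = v ((v ^^ n) x)"
  by (simp add: funpow_swap1)

text \<open>
  The images of a fundamental domain under the iterates of one branch are adjacent intervals, so their lengths telescope.
\<close>

lemma wsum_v: "wsum (replicate n True) c (v c) \<le> 1"
proof -
  have "wsum (replicate n True) c (v c) = (v ^^ Suc n) c - v c"
    by (induction n) (auto simp: wmap_replicate funpow_v_Suc)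
  moreover have "(v ^^ Suc n) c \<le> 1"
    using wmap_range[of c "replicate (Suc n) True"] c by (simp add: wmap_replicate)
  ultimately show ?thesis using vc c by simp
qed

lemma wsum_u: "wsum (replicate n False) c 1 \<le> 1"
proof -
  have "wsum (replicate n False) c 1 = c - (u ^^ Suc n) 1 + (u 1 - c)" for n
    by (induction n) (auto simp: wmap_replicate u_1[symmetric] funpow_swap1)
  moreover have "(u ^^ Suc n) 1 \<ge> 0"
    using wmap_range[of 1 "replicate (Suc n) False"] c by (simp add: wmap_replicate)
  ultimately show ?thesis using c by (simp add: u_1)
qed

text \<open>
  The itinerary from a point of \<open>(c, v c)\<close> up to its first return: one step on the right, a left run, and a right run. Both runs
  are nonempty, but the last step of the right run is already the first letter of the next cycle; hence the single
  \<open>Suc\<close>.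
\<close>

definition cyc :: "nat \<times> nat \<Rightarrow> bool list" where
  "cyc e = True # replicate (Suc (fst e)) False @ replicate (snd e) True"

definition cw :: "(nat \<times> nat) list \<Rightarrow> bool list" where
  "cw es = concat (map cyc es)"

lemma cw_simps [simp]: "cw [] = []" "cw (e # es) = cyc e @ cw es" "cw (es @ es') = cw es @ cw es'"
  by (simp_all add: cw_def)

lemma v_pow_range: "x \<in> {c..1} \<Longrightarrow> (v ^^ n) x \<in> {c..1}"
proof (induction n)
  case (Suc n)
  have "v 0 \<le> v ((v ^^ n) x)" using Suc c by (intro right.le) auto
  then show ?case using Suc right.range[of "(v ^^ n) x"] c by (auto simp: v_0)
qed auto

lemma u_pow_range: "x \<in> {0..1} \<Longrightarrow> (u ^^ Suc n) x \<in> {0..c}"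
  using wmap_range[of x "replicate n False"] left.le[of "(u ^^ n) x" 1] left.range[of "(u ^^ n) x"]
  by (auto simp: wmap_replicate u_1)

lemma wmap_cyc: "wmap (cyc (i, j)) x = v ((u ^^ Suc i) ((v ^^ j) x))"
  by (simp add: cyc_def wmap_append wmap_replicate)

lemma cyc_range: "x \<in> {c..v c} \<Longrightarrow> wmap (cyc e) x \<in> {c..v c}"
proof (cases e)
  case (Pair i j)
  assume x: "x \<in> {c..v c}"
  have "(v ^^ j) x \<in> {c..1}" using x vc by (intro v_pow_range) auto
  then have "(u ^^ Suc i) ((v ^^ j) x) \<in> {0..c}" using c by (intro u_pow_range) auto
  then show ?thesis
    using right.le[of 0 "(u ^^ Suc i) ((v ^^ j) x)"] right.le[of "(u ^^ Suc i) ((v ^^ j) x)" c] c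
    unfolding Pair wmap_cyc by (auto simp: v_0)
qed

lemma cw_range: "x \<in> {c..v c} \<Longrightarrow> wmap (cw es) x \<in> {c..v c}"
  by (induction es) (auto simp: wmap_append simp del: atLeastAtMost_iff intro!: cyc_range)

definition cycle_const :: real where
  "cycle_const = 1 + exp \<Lambda> / (1 - c) + exp \<Lambda> / (v c - c)"

lemma wsum_cyc:
  assumes xy: "c \<le> x" "x \<le> y" "y \<le> v c"
  shows "wsum (cyc e) x y \<le> cycle_const * (y - x)"
proof (cases e)
  case (Pair i j)
  let ?V = "\<lambda>x. (v ^^ j) x"
  have Vx: "?V x \<in> {c..1}" "?V y \<in> {c..1}" using xy vc by (auto intro!: v_pow_range simp del: atLeastAtMost_iff) auto
  have V_le: "?V x \<le> ?V y" and V_contr: "?V y - ?V x \<le> y - x"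
    using wmap_le[of x y "replicate j True"] wmap_contraction[of x y "replicate j True"] xy vc c
    by (auto simp: wmap_replicate)
  have "wsum (replicate j True) x y * (v c - c) \<le> exp \<Lambda> * (wsum (replicate j True) c (v c) * (y - x))"
    using c vc xy by (intro wsum_proportional wsum_v) auto
  also have "\<dots> \<le> exp \<Lambda> * (1 * (y - x))"
    using wsum_v[of j] xy by (intro mult_left_mono mult_right_mono) auto
  finally have 1: "wsum (replicate j True) x y \<le> exp \<Lambda> / (v c - c) * (y - x)"
    using vc by (simp add: field_simps)
  have "wsum (replicate (Suc i) False) (?V x) (?V y) * (1 - c)
      \<le> exp \<Lambda> * (wsum (replicate (Suc i) False) c 1 * (?V y - ?V x))"
    using c Vx V_le by (intro wsum_proportional wsum_u) auto
  also have "\<dots> \<le> exp \<Lambda> * (1 * (y - x))"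
    using wsum_u[of "Suc i"] V_le V_contr wsum_nonneg[of c 1 "replicate (Suc i) False"] c xy
    by (intro mult_left_mono mult_mono) auto
  finally have 2: "wsum (replicate (Suc i) False) (?V x) (?V y) \<le> exp \<Lambda> / (1 - c) * (y - x)"
    using c by (simp add: field_simps)
  have 3: "wmap (cyc e) y - wmap (cyc e) x \<le> y - x"
    using xy c vc by (intro wmap_contraction) auto
  have "wsum (cyc e) x y = (wmap (cyc e) y - wmap (cyc e) x)
     + wsum (replicate (Suc i) False) (?V x) (?V y) + wsum (replicate j True) x y"
    unfolding Pair cyc_def fst_conv snd_conv wsum.simps(2)[of True] wsum_append wmap_replicate
    by (simp add: wmap_append wmap_replicate)
  also have "\<dots> \<le> cycle_const * (y - x)"
    unfolding cycle_const_def distrib_right using 1 2 3 by (intro add_mono) auto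
  finally show ?thesis .
qed

lemma cyc_contracts:
  assumes xy: "c \<le> x" "x \<le> y" "y \<le> v c"
  shows "wmap (cyc e) y - wmap (cyc e) x \<le> (y - x) / \<rho>"
proof -
  let ?w = "replicate (Suc (fst e)) False @ replicate (snd e) True"
  have ran: "wmap ?w x \<in> {0..c}" if "x \<in> {c..v c}" for x
  proof -
    have "(v ^^ snd e) x \<in> {c..1}" using that vc by (intro v_pow_range) auto
    then have "(u ^^ Suc (fst e)) ((v ^^ snd e) x) \<in> {0..c}" using c by (intro u_pow_range) auto
    then show ?thesis by (simp add: wmap_append wmap_replicate)
  qed
  have "wmap (cyc e) y - wmap (cyc e) x = v (wmap ?w y) - v (wmap ?w x)" by (simp add: cyc_def)
  also have "\<dots> \<le> (wmap ?w y - wmap ?w x) / \<rho>"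
    using ran[of x] ran[of y] xy c vc by (intro v_contracts wmap_le) auto
  also have "\<dots> \<le> (y - x) / \<rho>"
    using xy c vc \<rho> by (intro divide_right_mono wmap_contraction) auto
  finally show ?thesis .
qed

lemma cycle_const_pos: "cycle_const > 0"
  using c vc by (simp add: cycle_const_def add_pos_pos)

text \<open>
  Each cycle contributes at most \<open>cycle_const\<close> times the current length, and shortens the interval by
  the factor \<open>1 / \<rho>\<close>, so it is paid for by the loss of length. This gives a bound that does not depend on the number of cycles.
\<close>

lemma wsum_cw:
  assumes xy: "c \<le> x" "x \<le> y" "y \<le> v c"
  shows "wsum (cw es) x y \<le> cycle_const * \<rho> / (\<rho> - 1) * ((y - x) - (wmap (cw es) y - wmap (cw es) x))"
proof (induction es)
  case (Cons e es)
  let ?X = "wmap (cw es) x" and ?Y = "wmap (cw es) y"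
  have XY: "c \<le> ?X" "?X \<le> ?Y" "?Y \<le> v c"
    using cw_range[of x es] cw_range[of y es] xy c vc by (auto intro!: wmap_le)
  have "wsum (cyc e) ?X ?Y \<le> cycle_const * (?Y - ?X)" by (rule wsum_cyc[OF XY])
  also have "\<dots> = cycle_const * \<rho> / (\<rho> - 1) * ((?Y - ?X) - (?Y - ?X) / \<rho>)"
    using \<rho> by (simp add: field_simps)
  also have "\<dots> \<le> cycle_const * \<rho> / (\<rho> - 1) * ((?Y - ?X) - (wmap (cyc e) ?Y - wmap (cyc e) ?X))"
    using cyc_contracts[OF XY, of e] \<rho> cycle_const_pos by (intro mult_left_mono) auto
  finally have "wsum (cw (e # es)) x y
      \<le> cycle_const * \<rho> / (\<rho> - 1) * ((?Y - ?X) - (wmap (cyc e) ?Y - wmap (cyc e) ?X))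
        + cycle_const * \<rho> / (\<rho> - 1) * ((y - x) - (?Y - ?X))"
    using Cons by (simp add: wsum_append)
  also have "\<dots> = cycle_const * \<rho> / (\<rho> - 1) * ((y - x) - (wmap (cw (e # es)) y - wmap (cw (e # es)) x))"
    unfolding distrib_left[symmetric] by (simp add: wmap_append)
  finally show ?case .
qed auto

definition total_distortion :: real where
  "total_distortion = \<Lambda> * (cycle_const * \<rho> / (\<rho> - 1))"

lemma cw_distortion: "distortion_le total_distortion {c..v c} (wmap (cw es))"
proof (rule distortion_le_mono[OF wmap_distortion])
  have "wsum (cw es) c (v c) \<le> cycle_const * \<rho> / (\<rho> - 1) * ((v c - c) - (wmap (cw es) (v c) - wmap (cw es) c))"
    using vc by (intro wsum_cw) auto
  also have "\<dots> \<le> cycle_const * \<rho> / (\<rho> - 1) * 1"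
    using vc c \<rho> cycle_const_pos wmap_le[of c "v c" "cw es"] by (intro mult_left_mono) auto
  finally show "\<Lambda> * wsum (cw es) c (v c) \<le> total_distortion"
    unfolding total_distortion_def using \<Lambda>_nonneg by (intro mult_left_mono) auto
  show "mono_on {c..v c} (wmap (cw es))"
    using vc c by (intro mono_onI wmap_le) auto
qed (use c vc in auto)

end

section \<open>First returns and their coding\<close>

text \<open>
  Values of \<open>f\<close> at \<open>0\<close>, \<open>c\<close> and \<open>1\<close> are left open; the orbits considered below avoid these points.
\<close>

locale coded_map = two_branches u v \<Lambda> B c \<rho>
  for u v :: "real \<Rightarrow> real" and \<Lambda> B c \<rho> :: real +
  fixes f :: "real \<Rightarrow> real"
  assumes f_u: "\<And>y. y \<in> {0<..<1} \<Longrightarrow> f (u y) = y"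
    and f_v: "\<And>y. y \<in> {0<..<1} \<Longrightarrow> f (v y) = y"
begin

lemma f_br: "y \<in> {0<..<1} \<Longrightarrow> f (br b y) = y"
  using f_u f_v by (cases b) auto

lemma u_side: "y \<in> {0<..<1} \<Longrightarrow> u y \<in> {0<..<c}"
  using left.less[of 0 y] left.less[of y 1] by (simp add: u_0 u_1)

lemma v_side: "y \<in> {0<..<1} \<Longrightarrow> v y \<in> {c<..<1}"
  using right.less[of 0 y] right.less[of y 1] by (simp add: v_0 v_1)

lemma br_open: "y \<in> {0<..<1} \<Longrightarrow> br b y \<in> {0<..<1}"
  using u_side[of y] v_side[of y] c by (cases b) auto

lemma wmap_open: "y \<in> {0<..<1} \<Longrightarrow> wmap w y \<in> {0<..<1}"
  by (induction w) (simp_all add: br_open del: greaterThanLessThan_iff)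

lemma funpow_wmap: "y \<in> {0<..<1} \<Longrightarrow> (f ^^ length w) (wmap w y) = y"
proof (induction w)
  case (Cons b w)
  then show ?case
    using f_br[OF wmap_open[OF Cons.prems], of b w]
    by (simp add: funpow_Suc_right del: funpow.simps(2))
qed simp

lemma wmap_between:
  assumes st: "0 \<le> s" "s \<le> t" "t \<le> 1" and x: "wmap w s < x" "x < wmap w t"
  obtains y where "y \<in> {s<..<t}" "x = wmap w y"
proof -
  have "continuous_on {s..t} (wmap w)"
    using wmap_continuous by (rule continuous_on_subset) (use st in auto)
  then obtain y where y: "s \<le> y" "y \<le> t" "wmap w y = x"
    using IVT'[of "wmap w" s x t] x st by force
  with x have "y \<noteq> s" "y \<noteq> t" by auto
  with y show thesis by (intro that[of y]) auto
qed

lemma br_between: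
  assumes st: "0 \<le> s" "s \<le> t" "t \<le> 1" and x: "br b s < x" "x < br b t"
  obtains y where "y \<in> {s<..<t}" "x = br b y"
  using wmap_between[of s t "[b]" x] assms by auto

text \<open>
  The points of \<open>(0, 1)\<close> whose orbits never meet \<open>c\<close>. On this set every point has a unique itinerary.
\<close>

definition G :: "real set" where
  "G = {0<..<1} - range (\<lambda>w. wmap w c)"

definition Z :: "real set" where
  "Z = G \<inter> {c<..<v c}"

lemma G_open: "x \<in> G \<Longrightarrow> x \<in> {0<..<1}"
  by (simp add: G_def)

lemma Z_G: "x \<in> Z \<Longrightarrow> x \<in> G" and Z_between: "x \<in> Z \<Longrightarrow> x \<in> {c<..<v c}"
  by (simp_all add: Z_def)

lemma G_not_wmap: "x \<in> G \<Longrightarrow> x \<noteq> wmap w c"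
  by (auto simp: G_def)

lemma G_br_D: "br b y \<in> G \<Longrightarrow> y \<in> {0<..<1} \<Longrightarrow> y \<in> G"
proof (rule ccontr)
  assume b: "br b y \<in> G" and y: "y \<in> {0<..<1}" "y \<notin> G"
  then obtain w where "y = wmap w c" by (auto simp: G_def)
  then have "br b y = wmap (b # w) c" by simp
  with b show False using G_not_wmap by blast
qed

lemma G_br: "y \<in> G \<Longrightarrow> br b y \<in> G"
proof (rule ccontr)
  assume y: "y \<in> G" and b: "br b y \<notin> G"
  have y01: "y \<in> {0<..<1}" and c01: "c \<in> {0<..<1}" using y c by (auto simp: G_def)
  obtain w where w: "br b y = wmap w c"
    using b br_open[OF y01, of b] by (auto simp: G_def)
  show False
  proof (cases w)
    case Nil
    then show False using w u_side[OF y01] v_side[OF y01] by (cases b) auto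
  next
    case (Cons b' w')
    define z where "z = wmap w' c"
    have z: "z \<in> {0<..<1}" "br b y = br b' z"
      using w Cons wmap_open[OF c01] by (simp_all add: z_def)
    have "y = z"
      using f_br[OF y01, of b] f_br[OF z(1), of b'] z(2) by simp
    then show False using G_not_wmap[OF y] z_def by blast
  qed
qed

lemma G_wmap: "y \<in> G \<Longrightarrow> wmap w y \<in> G"
  by (induction w) (simp_all add: G_br)

lemma G_wmap_D: "wmap w y \<in> G \<Longrightarrow> y \<in> {0<..<1} \<Longrightarrow> y \<in> G"
proof (induction w)
  case (Cons b w)
  have "br b (wmap w y) \<in> G" using Cons.prems(1) by simp
  then have "wmap w y \<in> G" by (rule G_br_D) (rule wmap_open[OF Cons.prems(2)])
  then show ?case using Cons by blast
qed simp

lemma G_cases: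
  assumes "x \<in> G"
  obtains (left) "f x \<in> G" "x = u (f x)" "x < c" | (right) "f x \<in> G" "x = v (f x)" "c < x"
proof -
  have x: "x \<in> {0<..<1}" "x \<noteq> c" using G_open[OF assms] G_not_wmap[OF assms, of "[]"] by auto
  consider "x < c" | "c < x" using x by linarith
  then show thesis
  proof cases
    case 1
    then obtain y where y: "y \<in> {0<..<1}" "x = br False y"
      using br_between[of 0 1 False x] x by (auto simp: u_0 u_1)
    then show ?thesis using left 1 G_br_D[of False y] assms f_br[OF y(1), of False] by simp
  next
    case 2
    then obtain y where y: "y \<in> {0<..<1}" "x = br True y"
      using br_between[of 0 1 True x] x by (auto simp: v_0 v_1)
    then show ?thesis using right 2 G_br_D[of True y] assms f_br[OF y(1), of True] by simp
  qed
qed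

lemma f_G: "x \<in> G \<Longrightarrow> f x \<in> G"
  by (erule G_cases)

subsection \<open>Ladders towards the two fixed points\<close>

text \<open>
  A point of \<open>G\<close> is less than \<open>cl n\<close> if and only if its itinerary starts with \<open>n\<close> letters \<open>False\<close>, and greater than
  \<open>dr n\<close> if and only if its itinerary starts with \<open>n\<close> letters \<open>True\<close>.
\<close>

definition cl :: "nat \<Rightarrow> real" where "cl n = (u ^^ n) 1"
definition dr :: "nat \<Rightarrow> real" where "dr n = (v ^^ n) 0"

lemma cl_simps: "cl 0 = 1" "cl (Suc n) = u (cl n)"
  by (simp_all add: cl_def)

lemma dr_simps: "dr 0 = 0" "dr (Suc n) = v (dr n)"
  by (simp_all add: dr_def)

lemma cl_Suc_eq: "cl (Suc n) = (u ^^ n) c"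
  by (simp add: cl_def funpow_swap1 u_1)

lemma dr_Suc_eq: "dr (Suc n) = (v ^^ n) c"
  by (simp add: dr_def funpow_swap1 v_0)

lemma cl_open: "cl (Suc n) \<in> {0<..<1}"
  unfolding cl_Suc_eq using wmap_open[of c "replicate n False"] c by (simp add: wmap_replicate)

lemma dr_open: "dr (Suc n) \<in> {0<..<1}"
  unfolding dr_Suc_eq using wmap_open[of c "replicate n True"] c by (simp add: wmap_replicate)

lemma cl_Suc_less: "cl (Suc n) < cl n"
  using u_less[OF cl_open] c by (cases n) (simp_all add: cl_simps u_1)

lemma dr_Suc_greater: "dr n < dr (Suc n)"
  using v_greater[OF dr_open] c by (cases n) (simp_all add: dr_simps v_0)

lemma cl_less: "m < n \<Longrightarrow> cl n < cl m"
  using lift_Suc_mono_less[of "\<lambda>n. - cl n" m n] cl_Suc_less by simp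

lemma dr_less: "m < n \<Longrightarrow> dr m < dr n"
  using lift_Suc_mono_less[of dr m n] dr_Suc_greater by simp

lemma cl_le: "m \<le> n \<Longrightarrow> cl n \<le> cl m"
  using cl_less[of m n] by (cases "m = n") auto

lemma dr_le: "m \<le> n \<Longrightarrow> dr m \<le> dr n"
  using dr_less[of m n] by (cases "m = n") auto

lemma cl_pos: "cl n > 0"
  using cl_open[of "n - 1"] by (cases n) (auto simp: cl_simps)

lemma cl_le_1: "cl n \<le> 1"
  using cl_open[of "n - 1"] by (cases n) (auto simp: cl_simps)

lemma dr_less_1: "dr n < 1"
  using dr_open[of "n - 1"] by (cases n) (auto simp: dr_simps)

lemma dr_nonneg: "dr n \<ge> 0"
  using dr_open[of "n - 1"] by (cases n) (auto simp: dr_simps)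

lemma cl_limit: "cl \<longlonglongrightarrow> 0"
proof -
  have dec: "decseq cl" by (simp add: decseq_def cl_le)
  obtain l where l: "cl \<longlonglongrightarrow> l" "\<forall>n. l \<le> cl n"
    using decseq_convergent[OF dec, of 0] cl_pos by (auto simp: less_imp_le)
  have l0: "l \<ge> 0" using LIMSEQ_le_const[OF l(1)] cl_pos by (auto simp: less_imp_le)
  have l1: "l < 1" using l(2) cl_open[of 0] by (metis dual_order.strict_trans2 greaterThanLessThan_iff linorder_not_le)
  have "(\<lambda>n. u (cl n)) \<longlonglongrightarrow> u l"
    using l l0 cl_pos cl_le_1 l1 by (intro continuous_on_tendsto_compose[OF left.continuous]) (auto simp: less_imp_le)
  moreover have "(\<lambda>n. u (cl n)) \<longlonglongrightarrow> l"
    using LIMSEQ_Suc[OF l(1)] by (simp add: cl_simps)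
  ultimately have "u l = l" by (rule LIMSEQ_unique)
  then have "l = 0" using u_less[of l] l0 l1 by force
  with l show ?thesis by simp
qed

lemma dr_limit: "dr \<longlonglongrightarrow> 1"
proof -
  have inc: "incseq dr" by (simp add: incseq_def dr_le)
  obtain l where l: "dr \<longlonglongrightarrow> l" "\<forall>n. dr n \<le> l"
    using incseq_convergent[OF inc, of 1] dr_less_1 by (auto simp: less_imp_le)
  have l1: "l \<le> 1" using LIMSEQ_le_const2[OF l(1)] dr_less_1 by (auto simp: less_imp_le)
  have l0: "l > 0" using l(2) dr_open[of 0] by (metis dual_order.strict_trans1 greaterThanLessThan_iff)
  have "(\<lambda>n. v (dr n)) \<longlonglongrightarrow> v l"
    using l l0 dr_nonneg dr_less_1 l1 by (intro continuous_on_tendsto_compose[OF right.continuous]) (auto simp: less_imp_le)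
  moreover have "(\<lambda>n. v (dr n)) \<longlonglongrightarrow> l"
    using LIMSEQ_Suc[OF l(1)] by (simp add: dr_simps)
  ultimately have "v l = l" by (rule LIMSEQ_unique)
  then have "l = 1" using v_greater[of l] l0 l1 by force
  with l show ?thesis by simp
qed

lemma left_rung:
  assumes "x \<in> G" "x < c"
  obtains i y where "y \<in> G" "c < y" "x = (u ^^ Suc i) y"
proof -
  have x: "x > 0" using G_open[OF assms(1)] by simp
  have "\<exists>n. cl n < x"
    using order_tendstoD(2)[OF cl_limit x] by (auto simp: eventually_sequentially)
  define n where "n = (LEAST n. cl n < x)"
  have n: "cl n < x" unfolding n_def by (rule LeastI_ex) fact
  have n': "x \<le> cl m" if "m < n" for m
    using not_less_Least[of m "\<lambda>n. cl n < x"] that unfolding n_def[symmetric] by (simp add: not_less)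
  have "n \<noteq> 0" proof
    assume "n = 0"
    with n assms(2) c show False by (simp add: cl_def u_1)
  qed
  moreover have "n \<noteq> 1" proof
    assume "n = 1"
    with n assms(2) c show False by (simp add: cl_def u_1)
  qed
  ultimately obtain i where i: "n = Suc (Suc i)" by (metis One_nat_def not0_implies_Suc)
  have "x \<noteq> cl (Suc i)"
    using G_not_wmap[OF assms(1), of "replicate i False"] by (simp add: wmap_replicate cl_Suc_eq)
  then have "x < cl (Suc i)" using n'[of "Suc i"] i by simp
  then have "wmap (replicate (Suc i) False) c < x" "x < wmap (replicate (Suc i) False) 1"
    using n unfolding i wmap_replicate br.simps cl_Suc_eq[of "Suc i"] cl_def[of "Suc i"] by - assumption+
  then obtain y where y: "y \<in> {c<..<1}" "x = wmap (replicate (Suc i) False) y"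
    using wmap_between[of c 1 "replicate (Suc i) False" x] c by auto
  then have "y \<in> G" using G_wmap_D[of "replicate (Suc i) False" y] assms c by auto
  then show thesis using that[of y i] y by (auto simp: wmap_replicate simp del: funpow.simps replicate.simps)
qed

lemma right_rung:
  assumes "x \<in> G" "c < x"
  obtains j z where "z \<in> Z" "x = (v ^^ j) z"
proof -
  have x: "x < 1" using G_open[OF assms(1)] by simp
  have "\<exists>n. x < dr n"
    using order_tendstoD(1)[OF dr_limit x] by (auto simp: eventually_sequentially)
  define n where "n = (LEAST n. x < dr n)"
  have n: "x < dr n" unfolding n_def by (rule LeastI_ex) fact
  have n': "dr m \<le> x" if "m < n" for m
    using not_less_Least[of m "\<lambda>n. x < dr n"] that unfolding n_def[symmetric] by (simp add: not_less)
  have "n \<noteq> 0" proof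
    assume "n = 0"
    with n assms(2) c show False by (simp add: dr_def v_0)
  qed
  moreover have "n \<noteq> 1" proof
    assume "n = 1"
    with n assms(2) c show False by (simp add: dr_def v_0)
  qed
  ultimately obtain j where j: "n = Suc (Suc j)" by (metis One_nat_def not0_implies_Suc)
  have "x \<noteq> dr (Suc j)"
    using G_not_wmap[OF assms(1), of "replicate j True"] by (simp add: wmap_replicate dr_Suc_eq)
  then have "dr (Suc j) < x" using n'[of "Suc j"] j by simp
  then have "wmap (replicate j True) c < x" "x < wmap (replicate j True) (v c)"
    using n unfolding j wmap_replicate by (auto simp add: dr_Suc_eq funpow_v_Suc)
  then obtain z where z: "z \<in> {c<..<v c}" "x = wmap (replicate j True) z"
    using wmap_between[of c "v c" "replicate j True" x] c vc by auto
  then have "z \<in> G" using G_wmap_D[of "replicate j True" z] assms c vc by auto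
  then show thesis using that[of z j] z by (auto simp: wmap_replicate Z_def)
qed

text \<open>
  The length of the first left run can be read off from the position relative to the ladder.
\<close>

lemma left_index_iff:
  assumes "y \<in> {c<..<1}"
  shows "v ((u ^^ Suc i) y) < v (cl (Suc r)) \<longleftrightarrow> r \<le> i"
proof -
  have "wmap (replicate (Suc i) False) c < wmap (replicate (Suc i) False) y"
    "wmap (replicate (Suc i) False) y < wmap (replicate (Suc i) False) 1"
    using assms c by (intro wmap_less; simp)+
  then have lo: "cl (Suc (Suc i)) < (u ^^ Suc i) y" and hi: "(u ^^ Suc i) y < cl (Suc i)"
    unfolding wmap_replicate cl_Suc_eq[of "Suc i"] cl_def[of "Suc i"] br.simps by - assumption+
  have "v ((u ^^ Suc i) y) < v (cl (Suc r)) \<longleftrightarrow> (u ^^ Suc i) y < cl (Suc r)"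
    using lo hi cl_pos[of "Suc (Suc i)"] cl_le_1[of "Suc i"] cl_pos[of "Suc r"] cl_le_1[of "Suc r"]
    by (intro right.less_iff) auto
  also have "\<dots> \<longleftrightarrow> r \<le> i"
    using lo hi cl_le[of "Suc r" "Suc i"] cl_le[of "Suc (Suc i)" "Suc r"] by (cases "r \<le> i") auto
  finally show ?thesis .
qed

lemma right_index_iff:
  assumes "z \<in> Z"
  shows "dr (Suc r) < (v ^^ j) z \<longleftrightarrow> r \<le> j"
proof -
  have "wmap (replicate j True) c < wmap (replicate j True) z"
    "wmap (replicate j True) z < wmap (replicate j True) (v c)"
    using Z_between[OF assms] c vc by (intro wmap_less; simp)+
  then have lo: "dr (Suc j) < (v ^^ j) z" and hi: "(v ^^ j) z < dr (Suc (Suc j))"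
    unfolding wmap_replicate dr_Suc_eq br.simps by (simp_all add: funpow_v_Suc)
  then show ?thesis
    using dr_le[of "Suc r" "Suc j"] dr_le[of "Suc (Suc j)" "Suc r"] by (cases "r \<le> j") auto
qed

lemma Z_v_pow: "z \<in> Z \<Longrightarrow> (v ^^ j) z \<in> {c<..<1} \<and> (v ^^ j) z \<in> G"
  using wmap_less[of c z "replicate j True"] Z_between[of z] c vc dr_le[of 1 "Suc j"]
    G_wmap[OF Z_G, of z "replicate j True"] G_open[OF G_wmap[OF Z_G, of z "replicate j True"]]
  by (auto simp: wmap_replicate dr_Suc_eq[symmetric] dr_simps v_0)

lemma cyc_Z: "z \<in> Z \<Longrightarrow> wmap (cyc e) z \<in> Z"
proof -
  assume z: "z \<in> Z"
  obtain i j where e: "e = (i, j)" by (cases e)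
  have y: "(v ^^ j) z \<in> {c<..<1}" using Z_v_pow[OF z] by blast
  have "wmap (cyc e) z < v (cl (Suc 0))"
    using left_index_iff[OF y, of i 0] unfolding e wmap_cyc by simp
  moreover have "wmap (cyc e) z \<in> {c<..<1}"
    using v_side[of "(u ^^ Suc i) ((v ^^ j) z)"] wmap_open[of "(v ^^ j) z" "replicate (Suc i) False"] y c
    unfolding e wmap_cyc wmap_replicate by auto
  ultimately show ?thesis using G_wmap[OF Z_G[OF z]] by (simp add: Z_def cl_simps u_1)
qed

lemma decompose:
  assumes "x \<in> Z"
  obtains e z where "z \<in> Z" "x = wmap (cyc e) z"
proof -
  have "c < x" "x < v c" using Z_between[OF assms] by auto
  then obtain fx: "f x \<in> G" "x = v (f x)"
    by (cases rule: G_cases[OF Z_G[OF assms]]) auto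
  have "f x < c"
    using right.less_iff[of "f x" c] fx(2) \<open>x < v c\<close> G_open[OF fx(1)] c by auto
  then obtain i y where y: "y \<in> G" "c < y" "f x = (u ^^ Suc i) y"
    using left_rung[OF fx(1)] by blast
  then obtain j z where z: "z \<in> Z" "y = (v ^^ j) z" using right_rung by blast
  have "x = wmap (cyc (i, j)) z" unfolding wmap_cyc using fx y z by simp
  with z that show thesis by blast
qed

lemma cyc_unique:
  assumes "z \<in> Z" "z' \<in> Z" "wmap (cyc e) z = wmap (cyc e') z'"
  shows "e = e'" "z = z'"
proof -
  obtain i j i' j' where e: "e = (i, j)" "e' = (i', j')" by (cases e, cases e')
  have "r \<le> i \<longleftrightarrow> r \<le> i'" for r
    using left_index_iff[of "(v ^^ j) z" i r] left_index_iff[of "(v ^^ j') z'" i' r]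
      Z_v_pow assms unfolding e wmap_cyc by metis
  then have i: "i = i'" by (metis le_antisym le_refl)
  let ?w = "True # replicate (Suc i) False"
  have "wmap ?w ((v ^^ j) z) = wmap ?w ((v ^^ j') z')"
    using assms(3) unfolding e wmap_cyc i by (simp add: wmap_replicate)
  then have y: "(v ^^ j) z = (v ^^ j') z'"
    using funpow_wmap[of "(v ^^ j) z" ?w] funpow_wmap[of "(v ^^ j') z'" ?w] Z_v_pow[OF assms(1)] Z_v_pow[OF assms(2)] c
    by (metis G_open)
  then have "r \<le> j \<longleftrightarrow> r \<le> j'" for r
    using right_index_iff[OF assms(1), of r j] right_index_iff[OF assms(2), of r j'] by metis
  then have j: "j = j'" by (metis le_antisym le_refl)
  show "e = e'" by (simp add: e i j)
  have inverse: "(f ^^ j) ((v ^^ j) z) = z" if "z \<in> Z" for z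
    using funpow_wmap[of z "replicate j True"] G_open[OF Z_G[OF that]] by (simp add: wmap_replicate)
  show "z = z'"
    using inverse[OF assms(1)] inverse[OF assms(2)] y j by metis
qed

subsection \<open>Lebesgue measure on the return set\<close>

lemma countable_exceptional: "countable (range (\<lambda>w. wmap w c))"
  by simp

lemma G_borel [measurable]: "G \<in> sets borel"
proof -
  have "range (\<lambda>w. wmap w c) \<in> sets borel"
    by (rule sets.countable[OF _ countable_exceptional]) simp
  then show ?thesis unfolding G_def by (intro sets.Diff) simp_all
qed

lemma Z_borel [measurable]: "Z \<in> sets borel"
  by (simp add: Z_def)

lemma emeasure_G_interval:
  assumes "0 \<le> a" "a \<le> b" "b \<le> 1"
  shows "emeasure lborel (G \<inter> {a<..<b}) = ennreal (b - a)"
proof -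
  let ?N = "range (\<lambda>w. wmap w c)"
  have "?N \<in> null_sets lborel"
    using countable_exceptional by (rule countable_imp_null_set_lborel)
  moreover have "G \<inter> {a<..<b} = {a<..<b} - ?N"
    using assms by (auto simp: G_def)
  ultimately have "emeasure lborel (G \<inter> {a<..<b}) = emeasure lborel {a<..<b}"
    by (simp add: emeasure_Diff_null_set)
  then show ?thesis using assms by simp
qed

definition MZ :: "real measure" where
  "MZ = restrict_space lborel Z"

lemma space_MZ [simp]: "space MZ = Z"
  by (simp add: MZ_def space_restrict_space)

lemma sets_MZ_iff: "A \<in> sets MZ \<longleftrightarrow> A \<subseteq> Z \<and> A \<in> sets borel"
  unfolding MZ_def by (subst sets_restrict_space_iff) auto

lemma emeasure_MZ: "A \<subseteq> Z \<Longrightarrow> emeasure MZ A = emeasure lborel A"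
  unfolding MZ_def by (rule emeasure_restrict_space) auto

lemma measure_MZ_interval:
  assumes "c \<le> a" "a \<le> b" "b \<le> v c"
  shows "measure MZ (G \<inter> {a<..<b}) = b - a"
proof -
  have "emeasure MZ (G \<inter> {a<..<b}) = ennreal (b - a)"
    using assms c vc emeasure_G_interval[of a b] by (subst emeasure_MZ) (auto simp: Z_def)
  then show ?thesis using assms by (simp add: measure_def)
qed

lemma finite_measure_MZ: "finite_measure MZ"
proof
  have "emeasure MZ Z = ennreal (v c - c)"
    using c vc emeasure_G_interval[of c "v c"] by (simp add: emeasure_MZ) (simp add: Z_def)
  then show "emeasure MZ (space MZ) \<noteq> \<infinity>" by simp
qed

subsection \<open>The return process\<close>

definition len :: "nat \<times> nat \<Rightarrow> nat" where
  "len e = fst e + snd e + 2"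

lemma length_cyc: "length (cyc e) = len e"
  by (simp add: cyc_def len_def)

text \<open>
  The label of the branch of the first return map that is defined at \<open>x\<close>, see \<open>decompose\<close> and \<open>cyc_unique\<close>.
\<close>

definition idx :: "real \<Rightarrow> nat \<times> nat" where
  "idx x = (THE e. \<exists>z\<in>Z. x = wmap (cyc e) z)"

definition F :: "real \<Rightarrow> real" where
  "F x = (f ^^ len (idx x)) x"

definition X :: "nat \<Rightarrow> real \<Rightarrow> nat \<times> nat" where
  "X k x = idx ((F ^^ k) x)"

lemma idx_wmap: "z \<in> Z \<Longrightarrow> idx (wmap (cyc e) z) = e"
  unfolding idx_def using cyc_unique(1) by (intro the_equality) blast+

lemma F_wmap: "z \<in> Z \<Longrightarrow> F (wmap (cyc e) z) = z"
  unfolding F_def using funpow_wmap[OF G_open[OF Z_G], of z "cyc e"]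
  by (simp add: idx_wmap length_cyc)

lemma Z_idx_F:
  assumes "x \<in> Z"
  shows "F x \<in> Z" "x = wmap (cyc (idx x)) (F x)"
proof -
  obtain e z where z: "z \<in> Z" "x = wmap (cyc e) z" using decompose[OF assms] .
  then show "F x \<in> Z" "x = wmap (cyc (idx x)) (F x)"
    by (simp_all add: F_wmap idx_wmap)
qed

lemma X_0: "X 0 x = idx x" and X_Suc: "X (Suc k) x = X k (F x)"
  by (simp_all add: X_def funpow_swap1)

lemma hist_iff:
  "x \<in> Z \<Longrightarrow> map (\<lambda>i. X i x) [0..<length es] = es \<longleftrightarrow> x \<in> wmap (cw es) ` Z"
proof (induction es arbitrary: x)
  case (Cons e es)
  have "map (\<lambda>i. X i x) [0..<length (e # es)] = idx x # map (\<lambda>i. X i (F x)) [0..<length es]"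
    unfolding length_Cons upt_conv_Cons[OF zero_less_Suc] map_Suc_upt[symmetric]
    by (simp add: X_0 X_Suc comp_def del: upt_Suc)
  then have "map (\<lambda>i. X i x) [0..<length (e # es)] = e # es
      \<longleftrightarrow> idx x = e \<and> F x \<in> wmap (cw es) ` Z"
    using Cons.IH[OF Z_idx_F(1)[OF Cons.prems]] by simp
  also have "\<dots> \<longleftrightarrow> x \<in> wmap (cw (e # es)) ` Z"
  proof
    assume *: "idx x = e \<and> F x \<in> wmap (cw es) ` Z"
    then obtain z where "z \<in> Z" "F x = wmap (cw es) z" by blast
    with * show "x \<in> wmap (cw (e # es)) ` Z"
      using Z_idx_F(2)[OF Cons.prems] by (auto simp: wmap_append)
  next
    assume "x \<in> wmap (cw (e # es)) ` Z"
    then obtain z where z: "z \<in> Z" "x = wmap (cyc e) (wmap (cw es) z)" by (auto simp: wmap_append)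
    have "wmap (cw es) z \<in> Z" using z(1)
      by (induction es) (simp_all add: wmap_append cyc_Z)
    then show "idx x = e \<and> F x \<in> wmap (cw es) ` Z"
      using z by (simp add: idx_wmap F_wmap)
  qed
  finally show ?case .
qed simp

lemma wmap_cw_image: "wmap (cw es) ` Z = G \<inter> {wmap (cw es) c<..<wmap (cw es) (v c)}"
proof (intro equalityI subsetI)
  fix x assume "x \<in> wmap (cw es) ` Z"
  then obtain z where z: "z \<in> Z" "x = wmap (cw es) z" by blast
  then show "x \<in> G \<inter> {wmap (cw es) c<..<wmap (cw es) (v c)}"
    using G_wmap[OF Z_G[OF z(1)]] Z_between[OF z(1)] c vc by (auto intro!: wmap_less)
next
  fix x assume x: "x \<in> G \<inter> {wmap (cw es) c<..<wmap (cw es) (v c)}"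
  then obtain z where z: "z \<in> {c<..<v c}" "x = wmap (cw es) z"
    using wmap_between[of c "v c" "cw es" x] c vc by auto
  have "z \<in> G" using G_wmap_D[of "cw es" z] x z c vc by auto
  then show "x \<in> wmap (cw es) ` Z" using z by (auto simp: Z_def)
qed

text \<open>
  The points with a given sequence of labels form an interval, up to the countable set of exceptional points.
\<close>

lemma hist_cylinder:
  "{x \<in> Z. map (\<lambda>i. X i x) [0..<length es] = es} = G \<inter> {wmap (cw es) c<..<wmap (cw es) (v c)}"
proof -
  have "wmap (cw es) ` Z \<subseteq> Z"
  proof (induction es)
    case (Cons e es)
    then show ?case by (auto simp: wmap_append intro!: cyc_Z)
  qed simp
  then have "{x \<in> Z. map (\<lambda>i. X i x) [0..<length es] = es} = wmap (cw es) ` Z"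
    using hist_iff by blast
  then show ?thesis by (simp only: wmap_cw_image)
qed

lemma hist_Suc_cylinder:
  "{x \<in> Z. map (\<lambda>i. X i x) [0..<length es] = es \<and> X (length es) x = e}
     = G \<inter> {wmap (cw (es @ [e])) c<..<wmap (cw (es @ [e])) (v c)}"
  unfolding hist_cylinder[symmetric] by auto

lemma measure_cylinder:
  "measure MZ (G \<inter> {wmap (cw es) c<..<wmap (cw es) (v c)}) = wmap (cw es) (v c) - wmap (cw es) c"
  using cw_range[of c es] cw_range[of "v c" es] c vc
  by (intro measure_MZ_interval wmap_le) auto

lemma X_0_singleton: "{x \<in> Z. X 0 x = e} = G \<inter> {wmap (cyc e) c<..<wmap (cyc e) (v c)}"
  using hist_Suc_cylinder[of "[]" e] by simp

lemma X_measurable [measurable]: "X k \<in> MZ \<rightarrow>\<^sub>M count_space UNIV"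
proof (subst measurable_count_space_eq_countable)
  have "X k -` {e} \<inter> space MZ \<in> sets MZ" for e
  proof -
    have "X k -` {e} \<inter> space MZ
        = (\<Union>es\<in>{es. length es = k}. {x \<in> Z. map (\<lambda>i. X i x) [0..<length es] = es \<and> X (length es) x = e})"
      by (auto intro!: exI[of _ "map (\<lambda>i. X i _) [0..<k]"])
    also have "\<dots> \<in> sets MZ"
    proof (intro sets.countable_UN'')
      fix es assume "es \<in> {es :: (nat \<times> nat) list. length es = k}"
      have "{x \<in> Z. map (\<lambda>i. X i x) [0..<length es] = es \<and> X (length es) x = e} \<in> sets borel"
        unfolding hist_Suc_cylinder by simp
      then show "{x \<in> Z. map (\<lambda>i. X i x) [0..<length es] = es \<and> X (length es) x = e} \<in> sets MZ"
        by (auto simp: sets_MZ_iff)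
    qed auto
    finally show ?thesis .
  qed
  then show "X k \<in> space MZ \<rightarrow> UNIV \<and> (\<forall>a\<in>UNIV. X k -` {a} \<inter> space MZ \<in> sets MZ)" by simp
qed simp

definition QK :: real where "QK = exp total_distortion / (v c - c)"
definition Q\<kappa> :: real where "Q\<kappa> = exp (- total_distortion) / (v c - c)"

text \<open>
  The cylinder of \<open>es @ [e]\<close> is the image of the cylinder of \<open>e\<close> under the composition that belongs to \<open>es\<close>. By bounded
  distortion this composition multiplies the lengths of the cylinder of \<open>e\<close> and of the whole return interval by
  comparable factors.
\<close>

lemma quasi_bernoulli_X: "quasi_bernoulli MZ X Q\<kappa> QK"
proof (intro quasi_bernoulli.intro quasi_bernoulli_axioms.intro finite_measure_MZ X_measurable)
  show "0 < Q\<kappa>" "0 < QK" using vc by (simp_all add: QK_def Q\<kappa>_def)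
next
    fix es :: "(nat \<times> nat) list" and e :: "nat \<times> nat"
    let ?\<phi> = "wmap (cw es)"
    let ?a = "wmap (cyc e) c" and ?b = "wmap (cyc e) (v c)"
    have ab: "?a \<in> {c..v c}" "?b \<in> {c..v c}" "?a \<le> ?b"
      using cyc_range[of c e] cyc_range[of "v c" e] vc c wmap_le[of c "v c" "cyc e"] by auto
    have 0: "\<P>(x in MZ. X 0 x = e) = ?b - ?a"
      using measure_cylinder[of "[e]"] X_0_singleton[of e] by simp
    have 1: "\<P>(x in MZ. map (\<lambda>i. X i x) [0..<length es] = es) = ?\<phi> (v c) - ?\<phi> c"
      using measure_cylinder[of es] hist_cylinder[of es] by simp
    have 2: "\<P>(x in MZ. map (\<lambda>i. X i x) [0..<length es] = es \<and> X (length es) x = e) = ?\<phi> ?b - ?\<phi> ?a"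
      using measure_cylinder[of "es @ [e]"] hist_Suc_cylinder[of es e] by (simp add: wmap_append)
    have up: "(?\<phi> ?b - ?\<phi> ?a) * (v c - c) \<le> exp total_distortion * ((?\<phi> (v c) - ?\<phi> c) * (?b - ?a))"
      using ab vc by (intro distortion_leD[OF cw_distortion]) auto
    have lo: "(?\<phi> (v c) - ?\<phi> c) * (?b - ?a) \<le> exp total_distortion * ((?\<phi> ?b - ?\<phi> ?a) * (v c - c))"
      using ab vc by (intro distortion_leD[OF cw_distortion]) auto
    show "\<P>(x in MZ. map (\<lambda>i. X i x) [0..<length es] = es \<and> X (length es) x = e)
      \<le> QK * \<P>(x in MZ. map (\<lambda>i. X i x) [0..<length es] = es) * \<P>(x in MZ. X 0 x = e)"
      unfolding 0 1 2 QK_def using up vc by (simp add: field_simps)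
    show "Q\<kappa> * \<P>(x in MZ. map (\<lambda>i. X i x) [0..<length es] = es) * \<P>(x in MZ. X 0 x = e)
      \<le> \<P>(x in MZ. map (\<lambda>i. X i x) [0..<length es] = es \<and> X (length es) x = e)"
      unfolding 0 1 2 Q\<kappa>_def using lo vc by (simp add: field_simps exp_minus)
qed

subsection \<open>Tails of the excursion lengths\<close>

lemma Z_cyc_eq:
  assumes "x \<in> Z" "idx x = (i, j)"
  shows "F x \<in> Z" "x = v ((u ^^ Suc i) ((v ^^ j) (F x)))"
  using Z_idx_F[OF assms(1)] assms(2) unfolding wmap_cyc[symmetric] by simp_all

lemma left_tail_set: "{x \<in> Z. r \<le> fst (X 0 x)} = G \<inter> {c<..<v (cl (Suc r))}"
proof -
  have "r \<le> fst (X 0 x) \<longleftrightarrow> x < v (cl (Suc r))" if x: "x \<in> Z" for x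
  proof -
    obtain i j where e: "idx x = (i, j)" by (cases "idx x")
    note Z_cyc_eq[OF x e]
    then show ?thesis
      using left_index_iff[of "(v ^^ j) (F x)" i r] Z_v_pow[of "F x" j] by (auto simp: X_0 e)
  qed
  moreover have "v (cl (Suc r)) \<le> v c"
    using cl_le[of "Suc 0" "Suc r"] cl_pos[of "Suc r"] c by (intro right.le) (auto simp: cl_simps u_1)
  ultimately show ?thesis by (auto simp: Z_def)
qed

lemma left_tail:
  "measure MZ {x \<in> Z. r \<le> fst (X 0 x)} \<le> cl (Suc r)"
  "cl (Suc r) \<le> B * measure MZ {x \<in> Z. r \<le> fst (X 0 x)}"
proof -
  have cl1: "cl (Suc r) \<le> c" using cl_le[of "Suc 0" "Suc r"] by (simp add: cl_simps u_1)
  have "measure MZ {x \<in> Z. r \<le> fst (X 0 x)} = v (cl (Suc r)) - v 0"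
    unfolding left_tail_set v_0 using cl_pos[of "Suc r"] cl1 c right.le[of 0 "cl (Suc r)"] right.le[of "cl (Suc r)" c]
    by (intro measure_MZ_interval) (auto simp: v_0)
  then show "measure MZ {x \<in> Z. r \<le> fst (X 0 x)} \<le> cl (Suc r)"
    "cl (Suc r) \<le> B * measure MZ {x \<in> Z. r \<le> fst (X 0 x)}"
    using right.contraction[of 0 "cl (Suc r)"] right.lower[of 0 "cl (Suc r)"] cl_pos[of "Suc r"] cl_le_1[of "Suc r"]
    by auto
qed

lemma right_tail_iff:
  assumes x: "x \<in> Z" "fst (X 0 x) = i"
  shows "r \<le> snd (X 0 x) \<longleftrightarrow> v ((u ^^ Suc i) (dr (Suc r))) < x"
proof -
  obtain j where e: "idx x = (i, j)" using x by (cases "idx x") (auto simp: X_0)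
  note eq = Z_cyc_eq[OF x(1) e]
  let ?w = "True # replicate (Suc i) False"
  have y: "(v ^^ j) (F x) \<in> {c<..<1}" using Z_v_pow[OF eq(1)] by blast
  have "wmap ?w (dr (Suc r)) < wmap ?w ((v ^^ j) (F x)) \<longleftrightarrow> dr (Suc r) < (v ^^ j) (F x)"
    using wmap_le[of "(v ^^ j) (F x)" "dr (Suc r)" ?w] wmap_less[of "dr (Suc r)" "(v ^^ j) (F x)" ?w] y c
      dr_less_1[of "Suc r"] dr_nonneg[of "Suc r"] by (auto simp del: replicate.simps wmap.simps simp: not_less[symmetric])
  moreover have "wmap ?w ((v ^^ j) (F x)) = x" "wmap ?w (dr (Suc r)) = v ((u ^^ Suc i) (dr (Suc r)))"
    using eq(2) unfolding wmap.simps wmap_replicate br.simps o_apply by simp_all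
  ultimately show ?thesis
    using right_index_iff[OF eq(1), of r j] by (simp add: X_0 e)
qed

lemma fst_X_eq: "x \<in> Z \<Longrightarrow> fst (X 0 x) = i \<Longrightarrow> x < v ((u ^^ Suc i) 1)"
  using left_tail_set[of i] by (auto simp: cl_def)

lemma B_pos: "B > 0"
proof (rule ccontr)
  assume "\<not> B > 0"
  then have "B * c \<le> 0" using c by (intro mult_nonpos_nonneg) auto
  then show False using left.lower[of 0 1] by (simp add: u_0 u_1)
qed

text \<open>
  The points that make exactly one step on the left and then at least \<open>Suc r\<close> steps on the right form the interval
  \<open>(v (u (dr (Suc r))), v (u 1))\<close>.
\<close>

lemma right_tail_0:
  "1 - dr (Suc r) \<le> B^2 * measure MZ {x \<in> Z. fst (X 0 x) = 0 \<and> r \<le> snd (X 0 x)}"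
proof -
  interpret finite_measure MZ by (rule finite_measure_MZ)
  let ?d = "dr (Suc r)"
  have d: "c \<le> ?d" "?d < 1" using dr_le[of "Suc 0" "Suc r"] dr_less_1[of "Suc r"] by (simp_all add: dr_simps v_0)
  have ud: "u c \<le> u ?d" "u ?d \<le> c" "0 \<le> u c" using d c left.le[of c ?d] left.le[of ?d 1] left.le[of 0 c] by (auto simp: u_0 u_1)
  have vu: "v (u c) \<le> v (u ?d)" "v (u ?d) \<le> v c" "c \<le> v (u c)"
    using ud c right.le[of 0 "u c"] by (auto intro!: right.le simp: v_0)
  have sub: "G \<inter> {v (u ?d)<..<v c} \<subseteq> {x \<in> Z. fst (X 0 x) = 0 \<and> r \<le> snd (X 0 x)}"
  proof
    fix x assume x: "x \<in> G \<inter> {v (u ?d)<..<v c}"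
    then have xZ: "x \<in> Z" using vu by (auto simp: Z_def)
    have "\<not> 1 \<le> fst (X 0 x)"
    proof -
      have "x \<notin> {x \<in> Z. 1 \<le> fst (X 0 x)}"
        unfolding left_tail_set using x vu by (auto simp: cl_simps u_1)
      then show ?thesis using xZ by blast
    qed
    then have 0: "fst (X 0 x) = 0" by simp
    then show "x \<in> {x \<in> Z. fst (X 0 x) = 0 \<and> r \<le> snd (X 0 x)}"
      using right_tail_iff[OF xZ 0, of r] x xZ by simp
  qed
  have "1 - ?d \<le> B * (c - u ?d)" using left.lower[of ?d 1] d c by (simp add: u_1)
  also have "\<dots> \<le> B * (B * (v c - v (u ?d)))"
    using right.lower[of "u ?d" c] ud c B_pos by (intro mult_left_mono) auto
  finally have *: "1 - ?d \<le> B * (B * (v c - v (u ?d)))" .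
  have "v c - v (u ?d) = measure MZ (G \<inter> {v (u ?d)<..<v c})"
    using vu by (subst measure_MZ_interval) auto
  also have "\<dots> \<le> measure MZ {x \<in> Z. fst (X 0 x) = 0 \<and> r \<le> snd (X 0 x)}"
  proof (rule finite_measure_mono[OF sub])
    have "{x \<in> space MZ. fst (X 0 x) = 0 \<and> r \<le> snd (X 0 x)} \<in> sets MZ" by measurable
    then show "{x \<in> Z. fst (X 0 x) = 0 \<and> r \<le> snd (X 0 x)} \<in> sets MZ" by simp
  qed
  finally have "B * (B * (v c - v (u ?d))) \<le> B * (B * measure MZ {x \<in> Z. fst (X 0 x) = 0 \<and> r \<le> snd (X 0 x)})"
    using B_pos by (intro mult_left_mono) auto
  then show ?thesis using * by (simp add: power2_eq_square ac_simps)
qed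

lemma wsum_replicate: "wsum (replicate n False) s t = (\<Sum>i<n. (u ^^ Suc i) t - (u ^^ Suc i) s)"
  by (induction n) (simp_all add: wmap_replicate)

text \<open>
  Summation over the length \<open>Suc i\<close> of the left run. By bounded distortion on the fundamental domain \<open>{c..1}\<close>, the \<open>i\<close>-th
  summand is at most a multiple of \<open>1 - dr (Suc r)\<close> times the length of the \<open>i\<close>-th image of \<open>{c..1}\<close>, and these
  images have total length at most one.
\<close>

lemma right_tail_upper:
  "measure MZ {x \<in> Z. r \<le> snd (X 0 x)} \<le> exp \<Lambda> / (1 - c) * (1 - dr (Suc r))"
proof -
  interpret finite_measure MZ by (rule finite_measure_MZ)
  let ?d = "dr (Suc r)"
  have d: "c \<le> ?d" "?d < 1" using dr_le[of "Suc 0" "Suc r"] dr_less_1[of "Suc r"] by (simp_all add: dr_simps v_0)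
  let ?A = "\<lambda>i. G \<inter> {v ((u ^^ Suc i) ?d)<..<v ((u ^^ Suc i) 1)}"
  have pow: "0 \<le> (u ^^ Suc i) ?d" "(u ^^ Suc i) ?d \<le> (u ^^ Suc i) 1" "(u ^^ Suc i) 1 \<le> c" for i
    using u_pow_range[of ?d i] u_pow_range[of 1 i] wmap_le[of ?d 1 "replicate (Suc i) False"] d c
    unfolding wmap_replicate by auto
  have A: "measure MZ (?A i) \<le> (u ^^ Suc i) 1 - (u ^^ Suc i) ?d" for i
  proof -
    have "measure MZ (?A i) = v ((u ^^ Suc i) 1) - v ((u ^^ Suc i) ?d)"
      using pow[of i] c right.le[of 0 "(u ^^ Suc i) ?d"] by (intro measure_MZ_interval right.le) (auto simp: v_0)
    also have "\<dots> \<le> (u ^^ Suc i) 1 - (u ^^ Suc i) ?d"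
      using pow[of i] c by (intro right.contraction) auto
    finally show ?thesis .
  qed
  have partial: "(\<Sum>i<n. measure MZ (?A i)) \<le> exp \<Lambda> / (1 - c) * (1 - ?d)" for n
  proof -
    have "wsum (replicate n False) ?d 1 * (1 - c) \<le> exp \<Lambda> * (wsum (replicate n False) c 1 * (1 - ?d))"
      using c d by (intro wsum_proportional wsum_u) auto
    also have "\<dots> \<le> exp \<Lambda> * (1 * (1 - ?d))"
      using d wsum_u[of n] by (intro mult_left_mono mult_right_mono) auto
    finally have "wsum (replicate n False) ?d 1 \<le> exp \<Lambda> / (1 - c) * (1 - ?d)"
      using c by (simp add: field_simps)
    moreover have "(\<Sum>i<n. measure MZ (?A i)) \<le> wsum (replicate n False) ?d 1"
      unfolding wsum_replicate by (intro sum_mono A)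
    ultimately show ?thesis by linarith
  qed
  have summ: "summable (\<lambda>i. measure MZ (?A i))"
    by (rule summableI_nonneg_bounded[OF _ partial]) simp
  have A_sets: "?A i \<in> sets MZ" for i
    using pow[of i] c right.le[of 0 "(u ^^ Suc i) ?d"] right.le[of "(u ^^ Suc i) 1" c]
    by (auto simp: sets_MZ_iff Z_def v_0)
  have "measure MZ {x \<in> Z. r \<le> snd (X 0 x)} \<le> measure MZ (\<Union>i. ?A i)"
  proof (rule finite_measure_mono)
    show "{x \<in> Z. r \<le> snd (X 0 x)} \<subseteq> (\<Union>i. ?A i)"
    proof
      fix x assume "x \<in> {x \<in> Z. r \<le> snd (X 0 x)}"
      then have "x \<in> ?A (fst (X 0 x))"
        using right_tail_iff[of x _ r] fst_X_eq[of x] Z_G[of x] by simp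
      then show "x \<in> (\<Union>i. ?A i)" by blast
    qed
    show "(\<Union>i. ?A i) \<in> sets MZ" using A_sets by blast
  qed
  also have "\<dots> \<le> (\<Sum>i. measure MZ (?A i))"
    using A_sets by (intro finite_measure_subadditive_countably summ) auto
  also have "\<dots> \<le> exp \<Lambda> / (1 - c) * (1 - ?d)"
    by (rule suminf_le_const[OF summ partial])
  finally show ?thesis .
qed

end

section \<open>Domination of the past by a single excursion\<close>

text \<open>
  The inductive step is the concavity of \<open>\<lambda>t. t powr (1 - \<gamma>)\<close>, in the form of Young's inequality.
\<close>

lemma sum_powr_minus_le:
  assumes "0 \<le> \<gamma>" "\<gamma> < 1"
  shows "(\<Sum>r=1..s. real r powr - \<gamma>) \<le> real s powr (1 - \<gamma>) / (1 - \<gamma>)"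
proof (induction s)
  case (Suc s)
  define b where "b = 1 - \<gamma>"
  have b: "0 < b" "b \<le> 1" using assms by (auto simp: b_def)
  have step: "real s powr b + b * real (Suc s) powr - \<gamma> \<le> real (Suc s) powr b"
  proof (cases "s = 0")
    case True
    then show ?thesis using b by simp
  next
    case False
    have "(real s / real (Suc s)) powr b * 1 powr (1 - b) \<le> b * (real s / real (Suc s)) + (1 - b) * 1"
      using b False by (intro Youngs_inequality_0) auto
    also have "\<dots> = 1 - b / real (Suc s)" by (simp add: field_simps)
    finally have le: "(real s / real (Suc s)) powr b \<le> 1 - b / real (Suc s)" by simp
    have "real s powr b = (real s / real (Suc s)) powr b * real (Suc s) powr b"
      by (simp add: powr_divide)
    also have "\<dots> \<le> (1 - b / real (Suc s)) * real (Suc s) powr b"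
      using le by (intro mult_right_mono) auto
    also have "\<dots> = real (Suc s) powr b - b * (real (Suc s) powr b / real (Suc s))"
      by (simp add: algebra_simps)
    also have "real (Suc s) powr b / real (Suc s) = real (Suc s) powr - \<gamma>"
      by (simp add: b_def powr_diff powr_minus_divide)
    finally show ?thesis by linarith
  qed
  have "(\<Sum>r=1..Suc s. real r powr - \<gamma>) \<le> real s powr b / b + real (Suc s) powr - \<gamma>"
    using Suc by (simp add: b_def)
  also have "\<dots> = (real s powr b + b * real (Suc s) powr - \<gamma>) / b"
    using b by (simp add: add_divide_distrib)
  also have "\<dots> \<le> real (Suc s) powr b / b"
    using step b by (intro divide_right_mono) auto
  finally show ?case by (simp add: b_def)
qed simp

context coded_map
begin

definition time :: "nat \<Rightarrow> real \<Rightarrow> nat" where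
  "time k x = (\<Sum>i<k. len (X i x))"

text \<open>
  The right excursions that are long compared with the past are required to follow a left excursion of the minimal length, so
  that this left excursion does not count.
\<close>

definition dominating_excursions :: "real \<Rightarrow> bool" where
  "dominating_excursions x \<longleftrightarrow> (\<forall>m::nat. \<forall>\<^sub>F k in sequentially. m * k \<le> time k x)
     \<and> (\<forall>m::nat. \<exists>\<^sub>\<infinity>k. m * time k x \<le> fst (X k x))
     \<and> (\<forall>m::nat. \<exists>\<^sub>\<infinity>k. fst (X k x) = 0 \<and> m * time k x \<le> snd (X k x))"

text \<open>
  The tail \<open>cl\<close> is used as the reference tail. Its regularity gives the bound for the truncated mean, and since
  the tails of both kinds of excursions are bounded from below by a multiple of it, \<open>frequently_hits\<close>
  applies to left and to right excursions.
\<close>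

lemma excursions_dominate:
  fixes \<gamma> R A :: real
  assumes \<gamma>: "0 < \<gamma>" "\<gamma> < 1" and R: "R > 0" and A: "A > 0"
    and reg: "\<And>j s. 1 \<le> j \<Longrightarrow> j \<le> s \<Longrightarrow> cl j \<le> R * (real s / real j) powr \<gamma> * cl s"
    and comp: "\<And>n. n \<ge> 1 \<Longrightarrow> cl n \<le> A * (1 - dr n)" "\<And>n. n \<ge> 1 \<Longrightarrow> 1 - dr n \<le> A * cl n"
  shows "AE x in MZ. dominating_excursions x"
proof -
  interpret quasi_bernoulli MZ X Q\<kappa> QK by (rule quasi_bernoulli_X)
  define \<tau> where "\<tau> r = cl (Suc r)" for r
  have \<tau>_pos: "\<tau> r > 0" for r by (simp add: \<tau>_def cl_pos)
  have q_left: "q {e. r \<le> fst e} \<ge> \<tau> r / B" for r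
    using left_tail(2)[of r] B_pos by (simp add: q_def \<tau>_def field_simps)
  have \<tau>_reg: "\<tau> j \<le> R * (real s / real j) powr \<gamma> * \<tau> s" if "1 \<le> j" "j \<le> s" for j s
  proof -
    have "\<tau> j \<le> R * (real (Suc s) / real (Suc j)) powr \<gamma> * \<tau> s"
      unfolding \<tau>_def using that by (intro reg) auto
    also have "\<dots> \<le> R * (real s / real j) powr \<gamma> * \<tau> s"
    proof -
      have "real (Suc s) / real (Suc j) \<le> real s / real j"
        using that by (simp add: field_simps)
      then show ?thesis using R \<gamma> \<tau>_pos[of s]
        by (intro mult_right_mono mult_left_mono powr_mono2) auto
    qed
    finally show ?thesis .
  qed
  have \<tau>_scale: "\<tau> s / (R * real m powr \<gamma>) \<le> \<tau> (m * s)" if "m \<ge> 1" "s \<ge> 1" for m s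
  proof -
    have "\<tau> s \<le> R * (real (m * s) / real s) powr \<gamma> * \<tau> (m * s)"
      using that by (intro \<tau>_reg) auto
    also have "real (m * s) / real s = real m" using that by simp
    finally show ?thesis using that R by (simp add: field_simps)
  qed
  define D where "D = (1 + exp \<Lambda> / (1 - c) * A)"
  have D: "D > 0" using A c by (auto simp: D_def intro!: add_pos_nonneg)
  have q_len: "q {e. r \<le> len e} \<le> D * (R * 4 powr \<gamma>) * (real s / real r) powr \<gamma> * \<tau> s"
    if r: "1 \<le> r" "r \<le> s" for r s
  proof -
    \<comment> \<open>If both indices were less than \<open>h\<close>, the length would be at most \<open>2 * h < r\<close>.\<close>
    define h where "h = (r - 1) div 2"
    have h: "real r \<le> 2 * real (Suc h)" "h \<le> s" using r by (auto simp: h_def)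
    have "q {e. r \<le> len e} \<le> measure MZ ({x \<in> Z. h \<le> fst (X 0 x)} \<union> {x \<in> Z. h \<le> snd (X 0 x)})"
      unfolding q_def
    proof (rule finite_measure_mono)
      show "{x \<in> space MZ. X 0 x \<in> {e. r \<le> len e}} \<subseteq> {x \<in> Z. h \<le> fst (X 0 x)} \<union> {x \<in> Z. h \<le> snd (X 0 x)}"
        using r by (auto simp: len_def h_def)
      have "{x \<in> space MZ. h \<le> fst (X 0 x)} \<union> {x \<in> space MZ. h \<le> snd (X 0 x)} \<in> sets MZ" by measurable
      then show "{x \<in> Z. h \<le> fst (X 0 x)} \<union> {x \<in> Z. h \<le> snd (X 0 x)} \<in> sets MZ" by simp
    qed
    also have "\<dots> \<le> measure MZ {x \<in> Z. h \<le> fst (X 0 x)} + measure MZ {x \<in> Z. h \<le> snd (X 0 x)}"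
    proof (rule measure_Un_le)
      have "{x \<in> space MZ. h \<le> fst (X 0 x)} \<in> sets MZ" "{x \<in> space MZ. h \<le> snd (X 0 x)} \<in> sets MZ" by measurable
      then show "{x \<in> Z. h \<le> fst (X 0 x)} \<in> sets MZ" "{x \<in> Z. h \<le> snd (X 0 x)} \<in> sets MZ" by simp_all
    qed
    also have "\<dots> \<le> cl (Suc h) + exp \<Lambda> / (1 - c) * (1 - dr (Suc h))"
      by (intro add_mono left_tail right_tail_upper)
    also have "\<dots> \<le> cl (Suc h) + exp \<Lambda> / (1 - c) * (A * cl (Suc h))"
      using comp(2)[of "Suc h"] c by (intro add_left_mono mult_left_mono) auto
    also have "\<dots> = D * cl (Suc h)" by (simp add: D_def algebra_simps)
    also have "\<dots> \<le> D * (R * (real (Suc s) / real (Suc h)) powr \<gamma> * cl (Suc s))"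
      using D h by (intro mult_left_mono reg) auto
    also have "\<dots> \<le> D * (R * (4 * (real s / real r)) powr \<gamma> * cl (Suc s))"
    proof -
      have "real (Suc s) / real (Suc h) \<le> (2 * real s) / (real r / 2)"
        using h r by (intro frac_le) auto
      also have "\<dots> = 4 * (real s / real r)" by simp
      finally show ?thesis using D R \<gamma> cl_pos[of "Suc s"]
        by (intro mult_left_mono mult_right_mono powr_mono2) auto
    qed
    also have "\<dots> = D * (R * 4 powr \<gamma>) * (real s / real r) powr \<gamma> * \<tau> s"
      unfolding \<tau>_def by (subst powr_mult) simp_all
    finally show ?thesis .
  qed
  define C where "C = D * (R * 4 powr \<gamma>) / (1 - \<gamma>)"
  have C: "C > 0" using D R \<gamma> by (simp add: C_def)
  have mean: "(\<Sum>r=1..s. q {e. r \<le> len e}) \<le> C * real s * \<tau> s" if "s \<ge> 1" for s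
  proof -
    have "(\<Sum>r=1..s. q {e. r \<le> len e}) \<le> (\<Sum>r=1..s. D * (R * 4 powr \<gamma>) * (real s / real r) powr \<gamma> * \<tau> s)"
      by (intro sum_mono q_len) auto
    also have "\<dots> = (\<Sum>r=1..s. (D * (R * 4 powr \<gamma>) * real s powr \<gamma> * \<tau> s) * real r powr - \<gamma>)"
      by (intro sum.cong) (auto simp: powr_divide powr_minus_divide)
    also have "\<dots> = D * (R * 4 powr \<gamma>) * real s powr \<gamma> * \<tau> s * (\<Sum>r=1..s. real r powr - \<gamma>)"
      by (simp only: sum_distrib_left)
    also have "\<dots> \<le> D * (R * 4 powr \<gamma>) * real s powr \<gamma> * \<tau> s * (real s powr (1 - \<gamma>) / (1 - \<gamma>))"
      using D R \<tau>_pos[of s] \<gamma> by (intro mult_left_mono sum_powr_minus_le) auto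
    also have "\<dots> = C * (real s powr \<gamma> * real s powr (1 - \<gamma>)) * \<tau> s"
      by (simp add: C_def)
    also have "real s powr \<gamma> * real s powr (1 - \<gamma>) = real s"
      using that by (simp add: powr_add[symmetric])
    finally show ?thesis .
  qed
  define \<eta> where "\<eta> = \<tau> 1 / (R * B)"
  have heavy: "\<eta> * real r powr - \<gamma> \<le> q {e. r \<le> len e}" if "r \<ge> 1" for r
  proof -
    have "\<eta> * real r powr - \<gamma> = (\<tau> 1 / (R * real r powr \<gamma>)) / B"
      by (simp add: \<eta>_def powr_minus_divide)
    also have "\<dots> \<le> \<tau> r / B"
      using \<tau>_scale[of r 1] that B_pos by (intro divide_right_mono) auto
    also have "\<dots> \<le> q {e. r \<le> fst e}" by (rule q_left)
    also have "\<dots> \<le> q {e. r \<le> len e}"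
    proof -
      have "{x \<in> space MZ. X 0 x \<in> {e. r \<le> len e}} \<in> sets MZ" by measurable
      then show ?thesis unfolding q_def by (intro finite_measure_mono) (auto simp: len_def)
    qed
    finally show ?thesis .
  qed
  interpret heavy_tailed_lengths MZ X Q\<kappa> QK len \<tau> C \<gamma> \<eta>
  proof
    show "\<tau> \<longlonglongrightarrow> 0" unfolding \<tau>_def using LIMSEQ_Suc[OF cl_limit] .
    show "0 < \<eta>" using \<tau>_pos R B_pos by (simp add: \<eta>_def)
  qed (use \<tau>_pos C \<gamma> mean heavy in \<open>auto simp: len_def\<close>)
  have S_eq: "S = time" by (intro ext) (simp add: S_def time_def)
  have L: "AE x in MZ. \<forall>m::nat. \<exists>\<^sub>\<infinity>k. X k x \<in> {e. m * S k x \<le> fst e}"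
  proof (rule frequently_hits)
    fix m :: nat assume m: "m \<ge> 1"
    show "\<exists>\<theta>>0. \<forall>s\<ge>1. \<theta> * \<tau> s \<le> q {e. m * s \<le> fst e}"
    proof (intro exI[of _ "1 / (R * real m powr \<gamma> * B)"] conjI allI impI)
      show "0 < 1 / (R * real m powr \<gamma> * B)" using R B_pos m by simp
      fix s :: nat assume "s \<ge> 1"
      have "1 / (R * real m powr \<gamma> * B) * \<tau> s = (\<tau> s / (R * real m powr \<gamma>)) / B" by simp
      also have "\<dots> \<le> \<tau> (m * s) / B" using \<tau>_scale[OF m \<open>s \<ge> 1\<close>] B_pos by (intro divide_right_mono) auto
      also have "\<dots> \<le> q {e. m * s \<le> fst e}" by (rule q_left)
      finally show "1 / (R * real m powr \<gamma> * B) * \<tau> s \<le> q {e. m * s \<le> fst e}" .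
    qed
  qed (auto simp: len_def)
  have q_right: "q {e. fst e = 0 \<and> r \<le> snd e} \<ge> \<tau> r / (A * B\<^sup>2)" for r
  proof -
    have "\<tau> r \<le> A * (1 - dr (Suc r))" unfolding \<tau>_def by (rule comp) simp
    also have "\<dots> \<le> A * (B^2 * measure MZ {x \<in> Z. fst (X 0 x) = 0 \<and> r \<le> snd (X 0 x)})"
      using A by (intro mult_left_mono right_tail_0) auto
    also have "\<dots> = A * B^2 * q {e. fst e = 0 \<and> r \<le> snd e}" by (simp add: q_def)
    finally show ?thesis using A B_pos by (simp add: field_simps)
  qed
  have R': "AE x in MZ. \<forall>m::nat. \<exists>\<^sub>\<infinity>k. X k x \<in> {e. fst e = 0 \<and> m * S k x \<le> snd e}"
  proof (rule frequently_hits)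
    fix m :: nat assume m: "m \<ge> 1"
    show "\<exists>\<theta>>0. \<forall>s\<ge>1. \<theta> * \<tau> s \<le> q {e. fst e = 0 \<and> m * s \<le> snd e}"
    proof (intro exI[of _ "1 / (R * real m powr \<gamma> * (A * B\<^sup>2))"] conjI allI impI)
      show "0 < 1 / (R * real m powr \<gamma> * (A * B\<^sup>2))" using R B_pos A m by simp
      fix s :: nat assume "s \<ge> 1"
      have "1 / (R * real m powr \<gamma> * (A * B\<^sup>2)) * \<tau> s = (\<tau> s / (R * real m powr \<gamma>)) / (A * B\<^sup>2)" by simp
      also have "\<dots> \<le> \<tau> (m * s) / (A * B\<^sup>2)" using \<tau>_scale[OF m \<open>s \<ge> 1\<close>] B_pos A by (intro divide_right_mono) auto
      also have "\<dots> \<le> q {e. fst e = 0 \<and> m * s \<le> snd e}" by (rule q_right)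
      finally show "1 / (R * real m powr \<gamma> * (A * B\<^sup>2)) * \<tau> s \<le> q {e. fst e = 0 \<and> m * s \<le> snd e}" .
    qed
  qed (auto simp: len_def)
  show ?thesis
    using S_superlinear L R' by eventually_elim (auto simp: S_eq dominating_excursions_def)
qed

end

section \<open>From excursions to time averages\<close>

context coded_map
begin

definition bsum :: "(real \<Rightarrow> real) \<Rightarrow> nat \<Rightarrow> real \<Rightarrow> real" where
  "bsum g n x = (\<Sum>j<n. g ((f ^^ j) x))"

lemma bsum_0 [simp]: "bsum g 0 x = 0"
  by (simp add: bsum_def)

lemma bsum_add: "bsum g (m + n) x = bsum g m x + bsum g n ((f ^^ m) x)"
  by (induction n) (simp_all add: bsum_def funpow_add[THEN fun_cong, simplified o_apply] add.commute[of m])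

lemma bsum_mono: "(\<And>y. g y \<ge> 0) \<Longrightarrow> m \<le> n \<Longrightarrow> bsum g m x \<le> bsum g n x"
  unfolding bsum_def by (intro sum_mono2) auto

lemma bsum_le: "(\<And>y. g y \<le> 1) \<Longrightarrow> bsum g n x \<le> real n"
  unfolding bsum_def using sum_mono[of "{..<n}" "\<lambda>j. g ((f ^^ j) x)" "\<lambda>_. 1"] by simp

abbreviation visits :: "nat \<Rightarrow> real \<Rightarrow> real" where
  "visits \<equiv> bsum (indicator Z)"

abbreviation rights :: "nat \<Rightarrow> real \<Rightarrow> real" where
  "rights \<equiv> bsum (indicator {c<..})"

lemma funpow_wmap_drop:
  assumes "y \<in> {0<..<1}" "n \<le> length w"
  shows "(f ^^ n) (wmap w y) = wmap (drop n w) y"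
proof -
  have "wmap w y = wmap (take n w) (wmap (drop n w) y)"
    by (simp flip: wmap_append)
  then show ?thesis
    using funpow_wmap[OF wmap_open[OF assms(1)], of "take n w" "drop n w"] assms(2) by simp
qed

lemma itinerary:
  assumes "y \<in> {0<..<1}" "n < length w"
  shows "c < (f ^^ n) (wmap w y) \<longleftrightarrow> w ! n"
proof -
  have "(f ^^ n) (wmap w y) = br (w ! n) (wmap (drop (Suc n) w) y)"
    using assms by (simp add: funpow_wmap_drop flip: Cons_nth_drop_Suc)
  then show ?thesis
    using u_side[OF wmap_open[OF assms(1)], of "drop (Suc n) w"]
      v_side[OF wmap_open[OF assms(1)], of "drop (Suc n) w"] by (cases "w ! n") auto
qed

lemma F_pow_Z: "x \<in> Z \<Longrightarrow> (F ^^ k) x \<in> Z"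
  by (induction k) (auto intro: Z_idx_F)

lemma time_Suc: "time (Suc k) x = time k x + len (X k x)"
  by (simp add: time_def)

lemma F_pow_eq: "(F ^^ k) x = (f ^^ time k x) x"
proof (induction k)
  case (Suc k)
  have "(F ^^ Suc k) x = (f ^^ len (X k x)) ((F ^^ k) x)"
    by (simp add: F_def X_def)
  also have "\<dots> = (f ^^ (len (X k x) + time k x)) x"
    by (simp add: Suc funpow_add)
  finally show ?case by (simp add: time_Suc add.commute)
qed (simp add: time_def)

lemma time_mono: "k \<le> k' \<Longrightarrow> time k x \<le> time k' x"
  unfolding time_def by (intro sum_mono2) auto

lemma time_ge: "k \<le> time k x"
proof (induction k)
  case (Suc k)
  then show ?case by (simp add: time_Suc len_def)
qed simp

lemma Z_code:
  assumes "z \<in> Z"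
  obtains z' i j where "z' \<in> Z" "idx z = (i, j)" "z = wmap (cyc (i, j)) z'"
proof -
  obtain i j where "idx z = (i, j)" by (cases "idx z")
  then show thesis using Z_idx_F[OF assms] that by metis
qed

lemma cyc_nth:
  assumes "n < i + j + 2"
  shows "cyc (i, j) ! n \<longleftrightarrow> n = 0 \<or> n \<ge> i + 2"
  using assms by (cases n) (auto simp: cyc_def nth_append nth_Cons' simp del: replicate.simps)

text \<open>
  In the code of a cycle, the letter \<open>True\<close> is followed by \<open>False\<close> only at the beginning.
\<close>

lemma visit_once:
  assumes z: "z \<in> Z" and n: "1 \<le> n" "n < len (idx z)"
  shows "(f ^^ n) z \<notin> Z"
proof -
  obtain z' i j where z': "z' \<in> Z" "idx z = (i, j)" "z = wmap (cyc (i, j)) z'"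
    using Z_code[OF z] .
  have z'01: "z' \<in> {0<..<1}" using G_open[OF Z_G[OF z'(1)]] .
  have n': "n < i + j + 2" using n z'(2) by (simp add: len_def)
  show ?thesis
  proof (cases "n \<ge> i + 2")
    case False
    then have "\<not> c < (f ^^ n) z"
      using itinerary[OF z'01, of n "cyc (i, j)"] cyc_nth[OF n'] n n' by (simp add: z'(3) length_cyc len_def)
    then show ?thesis using Z_between by force
  next
    case True
    define l where "l = i + j + 2 - n"
    have l: "l \<ge> 1" using n' by (simp add: l_def)
    have "cyc (i, j) = (True # replicate (Suc i) False) @ replicate j True"
      by (simp add: cyc_def del: replicate.simps)
    then have "drop n (cyc (i, j)) = replicate (j - (n - (i + 2))) True"
      using True by (simp only: drop_append drop_replicate) simp
    also have "j - (n - (i + 2)) = l" using True by (simp add: l_def)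
    finally have "(f ^^ n) z = (v ^^ l) z'"
      using n' by (simp add: z'(3) funpow_wmap_drop[OF z'01] length_cyc len_def wmap_replicate)
    moreover have "dr (Suc 1) < (v ^^ l) z'"
      using right_index_iff[OF z'(1), of 1 l] l by simp
    ultimately show ?thesis using Z_between by (force simp: dr_simps v_0)
  qed
qed

lemma visits_cycle: "z \<in> Z \<Longrightarrow> visits (len (idx z)) z \<le> 1"
proof -
  assume z: "z \<in> Z"
  have "visits (len (idx z)) z \<le> (\<Sum>n<len (idx z). if n = 0 then 1 else 0)"
    unfolding bsum_def using visit_once[OF z] by (intro sum_mono) (auto simp: indicator_def Suc_le_eq)
  then show ?thesis by (simp split: if_splits)
qed

lemma visits_time: "x \<in> Z \<Longrightarrow> visits (time k x) x \<le> real k"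
proof (induction k)
  case (Suc k)
  have "visits (time (Suc k) x) x = visits (time k x) x + visits (len (idx ((F ^^ k) x))) ((F ^^ k) x)"
    by (simp add: time_Suc bsum_add F_pow_eq X_def)
  then show ?case using Suc visits_cycle[OF F_pow_Z[OF Suc.prems], of k] by simp
qed (simp add: time_def)

text \<open>
  The number of visits is the inverse function of the return times, which grow superlinearly.
\<close>

lemma visits_sublinear:
  assumes x: "x \<in> Z" and time: "\<And>m::nat. \<forall>\<^sub>F k in sequentially. m * k \<le> time k x"
  shows "(\<lambda>n. visits n x / real n) \<longlonglongrightarrow> 0"
proof (rule LIMSEQ_I)
  fix \<epsilon> :: real assume \<epsilon>: "\<epsilon> > 0"
  obtain m :: nat where m: "2 / \<epsilon> < real m" using reals_Archimedean2 by blast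
  then have m0: "real m > 0" using \<epsilon> by (meson divide_pos_pos less_trans zero_less_numeral)
  obtain k0 where k0: "\<And>k. k \<ge> k0 \<Longrightarrow> m * k \<le> time k x"
    using time[of m] by (auto simp: eventually_sequentially)
  show "\<exists>N. \<forall>n\<ge>N. norm (visits n x / real n - 0) < \<epsilon>"
  proof (intro exI allI impI)
    fix n assume n: "n \<ge> Suc (max (time k0 x) m)"
    have "\<exists>k. n < time k x" using time_ge[of "Suc n" x] by (intro exI[of _ "Suc n"]) simp
    \<comment> \<open>Time \<open>n\<close> lies in the cycle number \<open>k = k' - 1\<close>.\<close>
    define k' where "k' = (LEAST k. n < time k x)"
    have k': "n < time k' x" unfolding k'_def by (rule LeastI_ex) fact
    have "k' \<noteq> 0" using k' by (intro notI) (simp add: time_def)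
    then obtain k where k: "k' = Suc k" by (cases k') auto
    have "\<not> n < time k x" using not_less_Least[of k "\<lambda>k. n < time k x"] k by (simp add: k'_def)
    moreover have "k \<ge> k0"
    proof (rule ccontr)
      assume "\<not> k \<ge> k0"
      then have "time k' x \<le> time k0 x" using k by (intro time_mono) simp
      then show False using k' n by simp
    qed
    ultimately have mk: "m * k \<le> n" using k0[of k] by simp
    have "visits n x \<le> visits (time k' x) x" using k' by (intro bsum_mono) auto
    also have "\<dots> \<le> real k + 1" using visits_time[OF x, of k'] k by simp
    finally have "real m * visits n x \<le> real m * (real k + 1)" using m0 by (intro mult_left_mono) auto
    also have "\<dots> \<le> real n + real m" using mk by (simp add: distrib_left flip: of_nat_mult)
    also have "\<dots> \<le> 2 * real n" using n by simp
    finally have "visits n x / real n \<le> 2 / real m" using m0 n by (simp add: field_simps)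
    also have "\<dots> < \<epsilon>" using m m0 \<epsilon> by (simp add: field_simps)
    finally show "norm (visits n x / real n - 0) < \<epsilon>"
      by (simp add: bsum_def sum_nonneg)
  qed
qed

text \<open>
  At the end of an excursion that is much longer than the time before it, most of the time has been spent in this excursion.
\<close>

lemma rare_if_absent_from_long_excursions:
  assumes g: "\<And>y. g y \<le> 1"
    and long: "\<And>m::nat. \<exists>\<^sub>\<infinity>k. \<exists>l. m * time k x \<le> l \<and> bsum g l ((F ^^ k) x) \<le> 1" and \<epsilon>: "\<epsilon> > 0"
  shows "\<exists>\<^sub>\<infinity>n. bsum g n x \<le> \<epsilon> * real n"
  unfolding INFM_nat_le
proof
  fix N
  obtain m :: nat where m: "2 / \<epsilon> < real m" using reals_Archimedean2 by blast
  obtain k l where k: "k \<ge> max N 1" and l: "m * time k x \<le> l" "bsum g l ((F ^^ k) x) \<le> 1"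
    using long[of m] unfolding INFM_nat_le by blast
  define n where "n = time k x + l"
  have "bsum g n x = bsum g (time k x) x + bsum g l ((F ^^ k) x)"
    unfolding n_def bsum_add by (simp only: F_pow_eq)
  then have "bsum g n x \<le> real (time k x) + 1" using bsum_le[of g "time k x" x, OF g] l by simp
  also have "\<dots> \<le> 2 * real (time k x)" using time_ge[of k x] k by simp
  also have "\<dots> \<le> \<epsilon> * (real m * real (time k x))"
  proof -
    have "2 \<le> \<epsilon> * real m" using m \<epsilon> by (simp add: field_simps)
    then show ?thesis using mult_right_mono[of 2 "\<epsilon> * real m" "real (time k x)"] by (simp add: mult.assoc)
  qed
  also have "\<dots> \<le> \<epsilon> * real n"
  proof (intro mult_left_mono)
    have "m * time k x \<le> n" using l by (simp add: n_def)
    then show "real m * real (time k x) \<le> real n" by (simp flip: of_nat_mult)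
  qed (use \<epsilon> in auto)
  finally have "bsum g n x \<le> \<epsilon> * real n" .
  moreover have "n \<ge> N" using time_ge[of k x] k by (simp add: n_def)
  ultimately show "\<exists>n\<ge>N. bsum g n x \<le> \<epsilon> * real n" by blast
qed

lemma side_in_cycle:
  assumes "z \<in> Z" "idx z = (i, j)" "l < i + j + 2"
  shows "c < (f ^^ l) z \<longleftrightarrow> l = 0 \<or> l \<ge> i + 2"
proof -
  obtain z' where z': "z' \<in> Z" "z = wmap (cyc (i, j)) z'"
    using Z_idx_F[OF assms(1)] assms(2) by metis
  show ?thesis
    using itinerary[OF G_open[OF Z_G[OF z'(1)]], of l "cyc (i, j)"] cyc_nth[OF assms(3)] assms(3)
    by (simp add: z'(2) length_cyc len_def)
qed

lemma rights_rare:
  assumes x: "x \<in> Z" and left: "\<And>m::nat. \<exists>\<^sub>\<infinity>k. m * time k x \<le> fst (X k x)" and \<epsilon>: "\<epsilon> > 0"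
  shows "\<exists>\<^sub>\<infinity>n. rights n x \<le> \<epsilon> * real n"
proof (rule rare_if_absent_from_long_excursions[OF _ _ \<epsilon>])
  fix m :: nat
  show "\<exists>\<^sub>\<infinity>k. \<exists>l. m * time k x \<le> l \<and> rights l ((F ^^ k) x) \<le> 1"
  proof (rule INFM_mono[OF left[of m]])
    fix k assume k: "m * time k x \<le> fst (X k x)"
    obtain i j where e: "idx ((F ^^ k) x) = (i, j)" by (cases "idx ((F ^^ k) x)")
    have "rights (i + 2) ((F ^^ k) x) \<le> (\<Sum>l<i + 2. if l = 0 then 1 else 0)"
      unfolding bsum_def
      using side_in_cycle[OF F_pow_Z[OF x] e] by (intro sum_mono) (auto simp: indicator_def)
    also have "\<dots> = 1" by (subst sum.delta) auto
    finally show "\<exists>l. m * time k x \<le> l \<and> rights l ((F ^^ k) x) \<le> 1"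
      using k by (intro exI[of _ "i + 2"]) (simp add: X_def e)
  qed
qed (simp add: indicator_def)

lemma lefts_rare:
  assumes x: "x \<in> Z" and right: "\<And>m::nat. \<exists>\<^sub>\<infinity>k. fst (X k x) = 0 \<and> m * time k x \<le> snd (X k x)" and \<epsilon>: "\<epsilon> > 0"
  shows "\<exists>\<^sub>\<infinity>n. real n - rights n x \<le> \<epsilon> * real n"
proof -
  let ?g = "\<lambda>y. 1 - indicat_real {c<..} y"
  have "\<exists>\<^sub>\<infinity>n. bsum ?g n x \<le> \<epsilon> * real n"
  proof (rule rare_if_absent_from_long_excursions[OF _ _ \<epsilon>])
    fix m :: nat
    show "\<exists>\<^sub>\<infinity>k. \<exists>l. m * time k x \<le> l \<and> bsum ?g l ((F ^^ k) x) \<le> 1"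
    proof (rule INFM_mono[OF right[of m]])
      fix k assume k: "fst (X k x) = 0 \<and> m * time k x \<le> snd (X k x)"
      then obtain j where e: "idx ((F ^^ k) x) = (0, j)" by (cases "idx ((F ^^ k) x)") (auto simp: X_def)
      have "bsum ?g (j + 2) ((F ^^ k) x) \<le> (\<Sum>l<j + 2. if l = 1 then 1 else 0)"
        unfolding bsum_def
        using side_in_cycle[OF F_pow_Z[OF x] e] by (intro sum_mono) (auto simp: indicator_def)
      also have "\<dots> = 1" by (subst sum.delta) auto
      finally show "\<exists>l. m * time k x \<le> l \<and> bsum ?g l ((F ^^ k) x) \<le> 1"
        using k by (intro exI[of _ "j + 2"]) (simp add: X_def e)
    qed
  qed (simp add: indicator_def)
  then show ?thesis by (simp add: bsum_def sum_subtractf)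
qed

definition wandering :: "real \<Rightarrow> bool" where
  "wandering x \<longleftrightarrow> (\<lambda>n. visits n x / real n) \<longlonglongrightarrow> 0
     \<and> (\<forall>\<epsilon>>0. \<exists>\<^sub>\<infinity>n. rights n x \<le> \<epsilon> * real n)
     \<and> (\<forall>\<epsilon>>0. \<exists>\<^sub>\<infinity>n. real n - rights n x \<le> \<epsilon> * real n)"

text \<open>
  A finite initial piece of the orbit of length \<open>l\<close> does not affect the asymptotic behavior.
\<close>

lemma shift_frequent:
  assumes a: "\<And>n. a (n + l) \<le> real l + b n" and b: "\<And>\<epsilon>. \<epsilon> > 0 \<Longrightarrow> \<exists>\<^sub>\<infinity>n. b n \<le> \<epsilon> * real n" and \<epsilon>: "\<epsilon> > 0"
  shows "\<exists>\<^sub>\<infinity>n. a n \<le> \<epsilon> * real n"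
  unfolding INFM_nat_le
proof
  fix N
  obtain N' :: nat where N': "real l \<le> real N' * (\<epsilon> / 2)"
    using reals_Archimedean3[of "\<epsilon> / 2"] \<epsilon> by (metis half_gt_zero less_eq_real_def)
  obtain n where n: "n \<ge> max N N'" "b n \<le> \<epsilon> / 2 * real n"
    using b[of "\<epsilon> / 2"] \<epsilon> unfolding INFM_nat_le by (meson half_gt_zero)
  have "real N' * (\<epsilon> / 2) \<le> real n * (\<epsilon> / 2)" using n \<epsilon> by (intro mult_right_mono) auto
  then have "a (n + l) \<le> \<epsilon> * real n" using a[of n] n N' by (simp add: field_simps)
  also have "\<dots> \<le> \<epsilon> * real (n + l)" using \<epsilon> by simp
  finally show "\<exists>n\<ge>N. a n \<le> \<epsilon> * real n" using n by (intro exI[of _ "n + l"]) auto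
qed

lemma wandering_shift:
  assumes "wandering ((f ^^ l) x)"
  shows "wandering x"
  unfolding wandering_def
proof (intro conjI allI impI)
  let ?y = "(f ^^ l) x"
  have split: "bsum g (n + l) x = bsum g l x + bsum g n ?y" for g n
    by (metis add.commute bsum_add)
  have le: "bsum (indicator A) l x \<le> real l" "0 \<le> bsum (indicator A) l x" for A
    by (rule bsum_le) (simp_all add: indicator_def bsum_def sum_nonneg)
  show "(\<lambda>n. visits n x / real n) \<longlonglongrightarrow> 0"
  proof (rule tendsto_sandwich[where f = "\<lambda>_. 0" and h = "\<lambda>n. real l / real n + visits n ?y / real n"])
    show "\<forall>\<^sub>F n in sequentially. visits n x / real n \<le> real l / real n + visits n ?y / real n"
    proof (rule always_eventually, intro allI)
      fix n
      have "visits n x \<le> visits (n + l) x" by (intro bsum_mono) auto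
      also have "\<dots> \<le> real l + visits n ?y" using split le(1)[of Z] by simp
      finally show "visits n x / real n \<le> real l / real n + visits n ?y / real n"
        by (simp add: add_divide_distrib[symmetric] divide_right_mono)
    qed
    have "(\<lambda>n. real l / real n + visits n ?y / real n) \<longlonglongrightarrow> 0 + 0"
      using assms unfolding wandering_def by (intro tendsto_add lim_const_over_n) auto
    then show "(\<lambda>n. real l / real n + visits n ?y / real n) \<longlonglongrightarrow> 0" by simp
    show "\<forall>\<^sub>F n in sequentially. 0 \<le> visits n x / real n"
      by (auto simp: bsum_def sum_nonneg)
  qed simp
  fix \<epsilon> :: real assume \<epsilon>: "\<epsilon> > 0"
  show "\<exists>\<^sub>\<infinity>n. rights n x \<le> \<epsilon> * real n"
    using assms \<epsilon> split le(1) unfolding wandering_def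
    by (intro shift_frequent[of "\<lambda>n. rights n x" l "\<lambda>n. rights n ?y"]) auto
  show "\<exists>\<^sub>\<infinity>n. real n - rights n x \<le> \<epsilon> * real n"
    using assms \<epsilon> split le(2) unfolding wandering_def
    by (intro shift_frequent[of "\<lambda>n. real n - rights n x" l "\<lambda>n. real n - rights n ?y"]) auto
qed

subsection \<open>Averages\<close>

text \<open>
  An orbit ascends while it is on the left and descends while it is on the right; reflecting the right half turns
  both runs into an ascent.
\<close>

definition height :: "real \<Rightarrow> real" where
  "height y = (if y < c then y else 2 - y)"

text \<open>
  The potential increases by at least the displacement in every step, except that it may drop by at most \<open>2\<close>
  when the orbit passes from the right to the left, which happens precisely at the points of \<open>Z\<close>.
\<close>

lemma displacement_le:
  assumes "y \<in> G"
  shows "\<bar>f y - y\<bar> \<le> height (f y) - height y + 2 * indicator Z y"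
  using assms
proof (cases rule: G_cases)
  case left
  have "y < f y" using u_less[OF G_open[OF left(1)]] left(2) by simp
  then show ?thesis using left G_open[OF left(1)] by (auto simp: height_def indicator_def)
next
  case right
  have lt: "f y < y" using v_greater[OF G_open[OF right(1)]] right(2) by simp
  have "y \<in> Z" if "f y < c"
    using right.less_iff[of "f y" c] that right G_open[OF right(1)] c assms by (auto simp: Z_def)
  then show ?thesis using right lt G_open[OF right(1)] G_open[OF assms] by (auto simp: height_def indicator_def)
qed

lemma f_pow_G: "x \<in> G \<Longrightarrow> (f ^^ n) x \<in> G"
  by (induction n) (auto intro: f_G)

lemma total_displacement_le:
  assumes "x \<in> G"
  shows "bsum (\<lambda>y. \<bar>f y - y\<bar>) n x \<le> 2 + 2 * visits n x"
proof -
  have "bsum (\<lambda>y. \<bar>f y - y\<bar>) n x \<le> height ((f ^^ n) x) - height x + 2 * visits n x" for n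
  proof (induction n)
    case (Suc n)
    then show ?case using displacement_le[OF f_pow_G[OF assms], of n] by (simp add: bsum_def)
  qed (simp add: bsum_def)
  moreover have "height ((f ^^ n) x) \<le> 2" "height x \<ge> 0"
    using G_open[OF f_pow_G[OF assms], of n] G_open[OF assms] by (auto simp: height_def)
  ultimately show ?thesis by (smt (verit))
qed

text \<open>
  Away from the two fixed points the displacement is bounded from below, and near them \<open>\<phi>\<close> is close to its value there.
\<close>

lemma endpoint_approximation:
  fixes \<phi> :: "real \<Rightarrow> real"
  assumes \<phi>: "continuous_on {0..1} \<phi>" and \<epsilon>: "\<epsilon> > 0"
  obtains M where "M \<ge> 0" "\<And>y. y \<in> G \<Longrightarrow> \<bar>\<phi> y - (if c < y then \<phi> 1 else \<phi> 0)\<bar> \<le> \<epsilon> + M * \<bar>f y - y\<bar>"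
proof -
  have "compact (\<phi> ` {0..1})" using \<phi> by (intro compact_continuous_image) auto
  then obtain K where K: "\<And>y. y \<in> {0..1} \<Longrightarrow> \<bar>\<phi> y\<bar> \<le> K"
    by (meson compact_imp_bounded bounded_real imageI)
  have K0: "K \<ge> 0" using K[of 0] by force
  obtain d0 where d0: "d0 > 0" "\<And>y. y \<in> {0..1} \<Longrightarrow> dist y 0 < d0 \<Longrightarrow> dist (\<phi> y) (\<phi> 0) < \<epsilon>"
    using \<phi> \<epsilon> unfolding continuous_on_iff by (metis atLeastAtMost_iff order_refl zero_le_one)
  obtain d1 where d1: "d1 > 0" "\<And>y. y \<in> {0..1} \<Longrightarrow> dist y 1 < d1 \<Longrightarrow> dist (\<phi> y) (\<phi> 1) < \<epsilon>"
    using \<phi> \<epsilon> unfolding continuous_on_iff by (metis atLeastAtMost_iff order_refl zero_le_one)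
  define d where "d = min (min d0 d1) 1"
  have d: "0 < d" "d \<le> d0" "d \<le> d1" "d \<le> 1" using d0 d1 by (auto simp: d_def)
  have "continuous_on {d..1} (\<lambda>w. w - u w)"
    using d by (intro continuous_intros continuous_on_subset[OF left.continuous]) auto
  then obtain w0 where w0: "w0 \<in> {d..1}" "\<And>w. w \<in> {d..1} \<Longrightarrow> w0 - u w0 \<le> w - u w"
    using continuous_attains_inf[of "{d..1}" "\<lambda>w. w - u w"] d by auto
  have "continuous_on {0..1-d} (\<lambda>w. v w - w)"
    using d by (intro continuous_intros continuous_on_subset[OF right.continuous]) auto
  then obtain w1 where w1: "w1 \<in> {0..1-d}" "\<And>w. w \<in> {0..1-d} \<Longrightarrow> v w1 - w1 \<le> v w - w"
    using continuous_attains_inf[of "{0..1-d}" "\<lambda>w. v w - w"] d by auto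
  \<comment> \<open>A lower bound for the displacement of \<open>y = u w\<close> with \<open>w \<ge> d\<close>, and of \<open>y = v w\<close> with \<open>w \<le> 1 - d\<close>.\<close>
  define \<kappa> where "\<kappa> = min (w0 - u w0) (v w1 - w1)"
  have "u w0 < w0" using u_less[of w0] w0(1) d c by (cases "w0 = 1") (auto simp: u_1)
  moreover have "w1 < v w1" using v_greater[of w1] w1(1) d c by (cases "w1 = 0") (auto simp: v_0)
  ultimately have \<kappa>: "\<kappa> > 0" by (simp add: \<kappa>_def)
  show thesis
  proof (rule that[of "2 * K / \<kappa>"])
    show "2 * K / \<kappa> \<ge> 0" using K0 \<kappa> by simp
    fix y assume y: "y \<in> G"
    have y01: "y \<in> {0<..<1}" by (rule G_open[OF y])
    have crude: "\<bar>\<phi> y - (if c < y then \<phi> 1 else \<phi> 0)\<bar> \<le> 2 * K"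
      using K[of y] K[of 0] K[of 1] y01 by auto
    have far: "\<bar>\<phi> y - (if c < y then \<phi> 1 else \<phi> 0)\<bar> \<le> \<epsilon> + 2 * K / \<kappa> * \<bar>f y - y\<bar>" if "\<bar>f y - y\<bar> \<ge> \<kappa>"
    proof -
      have "2 * K = 2 * K / \<kappa> * \<kappa>" using \<kappa> by simp
      also have "\<dots> \<le> 2 * K / \<kappa> * \<bar>f y - y\<bar>" using that K0 \<kappa> by (intro mult_left_mono) auto
      finally show ?thesis using crude \<epsilon> by linarith
    qed
    have near: "\<bar>\<phi> y - (if c < y then \<phi> 1 else \<phi> 0)\<bar> \<le> \<epsilon> + 2 * K / \<kappa> * \<bar>f y - y\<bar>"
      if "\<bar>\<phi> y - (if c < y then \<phi> 1 else \<phi> 0)\<bar> < \<epsilon>"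
      using that K0 \<kappa> by (intro order_trans[OF less_imp_le[OF that]]) simp
    from y show "\<bar>\<phi> y - (if c < y then \<phi> 1 else \<phi> 0)\<bar> \<le> \<epsilon> + 2 * K / \<kappa> * \<bar>f y - y\<bar>"
    proof (cases rule: G_cases)
      case left
      show ?thesis
      proof (cases "y < d")
        case True
        then show ?thesis using d0(2)[of y] y01 d left(3) by (intro near) (auto simp: dist_real_def)
      next
        case False
        have "y < f y" using u_less[OF G_open[OF left(1)]] left(2) by simp
        then have "\<kappa> \<le> f y - y"
          using w0(2)[of "f y"] False G_open[OF left(1)] left(2) by (auto simp: \<kappa>_def)
        then show ?thesis by (intro far) auto
      qed
    next
      case right
      show ?thesis
      proof (cases "y > 1 - d")
        case True
        then show ?thesis using d1(2)[of y] y01 d right(3) by (intro near) (auto simp: dist_real_def)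
      next
        case False
        have "f y < y" using v_greater[OF G_open[OF right(1)]] right(2) by simp
        then have "\<kappa> \<le> y - f y"
          using w1(2)[of "f y"] False G_open[OF right(1)] right(2) by (auto simp: \<kappa>_def)
        then show ?thesis by (intro far) auto
      qed
    qed
  qed
qed

text \<open>
  By \<open>total_displacement_le\<close>, the error made in \<open>endpoint_approximation\<close> has a time average that is
  controlled by the frequency of the visits to \<open>Z\<close>.
\<close>

lemma averages_near_mixture:
  fixes \<phi> :: "real \<Rightarrow> real"
  assumes x: "x \<in> G" and vis: "(\<lambda>n. visits n x / real n) \<longlonglongrightarrow> 0" and \<phi>: "continuous_on {0..1} \<phi>"
  shows "(\<lambda>n. bsum \<phi> n x / real n - ((1 - rights n x / real n) * \<phi> 0 + rights n x / real n * \<phi> 1)) \<longlonglongrightarrow> 0"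
proof (rule LIMSEQ_I)
  fix \<epsilon> :: real assume \<epsilon>: "\<epsilon> > 0"
  obtain M where M: "M \<ge> 0" "\<And>y. y \<in> G \<Longrightarrow> \<bar>\<phi> y - (if c < y then \<phi> 1 else \<phi> 0)\<bar> \<le> \<epsilon> / 2 + M * \<bar>f y - y\<bar>"
    using endpoint_approximation[OF \<phi>, of "\<epsilon> / 2"] \<epsilon> by (metis half_gt_zero)
  have "(\<lambda>n. M * (2 * (1 / real n) + 2 * (visits n x / real n))) \<longlonglongrightarrow> M * (2 * 0 + 2 * 0)"
    by (intro tendsto_intros vis lim_1_over_n)
  then have "(\<lambda>n. M * (2 * (1 / real n) + 2 * (visits n x / real n))) \<longlonglongrightarrow> 0" by simp
  then have "\<forall>\<^sub>F n in sequentially. M * (2 * (1 / real n) + 2 * (visits n x / real n)) < \<epsilon> / 2"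
    by (rule order_tendstoD) (use \<epsilon> in simp)
  moreover have "\<forall>\<^sub>F n :: nat in sequentially. n > 0" by (rule eventually_gt_at_top)
  ultimately have "\<forall>\<^sub>F n in sequentially. norm (bsum \<phi> n x / real n -
      ((1 - rights n x / real n) * \<phi> 0 + rights n x / real n * \<phi> 1) - 0) < \<epsilon>"
  proof eventually_elim
    case (elim n)
    define e where "e y = (if c < y then \<phi> 1 else \<phi> 0)" for y
    have e: "bsum e n x = (real n - rights n x) * \<phi> 0 + rights n x * \<phi> 1"
      unfolding bsum_def e_def by (induction n) (auto simp: algebra_simps indicator_def)
    have "\<bar>bsum \<phi> n x - bsum e n x\<bar> \<le> (\<Sum>j<n. \<bar>\<phi> ((f ^^ j) x) - e ((f ^^ j) x)\<bar>)"
      unfolding bsum_def sum_subtractf[symmetric] by (rule sum_abs)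
    also have "\<dots> \<le> (\<Sum>j<n. \<epsilon> / 2 + M * \<bar>f ((f ^^ j) x) - (f ^^ j) x\<bar>)"
      unfolding e_def by (intro sum_mono M f_pow_G x)
    also have "\<dots> = \<epsilon> / 2 * real n + M * bsum (\<lambda>y. \<bar>f y - y\<bar>) n x"
      by (simp add: bsum_def sum.distrib sum_distrib_left)
    also have "\<dots> \<le> \<epsilon> / 2 * real n + M * (2 + 2 * visits n x)"
      using M by (intro add_left_mono mult_left_mono total_displacement_le x)
    finally have "\<bar>bsum \<phi> n x - bsum e n x\<bar> / real n \<le> (\<epsilon> / 2 * real n + M * (2 + 2 * visits n x)) / real n"
      by (intro divide_right_mono) auto
    also have "\<dots> = \<epsilon> / 2 + M * (2 * (1 / real n) + 2 * (visits n x / real n))"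
      using elim by (simp add: field_simps)
    also have "\<dots> < \<epsilon> / 2 + \<epsilon> / 2" by (intro add_strict_left_mono elim)
    also have "\<dots> = \<epsilon>" by simp
    finally have "\<bar>bsum \<phi> n x - bsum e n x\<bar> / real n < \<epsilon>" .
    moreover have "bsum \<phi> n x / real n - ((1 - rights n x / real n) * \<phi> 0 + rights n x / real n * \<phi> 1)
        = (bsum \<phi> n x - bsum e n x) / real n"
      unfolding e using elim by (simp add: field_simps)
    ultimately show ?case by simp
  qed
  then show "\<exists>N. \<forall>n\<ge>N. norm (bsum \<phi> n x / real n -
      ((1 - rights n x / real n) * \<phi> 0 + rights n x / real n * \<phi> 1) - 0) < \<epsilon>"
    by (simp add: eventually_sequentially)
qed

subsection \<open>Null sets\<close>

lemma negligible_wmap_image: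
  assumes "negligible N" "N \<subseteq> {0..1}"
  shows "negligible (wmap w ` N)"
proof (rule negligible_locally_Lipschitz_image[OF _ assms(1)])
  fix x assume x: "x \<in> N"
  have "norm (wmap w y - wmap w x) \<le> 1 * norm (y - x)" if "y \<in> N" for y
  proof -
    have "x \<in> {0..1}" "y \<in> {0..1}" using assms(2) x that by blast+
    then show ?thesis
      using wmap_contraction[of x y w] wmap_contraction[of y x w] wmap_le[of x y w] wmap_le[of y x w]
      by (cases "x \<le> y") auto
  qed
  then show "\<exists>T B. open T \<and> x \<in> T \<and> (\<forall>y\<in>N \<inter> T. norm (wmap w y - wmap w x) \<le> B * norm (y - x))"
    by (intro exI[of _ UNIV] exI[of _ 1]) auto
qed simp

lemma G_reaches_Z:
  assumes "x \<in> G"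
  obtains w z where "z \<in> Z" "x = wmap w z"
proof -
  have right: "\<exists>z\<in>Z. \<exists>w. x = wmap w z" if x: "x \<in> G" "c < x" for x
    using right_rung[OF x] by (metis wmap_replicate br.simps(2))
  have "x \<noteq> c" using G_not_wmap[OF assms, of "[]"] by simp
  then consider "c < x" | "x < c" by linarith
  then show thesis
  proof cases
    case 2
    then obtain i y where y: "y \<in> G" "c < y" "x = wmap (replicate (Suc i) False) y"
      using left_rung[OF assms 2] by (metis wmap_replicate br.simps(1))
    then show ?thesis using right[of y] that by (metis wmap_append)
  qed (use right[OF assms] that in blast)
qed

text \<open>
  Every point of \<open>G\<close> is mapped to \<open>Z\<close> by an iterate of \<open>f\<close>, so the exceptional set is covered by countably many Lipschitz
  images of a null subset of \<open>Z\<close>.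
\<close>

lemma negligible_non_wandering:
  assumes "AE x in MZ. wandering x"
  shows "negligible {x \<in> {0<..<1}. \<not> (x \<in> G \<and> wandering x)}"
proof -
  define N where "N = {z \<in> Z. \<not> wandering z}"
  have "AE x in lborel. x \<in> Z \<longrightarrow> wandering x"
    using assms unfolding MZ_def by (subst (asm) AE_restrict_space_iff) auto
  then obtain N' where N': "N' \<in> null_sets lborel" "{x. \<not> (x \<in> Z \<longrightarrow> wandering x)} \<subseteq> N'"
    by (auto elim!: AE_E simp: null_sets_def)
  have "N' \<in> null_sets lebesgue" using N'(1) by (rule null_sets_completionI)
  then have "negligible N" using N'(2) by (intro negligible_subset[of N' N]) (auto simp: negligible_iff_null_sets N_def)
  moreover have "N \<subseteq> {0..1}" using G_open[OF Z_G] by (force simp: N_def)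
  ultimately have "negligible (wmap w ` N)" for w by (rule negligible_wmap_image)
  then have "negligible (\<Union>w. wmap w ` N)"
    by (intro negligible_countable_Union) auto
  moreover have "negligible (range (\<lambda>w. wmap w c))"
    using null_sets_completionI[OF countable_imp_null_set_lborel[OF countable_exceptional]]
    by (simp add: negligible_iff_null_sets)
  ultimately have "negligible (range (\<lambda>w. wmap w c) \<union> (\<Union>w. wmap w ` N))"
    by (intro negligible_Un) auto
  moreover have "{x \<in> {0<..<1}. \<not> (x \<in> G \<and> wandering x)} \<subseteq> range (\<lambda>w. wmap w c) \<union> (\<Union>w. wmap w ` N)"
  proof
    fix x assume x: "x \<in> {x \<in> {0<..<1}. \<not> (x \<in> G \<and> wandering x)}"
    show "x \<in> range (\<lambda>w. wmap w c) \<union> (\<Union>w. wmap w ` N)"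
    proof (cases "x \<in> G")
      case True
      then obtain w z where z: "z \<in> Z" "x = wmap w z" by (rule G_reaches_Z)
      have "\<not> wandering z"
      proof
        assume "wandering z"
        then have "wandering ((f ^^ length w) x)" using funpow_wmap[OF G_open[OF Z_G[OF z(1)]], of w] z(2) by simp
        then show False using wandering_shift True x by blast
      qed
      then show ?thesis using z by (auto simp: N_def)
    qed (use x in \<open>auto simp: G_def\<close>)
  qed
  ultimately show ?thesis by (rule negligible_subset)
qed

end

section \<open>Rates of approach to an indifferent fixed point\<close>

text \<open>
  At time \<open>n\<close>, a solution of \<open>x' = - g x\<close>, where \<open>g\<close> varies regularly with exponent greater than one, is such
  that \<open>x / g x\<close> is comparable to \<open>n\<close>.
\<close>

definition comparable_rate :: "(real \<Rightarrow> real) \<Rightarrow> (nat \<Rightarrow> real) \<Rightarrow> real \<Rightarrow> nat \<Rightarrow> bool" where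
  "comparable_rate g x b n \<longleftrightarrow> real n * g (x n) \<le> b * x n \<and> x n \<le> b * (real n * g (x n))"

text \<open>
  The assumption \<open>g_quad\<close> says that \<open>g t / t\<^sup>2\<close> is increasing up to the factor \<open>C\<close>. Hence each increment of \<open>1 / x\<close> up
  to time \<open>n\<close> is at least of the order \<open>g (x n) / (x n)\<^sup>2\<close>, and summation gives the upper bound for \<open>n * g (x n)\<close>.
  For the lower bound, it suffices to consider the last time at which \<open>x\<close> was at least \<open>2 * x n\<close>: since then, the
  steps have been at most of the order \<open>g (x n)\<close>, and they sum up to at least \<open>x n\<close>.
\<close>

lemma approach_rate:
  fixes x :: "nat \<Rightarrow> real" and g :: "real \<Rightarrow> real"
  assumes x: "\<And>n. n \<ge> N \<Longrightarrow> 0 < x n \<and> x n < r" and lim: "x \<longlonglongrightarrow> 0"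
    and A: "A > 0" and B: "B > 0" and C: "C > 0" and D: "D > 0"
    and step: "\<And>n. n \<ge> N \<Longrightarrow> g (x (Suc n)) \<le> A * (x n - x (Suc n))"
      "\<And>n. n \<ge> N \<Longrightarrow> x n - x (Suc n) \<le> A * g (x (Suc n))"
    and ratio: "\<And>n. n \<ge> N \<Longrightarrow> x n \<le> B * x (Suc n)"
    and g_pos: "\<And>t. 0 < t \<Longrightarrow> t < r \<Longrightarrow> g t > 0"
    and g_mono: "\<And>s t. 0 < s \<Longrightarrow> s \<le> t \<Longrightarrow> t < r \<Longrightarrow> g s \<le> g t"
    and g_quad: "\<And>s t. 0 < s \<Longrightarrow> s \<le> t \<Longrightarrow> t < r \<Longrightarrow> g s * t\<^sup>2 \<le> C * (s\<^sup>2 * g t)"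
    and g_double: "\<And>t. 0 < t \<Longrightarrow> 2 * t < r \<Longrightarrow> g (2 * t) \<le> D * g t"
  shows "\<exists>b>0. \<forall>\<^sub>F n in sequentially. comparable_rate g x b n"
proof -
  have dec: "x (Suc n) < x n" if "n \<ge> N" for n
    using step(1)[OF that] g_pos[of "x (Suc n)"] x[of "Suc n"] that A
    by (smt (verit) le_Suc_eq mult_nonneg_nonpos)
  have anti: "x n \<le> x m" if "N \<le> m" "m \<le> n" for m n
    using that(2) by (induction rule: dec_induct) (use dec that(1) in \<open>auto intro: order_trans[OF less_imp_le[OF dec]]\<close>)
  have upper: "real n * g (x n) \<le> 2 * A * B * C * x n" if n: "n \<ge> 2 * N" "n \<ge> 1" for n
  proof -
    have xn: "0 < x n" "x n < r" "g (x n) > 0" using x[of n] g_pos[of "x n"] n by auto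
    let ?K = "A * B * C * (x n)\<^sup>2"
    have inc: "g (x n) \<le> ?K * (1 / x (Suc i) - 1 / x i)" if i: "i \<in> {N..<n}" for i
    proof -
      have xi: "0 < x (Suc i)" "0 < x i" "x (Suc i) < r" using x[of i] x[of "Suc i"] i by auto
      have "g (x n) * (x (Suc i))\<^sup>2 \<le> C * ((x n)\<^sup>2 * g (x (Suc i)))"
        using g_quad[of "x n" "x (Suc i)"] anti[of "Suc i" n] i xi xn by auto
      also have "\<dots> \<le> C * ((x n)\<^sup>2 * (A * (x i - x (Suc i))))"
        using C step(1)[of i] i by (intro mult_left_mono) auto
      finally have "g (x n) * (x (Suc i))\<^sup>2 * x i \<le> C * ((x n)\<^sup>2 * (A * (x i - x (Suc i)))) * x i"
        using xi by (intro mult_right_mono) auto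
      also have "\<dots> \<le> C * ((x n)\<^sup>2 * (A * (x i - x (Suc i)))) * (B * x (Suc i))"
        using ratio[of i] i C A dec[of i] by (intro mult_left_mono mult_nonneg_nonneg) auto
      finally have "(g (x n) * (x i * x (Suc i))) * x (Suc i) \<le> (?K * (x i - x (Suc i))) * x (Suc i)"
        by (simp add: power2_eq_square ac_simps)
      then have "g (x n) * (x i * x (Suc i)) \<le> ?K * (x i - x (Suc i))"
        using xi(1) by (simp only: mult_le_cancel_right_pos)
      then have "g (x n) \<le> ?K * (x i - x (Suc i)) / (x i * x (Suc i))"
        using xi by (simp only: pos_le_divide_eq mult_pos_pos)
      also have "\<dots> = ?K * (1 / x (Suc i) - 1 / x i)" using xi by (simp add: field_simps)
      finally show ?thesis .
    qed
    have "real (n - N) * g (x n) = (\<Sum>i = N..<n. g (x n))" by simp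
    also have "\<dots> \<le> (\<Sum>i = N..<n. ?K * (1 / x (Suc i) - 1 / x i))" by (intro sum_mono inc)
    also have "\<dots> = ?K * (1 / x n - 1 / x N)"
      using sum_Suc_diff'[of N n "\<lambda>i. 1 / x i"] n by (simp add: sum_distrib_left[symmetric])
    also have "\<dots> \<le> ?K * (1 / x n)" using A B C x[of N] by (intro mult_left_mono) auto
    also have "\<dots> = A * B * C * x n" using xn by (simp add: power2_eq_square)
    finally have "real (n - N) * g (x n) \<le> A * B * C * x n" .
    moreover have "real n * g (x n) \<le> (2 * real (n - N)) * g (x n)"
      using n xn by (intro mult_right_mono) auto
    ultimately show ?thesis by simp
  qed
  have lower: "\<forall>\<^sub>F n in sequentially. x n \<le> A * D * (real n * g (x n))"
  proof -
    have "\<forall>\<^sub>F n in sequentially. x n < x N / 2"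
      using x[of N] by (intro order_tendstoD[OF lim]) auto
    moreover have "\<forall>\<^sub>F n in sequentially. n \<ge> N" by (rule eventually_ge_at_top)
    ultimately show ?thesis
    proof eventually_elim
      case (elim n)
      have xn: "0 < x n" "x n < r" "g (x n) > 0" using x[of n] g_pos[of "x n"] elim by auto
      \<comment> \<open>\<open>m\<close> is the last time at which the sequence is at least twice its value at time \<open>n\<close>.\<close>
      define I where "I = {i \<in> {N..n}. 2 * x n \<le> x i}"
      have I: "finite I" "N \<in> I" using elim by (auto simp: I_def)
      define m where "m = Max I"
      have m: "m \<in> I" and m_max: "\<And>i. i \<in> I \<Longrightarrow> i \<le> m"
        unfolding m_def using I by (auto intro: Max_in)
      then have mn: "N \<le> m" "m \<le> n" "2 * x n \<le> x m" by (auto simp: I_def)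
      have r2: "2 * x n < r" using mn x[of m] by auto
      have diff: "x i - x (Suc i) \<le> A * (D * g (x n))" if i: "i \<in> {m..<n}" for i
      proof -
        have "Suc i \<notin> I" using m_max[of "Suc i"] i by auto
        then have "x (Suc i) < 2 * x n" using i mn by (auto simp: I_def)
        then have "g (x (Suc i)) \<le> g (2 * x n)"
          using x[of "Suc i"] i mn r2 by (intro g_mono) auto
        also have "\<dots> \<le> D * g (x n)" using xn r2 by (intro g_double)
        finally have "A * g (x (Suc i)) \<le> A * (D * g (x n))" using A by simp
        then show ?thesis using step(2)[of i] i mn by auto
      qed
      have "x n \<le> x m - x n" using mn by simp
      also have "\<dots> = (\<Sum>i = m..<n. x i - x (Suc i))"
        using sum_Suc_diff'[of m n "\<lambda>i. - x i"] mn by simp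
      also have "\<dots> \<le> (\<Sum>i = m..<n. A * (D * g (x n)))" by (intro sum_mono diff)
      also have "\<dots> = real (n - m) * (A * (D * g (x n)))" by simp
      also have "\<dots> \<le> real n * (A * (D * g (x n)))" using A D xn by (intro mult_right_mono) auto
      finally show ?case by (simp add: ac_simps)
    qed
  qed
  define b where "b = max (2 * A * B * C) (A * D)"
  have "\<forall>\<^sub>F n in sequentially. n \<ge> max (2 * N) 1" by (rule eventually_ge_at_top)
  with lower have "\<forall>\<^sub>F n in sequentially. comparable_rate g x b n"
  proof eventually_elim
    case (elim n)
    have xn: "0 < x n" "g (x n) > 0" using x[of n] g_pos[of "x n"] elim by auto
    have "real n * g (x n) \<le> b * x n"
      using xn elim by (intro order_trans[OF upper]) (auto intro!: mult_right_mono simp: b_def)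
    moreover have "x n \<le> b * (real n * g (x n))"
      using xn by (intro order_trans[OF elim(1)] mult_right_mono) (auto simp: b_def)
    ultimately show ?case by (simp add: comparable_rate_def)
  qed
  moreover have "b > 0" using A D by (simp add: b_def less_max_iff_disj)
  ultimately show ?thesis by blast
qed

text \<open>
  The function \<open>x / g x\<close> decreases at least like \<open>1 / x\<close> up to constants, so the comparability of \<open>x n / g (x n)\<close>
  and \<open>y n / g (y n)\<close>, which are both of the order \<open>n\<close>, implies that of \<open>x n\<close> and \<open>y n\<close>.
\<close>

lemma comparable_rate_compare:
  assumes x: "comparable_rate g x b n" "0 < x n" "x n < r" and y: "comparable_rate g y b' n" "0 < y n"
    and b: "b > 0" "b' > 0" "C > 0"
    and g_quad: "\<And>s t. 0 < s \<Longrightarrow> s \<le> t \<Longrightarrow> t < r \<Longrightarrow> g s * t\<^sup>2 \<le> C * (s\<^sup>2 * g t)"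
  shows "x n \<le> max 1 (b * b' * C) * y n"
proof (cases "y n \<le> x n")
  case True
  have "y n * (x n)\<^sup>2 \<le> b' * (real n * g (y n)) * (x n)\<^sup>2"
    using y by (intro mult_right_mono) (auto simp: comparable_rate_def)
  also have "\<dots> = b' * real n * (g (y n) * (x n)\<^sup>2)" by simp
  also have "\<dots> \<le> b' * real n * (C * ((y n)\<^sup>2 * g (x n)))"
    using b True x y by (intro mult_left_mono g_quad) auto
  also have "\<dots> = b' * C * (y n)\<^sup>2 * (real n * g (x n))" by simp
  also have "\<dots> \<le> b' * C * (y n)\<^sup>2 * (b * x n)"
    using x b by (intro mult_left_mono) (auto simp: comparable_rate_def)
  finally have "x n * (x n * y n) \<le> (b * b' * C * y n) * (x n * y n)"
    by (simp add: power2_eq_square ac_simps)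
  then have "x n \<le> b * b' * C * y n"
    using x(2) y(2) by (simp only: mult_le_cancel_right_pos mult_pos_pos)
  also have "\<dots> \<le> max 1 (b * b' * C) * y n" using y(2) by (intro mult_right_mono) auto
  finally show ?thesis .
next
  case False
  then have "x n \<le> 1 * y n" by simp
  also have "\<dots> \<le> max 1 (b * b' * C) * y n" using y(2) by (intro mult_right_mono) auto
  finally show ?thesis .
qed

text \<open>
  Since \<open>x / g x\<close> grows at least like \<open>x powr (- q)\<close> when \<open>x\<close> decreases to \<open>0\<close>, the ratio of the times \<open>s\<close> and \<open>j\<close> is at least of the
  order \<open>(x j / x s) powr q\<close>.
\<close>

lemma comparable_rate_regular:
  assumes j: "comparable_rate g x b j" "0 < x j" "x j < r" and s: "comparable_rate g x b s" "0 < x s" "x s \<le> x j"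
    and js: "1 \<le> j" and b: "b > 0" "C > 0" and q: "q > 0"
    and g_potter: "\<And>s t. 0 < s \<Longrightarrow> s \<le> t \<Longrightarrow> t < r \<Longrightarrow> g s * t powr (q + 1) \<le> C * (s powr (q + 1) * g t)"
  shows "x j \<le> (b\<^sup>2 * C) powr (1 / q) * (real s / real j) powr (1 / q) * x s"
proof -
  let ?X = "x j" and ?Y = "x s"
  have "(real j * ?X powr (q+1)) * ?Y \<le> (real j * ?X powr (q+1)) * (b * (real s * g ?Y))"
    using s by (intro mult_left_mono) (auto simp: comparable_rate_def)
  also have "\<dots> = b * real s * real j * (g ?Y * ?X powr (q+1))" by simp
  also have "\<dots> \<le> b * real s * real j * (C * (?Y powr (q+1) * g ?X))"
    using b j s by (intro mult_left_mono g_potter) auto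
  also have "\<dots> = b * C * real s * ?Y powr (q+1) * (real j * g ?X)" by simp
  also have "\<dots> \<le> b * C * real s * ?Y powr (q+1) * (b * ?X)"
    using b j by (intro mult_left_mono) (auto simp: comparable_rate_def)
  finally have "(real j * ?X powr q) * (?X * ?Y) \<le> (b\<^sup>2 * C * real s * ?Y powr q) * (?X * ?Y)"
    using j(2) s(2) by (simp add: powr_add power2_eq_square ac_simps)
  then have "real j * ?X powr q \<le> b\<^sup>2 * C * real s * ?Y powr q"
    using j(2) s(2) by (simp only: mult_le_cancel_right_pos mult_pos_pos)
  then have "?X powr q \<le> (b\<^sup>2 * C * (real s / real j)) * ?Y powr q"
    using js by (simp add: field_simps)
  then have "(?X powr q) powr (1 / q) \<le> ((b\<^sup>2 * C * (real s / real j)) * ?Y powr q) powr (1 / q)"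
    using q by (intro powr_mono2) auto
  moreover have "((b\<^sup>2 * C * (real s / real j)) * ?Y powr q) powr (1 / q)
      = (b\<^sup>2 * C) powr (1 / q) * (real s / real j) powr (1 / q) * ?Y"
  proof -
    have "(?Y powr q) powr (1 / q) = ?Y" using q s(2) by (simp add: powr_powr)
    moreover have "((b\<^sup>2 * C * (real s / real j)) * ?Y powr q) powr (1 / q)
        = (b\<^sup>2 * C * (real s / real j)) powr (1 / q) * (?Y powr q) powr (1 / q)"
      using b by (simp only: powr_mult)
    moreover have "(b\<^sup>2 * C * (real s / real j)) powr (1 / q) = (b\<^sup>2 * C) powr (1 / q) * (real s / real j) powr (1 / q)"
      by (simp only: powr_mult)
    ultimately show ?thesis by simp
  qed
  ultimately show ?thesis using q j(2) by (simp add: powr_powr)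
qed

lemma regular_from_start:
  fixes x :: "nat \<Rightarrow> real"
  assumes pos: "\<And>n. x n > 0" and dec: "\<And>m n. m \<le> n \<Longrightarrow> x n \<le> x m" and \<gamma>: "\<gamma> > 0" and R: "R > 0"
    and ev: "\<And>j s. N \<le> j \<Longrightarrow> 1 \<le> j \<Longrightarrow> j \<le> s \<Longrightarrow> x j \<le> R * (real s / real j) powr \<gamma> * x s"
  shows "\<exists>R'>0. \<forall>j s. 1 \<le> j \<longrightarrow> j \<le> s \<longrightarrow> x j \<le> R' * (real s / real j) powr \<gamma> * x s"
proof -
  define M where "M = max N 1"
  define R' where "R' = max 1 R * (x 0 / x M)"
  have ratio: "x 0 / x M \<ge> 1" using pos[of M] dec[of 0 M] by simp
  have R'_ge: "R' \<ge> R" "R' \<ge> x 0 / x M" "R' \<ge> 1"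
  proof -
    have "max 1 R * 1 \<le> R'" unfolding R'_def using ratio by (intro mult_left_mono) auto
    then show "R' \<ge> R" "R' \<ge> 1" by auto
    have "1 * (x 0 / x M) \<le> R'" unfolding R'_def using ratio by (intro mult_right_mono) auto
    then show "R' \<ge> x 0 / x M" by simp
  qed
  have "x j \<le> R' * (real s / real j) powr \<gamma> * x s" if j: "1 \<le> j" "j \<le> s" for j s
  proof -
    consider "j \<ge> N" | "j < N" "s \<ge> N" | "s < N" by linarith
    then show ?thesis
    proof cases
      case 1
      have "x j \<le> R * (real s / real j) powr \<gamma> * x s" using 1 j by (intro ev)
      also have "\<dots> \<le> R' * (real s / real j) powr \<gamma> * x s"
        using R'_ge pos[of s] by (intro mult_right_mono) (auto intro: less_imp_le)
      finally show ?thesis .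
    next
      case 2
      then have M: "M = N" "N \<ge> 1" by (auto simp: M_def)
      have "x j \<le> x 0" by (rule dec) simp
      also have "x 0 = x 0 / x M * x M" using pos[of M] by simp
      also have "\<dots> \<le> x 0 / x M * (R * (real s / real M) powr \<gamma> * x s)"
        using 2 M pos[of 0] pos[of M] by (intro mult_left_mono ev) (auto intro: less_imp_le)
      also have "\<dots> \<le> x 0 / x M * (max 1 R * (real s / real j) powr \<gamma> * x s)"
      proof -
        have "real s / real M \<le> real s / real j" using 2 j M by (intro divide_left_mono) auto
        then have "(real s / real M) powr \<gamma> \<le> (real s / real j) powr \<gamma>" using \<gamma> by (intro powr_mono2) auto
        then show ?thesis
          using pos[of 0] pos[of M] pos[of s] R
          by (intro mult_left_mono mult_right_mono mult_mono) (auto intro: less_imp_le)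
      qed
      also have "\<dots> = R' * (real s / real j) powr \<gamma> * x s" by (simp add: R'_def)
      finally show ?thesis .
    next
      case 3
      then have sM: "s \<le> M" by (simp add: M_def)
      have "x j \<le> x 0" by (rule dec) simp
      also have "x 0 = x 0 / x M * x M" using pos[of M] by simp
      also have "\<dots> \<le> R' * x s"
        using R'_ge dec[OF sM] pos[of 0] pos[of M] by (intro mult_mono) (auto intro: less_imp_le)
      also have "\<dots> \<le> R' * (real s / real j) powr \<gamma> * x s"
      proof -
        have "(real s / real j) powr \<gamma> \<ge> 1" using j \<gamma> by (intro ge_one_powr_ge_zero) auto
        then have "R' * 1 \<le> R' * (real s / real j) powr \<gamma>" using R'_ge by (intro mult_left_mono) auto
        then show ?thesis using pos[of s] by (intro mult_right_mono) auto
      qed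
      finally show ?thesis .
    qed
  qed
  then show ?thesis using R'_ge by (intro exI[of _ R']) auto
qed

lemma eventually_comparable_all:
  fixes x y :: "nat \<Rightarrow> real"
  assumes pos: "\<And>n. x n > 0" "\<And>n. y n > 0" and K: "K > 0" and ev: "\<forall>\<^sub>F n in sequentially. x n \<le> K * y n"
  shows "\<exists>K'>0. \<forall>n. x n \<le> K' * y n"
proof -
  obtain N where N: "\<And>n. n \<ge> N \<Longrightarrow> x n \<le> K * y n" using ev by (auto simp: eventually_sequentially)
  define K' where "K' = K + (\<Sum>i<N. x i / y i)"
  have sum_pos: "(\<Sum>i<N. x i / y i) \<ge> 0" using pos by (intro sum_nonneg) (auto intro: less_imp_le)
  have "x n \<le> K' * y n" for n
  proof (cases "n \<ge> N")
    case True
    have "K * y n \<le> K' * y n" using sum_pos pos(2)[of n] by (intro mult_right_mono) (auto simp: K'_def)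
    then show ?thesis using N[OF True] by linarith
  next
    case False
    have "x n / y n \<le> (\<Sum>i<N. x i / y i)"
      using False pos by (intro member_le_sum) (auto intro: less_imp_le)
    then have "x n / y n \<le> K'" using K by (simp add: K'_def)
    then show ?thesis using pos(2)[of n] by (simp add: field_simps)
  qed
  moreover have "K' > 0" using sum_pos K by (simp add: K'_def)
  ultimately show ?thesis by blast
qed

subsection \<open>Regular variation\<close>

lemma asymp_equiv_eventually_le:
  fixes f g :: "real \<Rightarrow> real"
  assumes "f \<sim>[F] g" "\<forall>\<^sub>F x in F. g x > 0" "K > 1"
  shows "\<forall>\<^sub>F x in F. f x \<le> K * g x" "\<forall>\<^sub>F x in F. g x \<le> K * f x"
proof -
  have lim: "((\<lambda>x. if f x = 0 \<and> g x = 0 then 1 else f x / g x) \<longlongrightarrow> 1) F"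
    using assms(1) by (simp add: asymp_equiv_def)
  show "\<forall>\<^sub>F x in F. f x \<le> K * g x"
    using order_tendstoD(2)[OF lim assms(3)] assms(2)
    by eventually_elim (auto simp: field_simps)
  have "1 / K < 1" using assms(3) by simp
  from order_tendstoD(1)[OF lim this] assms(2) show "\<forall>\<^sub>F x in F. g x \<le> K * f x"
    by eventually_elim (use assms(3) in \<open>auto simp: field_simps\<close>)
qed

text \<open>
  The function \<open>h\<close> varies slowly, so \<open>g\<close> varies regularly with exponent \<open>p + 1\<close>.
\<close>

lemma regular_variation:
  fixes g h :: "real \<Rightarrow> real"
  assumes g: "\<And>x. x \<in> {0<..<c} \<Longrightarrow> g x = h x * x powr (p + 1)" and c: "c > 0"
    and h: "(\<lambda>x. h (k * x)) \<sim>[at_right 0] h" and k: "k > 0"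
  shows "(\<lambda>x. g (k * x)) \<sim>[at_right 0] (\<lambda>x. k powr (p + 1) * g x)"
proof -
  have small: "\<forall>\<^sub>F x in at_right 0. x \<in> {0<..<c} \<and> k * x \<in> {0<..<c}"
    unfolding eventually_at_right_field using c k
    by (intro exI[of _ "min c (c / k)"]) (auto simp: field_simps)
  have "(\<lambda>x. h (k * x) * (k powr (p + 1) * x powr (p + 1))) \<sim>[at_right 0] (\<lambda>x. h x * (k powr (p + 1) * x powr (p + 1)))"
    by (intro asymp_equiv_intros h)
  moreover have "\<forall>\<^sub>F x in at_right 0. h (k * x) * (k powr (p + 1) * x powr (p + 1)) = g (k * x)"
    using small by eventually_elim (use k in \<open>simp add: g powr_mult\<close>)
  moreover have "\<forall>\<^sub>F x in at_right 0. h x * (k powr (p + 1) * x powr (p + 1)) = k powr (p + 1) * g x"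
    using small by eventually_elim (simp add: g)
  ultimately show ?thesis by (subst (asm) asymp_equiv_cong)
qed

text \<open>
  A one-sided Potter bound. Halving the argument reduces \<open>g\<close> at least by the factor \<open>(1/2) powr q\<close>; this is iterated, and
  the monotonicity of \<open>g\<close> bridges the gaps between the dyadic multiples of \<open>s\<close>.
\<close>

lemma potter_bound:
  fixes g :: "real \<Rightarrow> real"
  assumes q: "q > 0" and halve: "\<And>x. 0 < x \<Longrightarrow> x < r \<Longrightarrow> g (x / 2) \<le> (1/2) powr q * g x"
    and g_pos: "\<And>t. 0 < t \<Longrightarrow> t < r \<Longrightarrow> g t > 0"
    and g_mono: "\<And>s t. 0 < s \<Longrightarrow> s \<le> t \<Longrightarrow> t < r \<Longrightarrow> g s \<le> g t"
    and s: "0 < s" "s \<le> t" "t < r"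
  shows "g s * t powr q \<le> 2 powr q * (s powr q * g t)"
proof -
  have base: "g s * t powr q \<le> 2 powr q * (s powr q * g t)" if "0 < s" "s \<le> t" "t \<le> 2 * s" for s
  proof -
    have "t powr q \<le> (2 * s) powr q" using that s q by (intro powr_mono2) auto
    then have "g s * t powr q \<le> g t * (2 * s) powr q"
      using that s g_mono[of s t] g_pos[of t] by (intro mult_mono) auto
    then show ?thesis using that by (simp add: powr_mult ac_simps)
  qed
  have "g s * t powr q \<le> 2 powr q * (s powr q * g t)" if "0 < s" "s \<le> t" "t \<le> 2 ^ Suc k * s" for s k
    using that
  proof (induction k arbitrary: s)
    case 0
    then show ?case by (intro base) auto
  next
    case (Suc k)
    show ?case
    proof (cases "t \<le> 2 * s")
      case True
      then show ?thesis using Suc by (intro base) auto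
    next
      case False
      then have IH: "g (2 * s) * t powr q \<le> 2 powr q * ((2 * s) powr q * g t)"
        using Suc.prems by (intro Suc.IH) auto
      have "g s \<le> (1/2) powr q * g (2 * s)" using halve[of "2 * s"] False Suc.prems s by auto
      then have "g s * t powr q \<le> (1/2) powr q * g (2 * s) * t powr q" by (intro mult_right_mono) auto
      also have "\<dots> = (1/2) powr q * (g (2 * s) * t powr q)" by simp
      also have "\<dots> \<le> (1/2) powr q * (2 powr q * ((2 * s) powr q * g t))" by (intro mult_left_mono IH) auto
      also have "\<dots> = (1/2 * 2 * (2 * s)) powr q * g t"
        using Suc.prems by (simp add: powr_mult powr_divide)
      also have "\<dots> = 2 powr q * (s powr q * g t)" using Suc.prems by (simp add: powr_mult)
      finally show ?thesis .
    qed
  qed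
  moreover obtain k where "t / s < 2 ^ k" using real_arch_pow[of 2 "t / s"] by auto
  then have "t \<le> 2 ^ Suc k * s" using s by (simp add: field_simps)
  ultimately show ?thesis using s by blast
qed

section \<open>Empirical measures and the weak* topology\<close>

lemma continuous_measurable_borel_I:
  "continuous_on {0..1} \<phi> \<Longrightarrow> (\<phi> :: real \<Rightarrow> real) \<in> borel_measurable borel_I"
  by (rule borel_measurable_continuous_on_restrict)

lemma empirical_measure_eq_distr:
  assumes orbit: "\<And>j. (f ^^ j) x \<in> {0..1}" and n: "n \<ge> 1"
  shows "empirical_measure f x n = distr (uniform_count_measure {..<n}) borel_I (\<lambda>j. (f ^^ j) x)"
proof (rule measure_eqI)
  have meas: "(\<lambda>j. (f ^^ j) x) \<in> uniform_count_measure {..<n} \<rightarrow>\<^sub>M borel_I"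
    using orbit by (simp add: measurable_def uniform_count_measure_def sets_point_measure space_point_measure space_borel_I)
  show "sets (empirical_measure f x n) = sets (distr (uniform_count_measure {..<n}) borel_I (\<lambda>j. (f ^^ j) x))"
    by simp
  fix A assume "A \<in> sets (empirical_measure f x n)"
  then have A: "A \<in> sets borel_I" by simp
  let ?J = "{j. j < n \<and> (f ^^ j) x \<in> A}"
  have "emeasure (distr (uniform_count_measure {..<n}) borel_I (\<lambda>j. (f ^^ j) x)) A
      = emeasure (uniform_count_measure {..<n}) ?J"
    using meas A by (subst emeasure_distr) (auto simp: uniform_count_measure_def space_point_measure intro!: arg_cong[where f = "emeasure _"])
  also have "\<dots> = ennreal (card ?J / n)"
    by (subst emeasure_uniform_count_measure) auto
  finally have 1: "emeasure (distr (uniform_count_measure {..<n}) borel_I (\<lambda>j. (f ^^ j) x)) A = ennreal (card ?J / n)" .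
  have "(\<Sum>j<n. indicator A ((f ^^ j) x) :: ennreal) = (\<Sum>j\<in>{..<n}. if (f ^^ j) x \<in> A then 1 else 0)"
    by (intro sum.cong) (auto simp: indicator_def)
  also have "\<dots> = of_nat (card ({..<n} \<inter> {j. (f ^^ j) x \<in> A}))" by (simp add: sum.If_cases)
  also have "{..<n} \<inter> {j. (f ^^ j) x \<in> A} = ?J" by auto
  finally have "emeasure (empirical_measure f x n) A = ennreal (1 / real n) * of_nat (card ?J)"
    by (simp add: emeasure_empirical_measure[OF A])
  also have "\<dots> = ennreal (card ?J / n)"
    by (simp add: ennreal_of_nat_eq_real_of_nat ennreal_mult'[symmetric])
  finally show "emeasure (empirical_measure f x n) A
      = emeasure (distr (uniform_count_measure {..<n}) borel_I (\<lambda>j. (f ^^ j) x)) A"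
    using 1 by simp
qed

lemma integral_empirical_measure:
  fixes \<phi> :: "real \<Rightarrow> real"
  assumes orbit: "\<And>j. (f ^^ j) x \<in> {0..1}" and n: "n \<ge> 1" and \<phi>: "continuous_on {0..1} \<phi>"
  shows "integral\<^sup>L (empirical_measure f x n) \<phi> = (\<Sum>j<n. \<phi> ((f ^^ j) x)) / real n"
proof -
  have meas: "(\<lambda>j. (f ^^ j) x) \<in> uniform_count_measure {..<n} \<rightarrow>\<^sub>M borel_I"
    using orbit by (simp add: measurable_def uniform_count_measure_def sets_point_measure space_point_measure space_borel_I)
  show ?thesis
    unfolding empirical_measure_eq_distr[OF orbit n]
    by (subst integral_distr[OF meas continuous_measurable_borel_I[OF \<phi>]])
       (simp add: uniform_count_measure_def lebesgue_integral_point_measure_finite sum_divide_distrib)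
qed

lemma prob_empirical_measure:
  assumes orbit: "\<And>j. (f ^^ j) x \<in> {0..1}" and n: "n \<ge> 1"
  shows "empirical_measure f x n \<in> prob_measures_I"
proof -
  have "prob_space (uniform_count_measure {..<n})"
  proof (rule prob_space_uniform_count_measure)
    show "{..<n} \<noteq> {}" using n by (simp add: lessThan_eq_iff flip: lessThan_0)
  qed simp
  moreover have "(\<lambda>j. (f ^^ j) x) \<in> uniform_count_measure {..<n} \<rightarrow>\<^sub>M borel_I"
    using orbit by (simp add: measurable_def uniform_count_measure_def sets_point_measure space_point_measure space_borel_I)
  ultimately have "prob_space (empirical_measure f x n)"
    unfolding empirical_measure_eq_distr[OF orbit n] by (rule prob_space.prob_space_distr)
  then show ?thesis by (simp add: prob_measures_I_def)
qed

lemma endpoint_mixture_eq_distr: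
  assumes l: "l \<in> {0..1}"
  shows "endpoint_mixture l = distr (measure_pmf (bernoulli_pmf l)) borel_I (\<lambda>b. if b then 0 else 1)"
proof (rule measure_eqI)
  fix A assume "A \<in> sets (endpoint_mixture l)"
  then have A: "A \<in> sets borel_I" by simp
  let ?g = "\<lambda>b. if b then 0 else 1 :: real"
  have "emeasure (distr (measure_pmf (bernoulli_pmf l)) borel_I ?g) A = (\<integral>\<^sup>+y. indicator A y \<partial>distr (measure_pmf (bernoulli_pmf l)) borel_I ?g)"
    using A by simp
  also have "\<dots> = (\<integral>\<^sup>+b. indicator A (?g b) \<partial>bernoulli_pmf l)"
    using A by (intro nn_integral_distr) (auto simp: space_borel_I)
  also have "\<dots> = ennreal l * indicator A 0 + ennreal (1 - l) * indicator A 1"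
    using l by (subst nn_integral_bernoulli_pmf) (auto simp: mult.commute)
  finally show "emeasure (endpoint_mixture l) A = emeasure (distr (measure_pmf (bernoulli_pmf l)) borel_I ?g) A"
    by (simp add: emeasure_endpoint_mixture[OF A])
qed simp

lemma integral_endpoint_mixture:
  fixes \<phi> :: "real \<Rightarrow> real"
  assumes l: "l \<in> {0..1}" and \<phi>: "continuous_on {0..1} \<phi>"
  shows "integral\<^sup>L (endpoint_mixture l) \<phi> = l * \<phi> 0 + (1 - l) * \<phi> 1"
  unfolding endpoint_mixture_eq_distr[OF l]
  using l by (subst integral_distr[OF _ continuous_measurable_borel_I[OF \<phi>]])
    (auto simp: space_borel_I mult.commute)

lemma prob_endpoint_mixture:
  assumes l: "l \<in> {0..1}"
  shows "endpoint_mixture l \<in> prob_measures_I"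
proof -
  have "prob_space (endpoint_mixture l)"
    unfolding endpoint_mixture_eq_distr[OF l]
    by (rule prob_space.prob_space_distr[OF prob_space_measure_pmf]) (simp add: space_borel_I)
  then show ?thesis by (simp add: prob_measures_I_def)
qed

abbreviation weak_star_eval :: "real measure \<Rightarrow> (real \<Rightarrow> real) \<Rightarrow> real" where
  "weak_star_eval M \<equiv> (\<lambda>\<phi>\<in>continuous_I. integral\<^sup>L M \<phi>)"

lemma openin_weak_star_integral:
  fixes \<phi> :: "real \<Rightarrow> real"
  assumes \<phi>: "continuous_on {0..1} \<phi>" and V: "open V"
  shows "openin weak_star_topology {M \<in> prob_measures_I. integral\<^sup>L M \<phi> \<in> V}"
proof -
  let ?T = "product_topology (\<lambda>_. euclideanreal) continuous_I"
  have \<phi>I: "\<phi> \<in> continuous_I" using \<phi> by (simp add: continuous_I_def)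
  have "openin ?T {w \<in> topspace ?T. w \<phi> \<in> V}"
    using openin_continuous_map_preimage[OF continuous_map_product_projection[OF \<phi>I, of "\<lambda>_. euclideanreal"], of V] V
    by simp
  moreover have "{M \<in> prob_measures_I. integral\<^sup>L M \<phi> \<in> V}
      = weak_star_eval -` {w \<in> topspace ?T. w \<phi> \<in> V} \<inter> prob_measures_I"
    using \<phi>I by auto
  ultimately show ?thesis unfolding weak_star_topology_def openin_pullback_topology by blast
qed

text \<open>
  Convergence along the indices \<open>s k\<close>, which need not be increasing, suffices for accumulation.
\<close>

lemma frequently_in_weak_star_open:
  assumes U: "openin weak_star_topology U" "M \<in> U"
    and \<mu>: "\<And>n::nat. n \<ge> 1 \<Longrightarrow> \<mu> n \<in> prob_measures_I" and s: "filterlim s at_top sequentially"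
    and conv: "\<And>\<phi> :: real \<Rightarrow> real. continuous_on {0..1} \<phi> \<Longrightarrow> (\<lambda>k. integral\<^sup>L (\<mu> (s k)) \<phi>) \<longlonglongrightarrow> integral\<^sup>L M \<phi>"
  shows "\<exists>\<^sub>\<infinity>n. n \<ge> 1 \<and> \<mu> n \<in> U"
proof -
  let ?T = "product_topology (\<lambda>_. euclideanreal) continuous_I"
  obtain V where V: "openin ?T V" "U = weak_star_eval -` V \<inter> prob_measures_I"
    using U(1) unfolding weak_star_topology_def openin_pullback_topology by blast
  have "limitin ?T (\<lambda>k. weak_star_eval (\<mu> (s k))) (weak_star_eval M) sequentially"
    unfolding limitin_componentwise using conv by (auto simp: continuous_I_def)
  then have "\<forall>\<^sub>F k in sequentially. weak_star_eval (\<mu> (s k)) \<in> V"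
    using V U(2) unfolding limitin_def by auto
  moreover have "\<forall>\<^sub>F k in sequentially. s k \<ge> 1"
    using s by (simp add: filterlim_at_top)
  ultimately have ev: "\<forall>\<^sub>F k in sequentially. s k \<ge> 1 \<and> \<mu> (s k) \<in> U"
    by eventually_elim (use V \<mu> in auto)
  show ?thesis
    unfolding INFM_nat_le
  proof
    fix N
    have "\<forall>\<^sub>F k in sequentially. s k \<ge> N" using s by (simp add: filterlim_at_top)
    with ev have "\<forall>\<^sub>F k in sequentially. s k \<ge> N \<and> s k \<ge> 1 \<and> \<mu> (s k) \<in> U"
      by eventually_elim auto
    then obtain k where "s k \<ge> N \<and> s k \<ge> 1 \<and> \<mu> (s k) \<in> U"
      using eventually_happens by force
    then show "\<exists>n\<ge>N. n \<ge> 1 \<and> \<mu> n \<in> U" by blast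
  qed
qed

text \<open>
  The integrand is nonnegative on \<open>{0..1}\<close> and vanishes only at the end points, so the measure is carried by them.
\<close>

lemma measure_on_endpoints:
  assumes M: "M \<in> prob_measures_I" and zero: "integral\<^sup>L M (\<lambda>x. x * (1 - x)) = 0"
  shows "\<exists>l\<in>{0..1}. M = endpoint_mixture l"
proof -
  interpret prob_space M using M by (simp add: prob_measures_I_def)
  have sets_M: "sets M = sets borel_I" using M by (simp add: prob_measures_I_def)
  then have space_M: "space M = {0..1}" using sets_eq_imp_space_eq[OF sets_M] space_borel_I by simp
  have meas: "(\<lambda>x::real. x * (1 - x)) \<in> borel_measurable M"
  proof -
    have "continuous_on {0..1} (\<lambda>x::real. x * (1 - x))" by (intro continuous_intros)
    then show ?thesis
      using continuous_measurable_borel_I measurable_cong_sets[OF sets_M refl, of "borel :: real measure"] by simp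
  qed
  have bound: "norm (x * (1 - x)) \<le> 1" if "x \<in> space M" for x :: real
    using that mult_mono[of x 1 "1 - x" 1] by (auto simp: space_M abs_mult)
  have int: "integrable M (\<lambda>x. x * (1 - x))"
    using meas bound by (intro integrable_const_bound[where B = 1]) auto
  have "AE x in M. x * (1 - x) = 0"
  proof -
    have "AE x in M. 0 \<le> x * (1 - x)" by (intro AE_I2) (simp add: space_M)
    then show ?thesis using integral_nonneg_eq_0_iff_AE[OF int] zero by simp
  qed
  then have AE: "AE x in M. x \<in> {0, 1}" by eventually_elim auto
  have singl: "{0} \<in> sets M" "{1} \<in> sets M"
    unfolding sets_M by (auto simp: sets_restrict_space_iff)
  define l where "l = prob {0}"
  have one: "prob {0} + prob {1} = 1"
  proof -
    have "prob {0} + prob {1} = prob ({0} \<union> {1})"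
      using singl by (intro finite_measure_Union[symmetric]) auto
    also have "{0} \<union> {1} = {0, 1::real}" by auto
    also have "prob {0, 1} = 1"
      using AE sets.Un[OF singl] by (subst prob_eq_1) (auto simp: insert_commute)
    finally show ?thesis .
  qed
  have "M = endpoint_mixture l"
  proof (rule measure_eqI)
    show "sets M = sets (endpoint_mixture l)" by (simp add: sets_M)
    fix A assume A: "A \<in> sets M"
    have "prob A = prob (A \<inter> {0}) + prob (A \<inter> {1})"
    proof -
      have "prob A = prob ((A \<inter> {0}) \<union> (A \<inter> {1}))"
        using AE A singl by (intro finite_measure_eq_AE) auto
      also have "\<dots> = prob (A \<inter> {0}) + prob (A \<inter> {1})"
        using A singl by (intro finite_measure_Union) auto
      finally show ?thesis .
    qed
    also have "prob (A \<inter> {0}) = l * indicator A 0" by (auto simp: l_def indicator_def)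
    also have "prob (A \<inter> {1}) = (1 - l) * indicator A 1" using one by (auto simp: l_def indicator_def)
    finally have "emeasure M A = ennreal (l * indicator A 0 + (1 - l) * indicator A 1)"
      by (simp add: emeasure_eq_measure)
    also have "\<dots> = ennreal l * indicator A 0 + ennreal (1 - l) * indicator A 1"
      by (auto simp: indicator_def l_def ennreal_plus[symmetric] simp del: ennreal_plus)
    finally show "emeasure M A = emeasure (endpoint_mixture l) A"
      using A by (simp add: emeasure_endpoint_mixture sets_M)
  qed
  moreover have "l \<in> {0..1}" by (simp add: l_def)
  ultimately show ?thesis by blast
qed

text \<open>
  An upcrossing from below \<open>\<epsilon>\<close> to above \<open>1 - \<epsilon>\<close> with steps smaller than \<open>\<epsilon>\<close> cannot jump over the interval
  \<open>{s - \<epsilon>..s + \<epsilon>}\<close>.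
\<close>

lemma intermediate_accumulation:
  fixes r :: "nat \<Rightarrow> real"
  assumes step: "\<And>n. n \<ge> 1 \<Longrightarrow> r (Suc n) \<le> r n + 1 / real (Suc n)"
    and low: "\<And>\<epsilon>. \<epsilon> > 0 \<Longrightarrow> \<exists>\<^sub>\<infinity>n. r n \<le> \<epsilon>" and high: "\<And>\<epsilon>. \<epsilon> > 0 \<Longrightarrow> \<exists>\<^sub>\<infinity>n. r n \<ge> 1 - \<epsilon>"
    and s: "s \<in> {0..1}" and \<epsilon>: "\<epsilon> > 0"
  shows "\<exists>n\<ge>N. \<bar>r n - s\<bar> \<le> \<epsilon>"
proof -
  obtain N1 :: nat where N1: "1 / \<epsilon> < real N1" using reals_Archimedean2 by blast
  obtain n1 where n1: "n1 \<ge> max (max N N1) 1" "r n1 \<le> \<epsilon>"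
    using low[OF \<epsilon>] unfolding INFM_nat_le by blast
  obtain n2 where n2: "n2 \<ge> n1" "r n2 \<ge> 1 - \<epsilon>"
    using high[OF \<epsilon>] unfolding INFM_nat_le by blast
  define n where "n = (LEAST n. n \<ge> n1 \<and> r n \<ge> s - \<epsilon>)"
  have ex: "\<exists>n. n \<ge> n1 \<and> r n \<ge> s - \<epsilon>" using n2 s by (intro exI[of _ n2]) auto
  have n: "n \<ge> n1" "r n \<ge> s - \<epsilon>" using LeastI_ex[OF ex] by (simp_all add: n_def)
  have "r n \<le> s + \<epsilon>"
  proof (cases "n = n1")
    case True
    then show ?thesis using n1 s by auto
  next
    case False
    then obtain m where m: "n = Suc m" "m \<ge> n1" using n by (cases n) auto
    have "\<not> (m \<ge> n1 \<and> r m \<ge> s - \<epsilon>)"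
      using not_less_Least[of m "\<lambda>n. n \<ge> n1 \<and> r n \<ge> s - \<epsilon>"] m by (simp add: n_def)
    then have "r m < s - \<epsilon>" using m by simp
    moreover have "1 / real (Suc m) \<le> \<epsilon>"
    proof -
      have "1 / \<epsilon> \<le> real (Suc m)" using N1 n1 m by simp
      then show ?thesis using \<epsilon> by (simp add: field_simps)
    qed
    ultimately show ?thesis using step[of m] m n1 \<epsilon> by simp
  qed
  then show ?thesis using n n1 by (intro exI[of _ n]) auto
qed

text \<open>
  An accumulation point gives the integral zero to \<open>\<lambda>x. x * (1 - x)\<close>, since the mixtures of the two end point measures do; so it
  is a mixture itself. Conversely, \<open>r\<close> accumulates at every weight, and the empirical measures follow \<open>r\<close>.
  The identity function shows that the time averages do not converge.
\<close>

lemma oscillating_orbit: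
  fixes r :: "nat \<Rightarrow> real"
  assumes orbit: "\<And>j. (f ^^ j) x \<in> {0..1}"
    and step: "\<And>n. n \<ge> 1 \<Longrightarrow> r (Suc n) \<le> r n + 1 / real (Suc n)"
    and low: "\<And>\<epsilon>. \<epsilon> > 0 \<Longrightarrow> \<exists>\<^sub>\<infinity>n. r n \<le> \<epsilon>" and high: "\<And>\<epsilon>. \<epsilon> > 0 \<Longrightarrow> \<exists>\<^sub>\<infinity>n. r n \<ge> 1 - \<epsilon>"
    and avg: "\<And>\<phi> :: real \<Rightarrow> real. continuous_on {0..1} \<phi> \<Longrightarrow>
      (\<lambda>n. (\<Sum>j<n. \<phi> ((f ^^ j) x)) / real n - ((1 - r n) * \<phi> 0 + r n * \<phi> 1)) \<longlonglongrightarrow> 0"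
  shows "historical_point f x" "limit_measures f x = {endpoint_mixture l | l. l \<in> {0..1}}"
proof -
  show "historical_point f x"
    unfolding historical_point_def
  proof (intro exI conjI notI)
    show "continuous_on {0..1} (\<lambda>x::real. x)" by (rule continuous_on_id)
    assume "convergent (\<lambda>n. (\<Sum>j<n. (f ^^ j) x) / real n)"
    then obtain L where "(\<lambda>n. (\<Sum>j<n. (f ^^ j) x) / real n) \<longlonglongrightarrow> L" by (auto simp: convergent_def)
    from tendsto_diff[OF this avg[of "\<lambda>x. x"]] have r: "r \<longlonglongrightarrow> L" by simp
    have "\<exists>\<^sub>\<infinity>n. r n \<le> 1/4" "\<exists>\<^sub>\<infinity>n. r n \<ge> 1 - 1/4" by (intro low high; simp)+
    moreover have "\<forall>\<^sub>F n in sequentially. \<bar>r n - L\<bar> < 1/4"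
      unfolding dist_real_def[symmetric] using r by (rule tendstoD) simp
    ultimately obtain n m where "r n \<le> 1/4" "\<bar>r n - L\<bar> < 1/4" "r m \<ge> 1 - 1/4" "\<bar>r m - L\<bar> < 1/4"
      unfolding INFM_nat_le eventually_sequentially by meson
    then show False by linarith
  qed
  have limD: "\<exists>\<^sub>\<infinity>n. n \<ge> 1 \<and> integral\<^sup>L (empirical_measure f x n) \<phi> \<in> V"
    if M: "M \<in> limit_measures f x" and \<phi>: "continuous_on {0..1} \<phi>" and V: "open V" "integral\<^sup>L M \<phi> \<in> V"
    for M and \<phi> :: "real \<Rightarrow> real" and V
  proof -
    have "M \<in> {M \<in> prob_measures_I. integral\<^sup>L M \<phi> \<in> V}"
      using M V by (simp add: limit_measures_def topspace_weak_star_topology)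
    then have "\<exists>\<^sub>\<infinity>n. n \<ge> 1 \<and> empirical_measure f x n \<in> {M \<in> prob_measures_I. integral\<^sup>L M \<phi> \<in> V}"
      using M openin_weak_star_integral[OF \<phi> V(1)] unfolding limit_measures_def by blast
    then show ?thesis by (rule INFM_mono) auto
  qed
  show "limit_measures f x = {endpoint_mixture l | l. l \<in> {0..1}}"
  proof (intro equalityI subsetI)
    fix M assume M: "M \<in> limit_measures f x"
    let ?\<phi> = "\<lambda>x::real. x * (1 - x)"
    have \<phi>: "continuous_on {0..1} ?\<phi>" by (intro continuous_intros)
    have "integral\<^sup>L M ?\<phi> = 0"
    proof (rule ccontr)
      assume nz: "integral\<^sup>L M ?\<phi> \<noteq> 0"
      define e where "e = \<bar>integral\<^sup>L M ?\<phi>\<bar> / 2"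
      have e: "e > 0" using nz by (simp add: e_def)
      have "\<forall>\<^sub>F n in sequentially. \<bar>(\<Sum>j<n. ?\<phi> ((f ^^ j) x)) / real n\<bar> < e"
        using tendstoD[OF avg[OF \<phi>] e] by (simp add: dist_real_def)
      moreover have "\<exists>\<^sub>\<infinity>n. n \<ge> 1 \<and> integral\<^sup>L (empirical_measure f x n) ?\<phi> \<in> ball (integral\<^sup>L M ?\<phi>) e"
        using e by (intro limD[OF M \<phi>]) auto
      ultimately obtain n where n: "n \<ge> 1" "\<bar>(\<Sum>j<n. ?\<phi> ((f ^^ j) x)) / real n\<bar> < e"
        "integral\<^sup>L (empirical_measure f x n) ?\<phi> \<in> ball (integral\<^sup>L M ?\<phi>) e"
        unfolding INFM_nat_le eventually_sequentially by meson
      then have "\<bar>integral\<^sup>L M ?\<phi> - (\<Sum>j<n. ?\<phi> ((f ^^ j) x)) / real n\<bar> < e"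
        using integral_empirical_measure[OF orbit n(1) \<phi>] by (simp add: dist_real_def)
      then show False using n(2) unfolding e_def by linarith
    qed
    then show "M \<in> {endpoint_mixture l | l. l \<in> {0..1}}"
      using measure_on_endpoints[of M] M by (auto simp: limit_measures_def topspace_weak_star_topology)
  next
    fix M assume "M \<in> {endpoint_mixture l | l. l \<in> {0..1}}"
    then obtain l where l: "l \<in> {0..1}" "M = endpoint_mixture l" by blast
    have "\<exists>s. \<forall>k. s k \<ge> k \<and> \<bar>r (s k) - (1 - l)\<bar> \<le> 1 / real (Suc k)"
    proof (rule choice, rule allI)
      fix k
      show "\<exists>n. n \<ge> k \<and> \<bar>r n - (1 - l)\<bar> \<le> 1 / real (Suc k)"
      proof (rule intermediate_accumulation[OF step low high])
        show "1 - l \<in> {0..1}" using l by simp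
      qed simp_all
    qed
    then obtain s where s: "\<And>k. s k \<ge> k" "\<And>k. \<bar>r (s k) - (1 - l)\<bar> \<le> 1 / real (Suc k)" by blast
    have s_top: "filterlim s at_top sequentially"
      by (rule filterlim_at_top_mono[OF filterlim_ident always_eventually]) (simp add: s)
    have "(\<lambda>k. r (s k) - (1 - l)) \<longlonglongrightarrow> 0"
      by (rule Lim_null_comparison[OF _ LIMSEQ_inverse_real_of_nat]) (use s(2) in \<open>simp add: inverse_eq_divide\<close>)
    then have rs: "(\<lambda>k. r (s k)) \<longlonglongrightarrow> 1 - l" by (simp add: LIM_zero_iff)
    have conv: "(\<lambda>k. integral\<^sup>L (empirical_measure f x (s k)) \<phi>) \<longlonglongrightarrow> integral\<^sup>L M \<phi>"
      if \<phi>: "continuous_on {0..1} \<phi>" for \<phi> :: "real \<Rightarrow> real"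
    proof -
      have "(\<lambda>k. (\<Sum>j<s k. \<phi> ((f ^^ j) x)) / real (s k) - ((1 - r (s k)) * \<phi> 0 + r (s k) * \<phi> 1)
            + ((1 - r (s k)) * \<phi> 0 + r (s k) * \<phi> 1)) \<longlonglongrightarrow> 0 + ((1 - (1 - l)) * \<phi> 0 + (1 - l) * \<phi> 1)"
        by (intro tendsto_intros rs filterlim_compose[OF avg[OF \<phi>] s_top])
      then have "(\<lambda>k. (\<Sum>j<s k. \<phi> ((f ^^ j) x)) / real (s k)) \<longlonglongrightarrow> integral\<^sup>L M \<phi>"
        unfolding l(2) integral_endpoint_mixture[OF l(1) \<phi>] by simp
      moreover have "\<forall>\<^sub>F k in sequentially. (\<Sum>j<s k. \<phi> ((f ^^ j) x)) / real (s k) = integral\<^sup>L (empirical_measure f x (s k)) \<phi>"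
        using eventually_ge_at_top[of 1]
      proof eventually_elim
        case (elim k)
        then have "s k \<ge> 1" using s(1)[of k] by simp
        then show ?case by (simp only: integral_empirical_measure[OF orbit _ \<phi>])
      qed
      ultimately show ?thesis by (rule Lim_transform_eventually)
    qed
    show "M \<in> limit_measures f x"
      unfolding limit_measures_def topspace_weak_star_topology
      using prob_endpoint_mixture[OF l(1)] l(2)
        frequently_in_weak_star_open[OF _ _ prob_empirical_measure[OF orbit] s_top conv] by blast
  qed
qed

section \<open>Thaler functions\<close>

text \<open>
  One branch of a Thaler function, extended to its closed interval.
\<close>

locale expanding_branch =
  fixes \<phi> \<phi>' :: "real \<Rightarrow> real" and a b M D :: real
  assumes ab: "0 \<le> a" "a < b" "b \<le> 1"
    and deriv: "\<And>x. x \<in> {a..b} \<Longrightarrow> (\<phi> has_real_derivative \<phi>' x) (at x within {a..b})"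
    and deriv_ge: "\<And>x. x \<in> {a..b} \<Longrightarrow> 1 \<le> \<phi>' x"
    and deriv_gt: "\<And>x. x \<in> {a<..<b} \<Longrightarrow> 1 < \<phi>' x"
    and deriv_le: "\<And>x. x \<in> {a..b} \<Longrightarrow> \<phi>' x \<le> D"
    and deriv_lipschitz: "\<And>x y. x \<in> {a..b} \<Longrightarrow> y \<in> {a..b} \<Longrightarrow> \<phi>' x \<le> \<phi>' y + M * \<bar>x - y\<bar>"
    and M_nonneg: "M \<ge> 0"
    and ends: "\<phi> a = 0" "\<phi> b = 1"
begin

lemma mean_value:
  assumes "a \<le> x" "x < y" "y \<le> b"
  obtains \<xi> where "x < \<xi>" "\<xi> < y" "\<phi> y - \<phi> x = \<phi>' \<xi> * (y - x)"
proof -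
  have cont: "continuous_on {a..b} \<phi>" by (rule DERIV_continuous_on) (rule deriv)
  have d: "DERIV \<phi> z :> \<phi>' z" if "a < z" "z < b" for z
    using deriv[of z] that by (simp add: at_within_Icc_at)
  have "\<exists>l z. x < z \<and> z < y \<and> DERIV \<phi> z :> l \<and> \<phi> y - \<phi> x = (y - x) * l"
  proof (rule MVT)
    show "continuous_on {x..y} \<phi>" using cont by (rule continuous_on_subset) (use assms in auto)
    fix z assume "x < z" "z < y"
    then show "\<phi> differentiable (at z)" using d[of z] assms by (auto simp: real_differentiable_def)
  qed fact
  then obtain l z where z: "x < z" "z < y" "DERIV \<phi> z :> l" "\<phi> y - \<phi> x = (y - x) * l" by blast
  have "l = \<phi>' z" using d[of z] z assms by (intro DERIV_unique[OF z(3)]) auto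
  with z that show thesis by (simp add: mult.commute)
qed

lemma strict_expansion:
  assumes "a \<le> x" "x < y" "y \<le> b"
  shows "y - x < \<phi> y - \<phi> x"
proof -
  obtain \<xi> where \<xi>: "x < \<xi>" "\<xi> < y" "\<phi> y - \<phi> x = \<phi>' \<xi> * (y - x)"
    using mean_value[OF assms] .
  have "1 * (y - x) < \<phi>' \<xi> * (y - x)"
    using \<xi> assms deriv_gt[of \<xi>] by (intro mult_strict_right_mono) auto
  then show ?thesis using \<xi> by simp
qed

lemma \<phi>_less: "a \<le> x \<Longrightarrow> x < y \<Longrightarrow> y \<le> b \<Longrightarrow> \<phi> x < \<phi> y"
  using strict_expansion[of x y] by simp

lemma \<phi>_bij: "bij_betw \<phi> {a..b} {0..1}"
proof (rule bij_betw_imageI)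
  show "inj_on \<phi> {a..b}"
  proof (rule linorder_inj_onI)
    fix x y assume "x < y" "x \<in> {a..b}" "y \<in> {a..b}"
    then show "\<phi> x \<noteq> \<phi> y" using \<phi>_less[of x y] by auto
  qed auto
  show "\<phi> ` {a..b} = {0..1}"
  proof (intro equalityI subsetI)
    fix y assume "y \<in> \<phi> ` {a..b}"
    then obtain x where x: "x \<in> {a..b}" "y = \<phi> x" by blast
    have "\<phi> a \<le> \<phi> x" using \<phi>_less[of a x] x by (cases "a = x") auto
    moreover have "\<phi> x \<le> \<phi> b" using \<phi>_less[of x b] x by (cases "x = b") auto
    ultimately show "y \<in> {0..1}" using x ends by simp
  next
    fix y :: real assume y: "y \<in> {0..1}"
    have cont: "continuous_on {a..b} \<phi>" by (rule DERIV_continuous_on) (rule deriv)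
    then show "y \<in> \<phi> ` {a..b}" using IVT'[of \<phi> a y b] y ends ab by force
  qed
qed

definition inverse_branch :: "real \<Rightarrow> real" where
  "inverse_branch = inv_into {a..b} \<phi>"

lemma inverse_in: "y \<in> {0..1} \<Longrightarrow> inverse_branch y \<in> {a..b}"
  and \<phi>_inverse: "y \<in> {0..1} \<Longrightarrow> \<phi> (inverse_branch y) = y"
  and inverse_\<phi>: "x \<in> {a..b} \<Longrightarrow> inverse_branch (\<phi> x) = x"
  using \<phi>_bij unfolding inverse_branch_def bij_betw_def
  by (metis inv_into_into, metis f_inv_into_f, metis inv_into_f_f)

lemma inverse_ends: "inverse_branch 0 = a" "inverse_branch 1 = b"
  using inverse_\<phi>[of a] inverse_\<phi>[of b] ends ab by auto

lemma inverse_less: "0 \<le> x \<Longrightarrow> x < y \<Longrightarrow> y \<le> 1 \<Longrightarrow> inverse_branch x < inverse_branch y"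
  using inverse_in[of x] inverse_in[of y] \<phi>_inverse[of x] \<phi>_inverse[of y]
    \<phi>_less[of "inverse_branch y" "inverse_branch x"]
  by (cases "inverse_branch x" "inverse_branch y" rule: linorder_cases) auto

lemma inverse_le: "0 \<le> x \<Longrightarrow> x \<le> y \<Longrightarrow> y \<le> 1 \<Longrightarrow> inverse_branch x \<le> inverse_branch y"
  using inverse_less[of x y] by (cases "x = y") auto

lemma inverse_slope:
  assumes "0 \<le> x" "x \<le> y" "y \<le> 1"
  obtains \<xi> where "\<xi> \<in> {inverse_branch x..inverse_branch y}" "y - x = \<phi>' \<xi> * (inverse_branch y - inverse_branch x)"
proof (cases "x = y")
  case True
  then show thesis using that[of "inverse_branch x"] by simp
next
  case False
  then have xy: "x < y" using assms by simp
  obtain \<xi> where "inverse_branch x < \<xi>" "\<xi> < inverse_branch y"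
    "\<phi> (inverse_branch y) - \<phi> (inverse_branch x) = \<phi>' \<xi> * (inverse_branch y - inverse_branch x)"
    using mean_value[of "inverse_branch x" "inverse_branch y"] inverse_less[of x y] inverse_in[of x] inverse_in[of y] xy assms
    by auto
  then show thesis using that[of \<xi>] assms by (auto simp: \<phi>_inverse)
qed

lemma inverse_contracts:
  assumes xy: "0 \<le> x" "x \<le> y" "y \<le> 1" and \<rho>: "\<rho> > 0"
    and ge: "\<And>\<xi>. \<xi> \<in> {inverse_branch x..inverse_branch y} \<Longrightarrow> \<rho> \<le> \<phi>' \<xi>"
  shows "inverse_branch y - inverse_branch x \<le> (y - x) / \<rho>"
proof -
  obtain \<xi> where \<xi>: "\<xi> \<in> {inverse_branch x..inverse_branch y}" "y - x = \<phi>' \<xi> * (inverse_branch y - inverse_branch x)"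
    using inverse_slope[OF xy] .
  have "\<rho> * (inverse_branch y - inverse_branch x) \<le> y - x"
    unfolding \<xi>(2) using ge[OF \<xi>(1)] inverse_le[OF xy] by (intro mult_right_mono) auto
  then show ?thesis using \<rho> by (simp add: field_simps)
qed

text \<open>
  By the mean value theorem the slopes of the inverse are reciprocals of derivatives at points of the image. Two such
  derivatives differ by at most \<open>M\<close> times the length of the image, and they are at least one, so their ratio is
  at most \<open>1 + M * length \<le> exp (M * length)\<close>.
\<close>

lemma branch_map_inverse:
  assumes "\<Lambda> \<ge> M" "B \<ge> D"
  shows "branch_map inverse_branch \<Lambda> B"
proof
  show "strict_mono_on {0..1} inverse_branch"
    by (auto simp: strict_mono_on_def inverse_less)
  show "inverse_branch x \<in> {0..1}" if "x \<in> {0..1}" for x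
    using inverse_in[OF that] ab by auto
  show "inverse_branch y - inverse_branch x \<le> y - x" if "0 \<le> x" "x \<le> y" "y \<le> 1" for x y
    using inverse_contracts[OF that, of 1] deriv_ge inverse_in[of x] inverse_in[of y] that by force
  show "y - x \<le> B * (inverse_branch y - inverse_branch x)" if xy: "0 \<le> x" "x \<le> y" "y \<le> 1" for x y
  proof -
    obtain \<xi> where \<xi>: "\<xi> \<in> {inverse_branch x..inverse_branch y}" "y - x = \<phi>' \<xi> * (inverse_branch y - inverse_branch x)"
      using inverse_slope[OF xy] .
    show ?thesis
      unfolding \<xi>(2) using deriv_le[of \<xi>] \<xi>(1) inverse_in[of x] inverse_in[of y] xy inverse_le[OF xy] assms
      by (intro mult_right_mono) auto
  qed
  show "distortion_le (\<Lambda> * (inverse_branch t - inverse_branch s)) {s..t} inverse_branch"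
    if st: "0 \<le> s" "s \<le> t" "t \<le> 1" for s t
    unfolding distortion_le_def
  proof (intro ballI impI)
    fix x y z w assume *: "x \<in> {s..t}" "y \<in> {s..t}" "z \<in> {s..t}" "w \<in> {s..t}" "x \<le> y" "z \<le> w"
    let ?h = inverse_branch
    let ?d = "?h t - ?h s"
    obtain \<xi> where \<xi>: "\<xi> \<in> {?h x..?h y}" "y - x = \<phi>' \<xi> * (?h y - ?h x)"
      using inverse_slope[of x y] * st by auto
    obtain \<zeta> where \<zeta>: "\<zeta> \<in> {?h z..?h w}" "w - z = \<phi>' \<zeta> * (?h w - ?h z)"
      using inverse_slope[of z w] * st by auto
    have h: "?h s \<le> ?h x" "?h x \<le> ?h y" "?h y \<le> ?h t" "?h s \<le> ?h z" "?h z \<le> ?h w" "?h w \<le> ?h t"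
      using * st by (auto intro!: inverse_le)
    have ran: "\<xi> \<in> {a..b}" "\<zeta> \<in> {a..b}"
      using \<xi>(1) \<zeta>(1) h inverse_in[of s] inverse_in[of t] st by auto
    have "\<phi>' \<zeta> \<le> \<phi>' \<xi> + M * \<bar>\<zeta> - \<xi>\<bar>" by (rule deriv_lipschitz[OF ran(2,1)])
    also have "\<dots> \<le> \<phi>' \<xi> + \<Lambda> * ?d"
      using \<xi>(1) \<zeta>(1) h assms M_nonneg by (intro add_left_mono mult_mono) auto
    also have "\<dots> \<le> \<phi>' \<xi> + \<phi>' \<xi> * (\<Lambda> * ?d)"
      using deriv_ge[OF ran(1)] h assms M_nonneg mult_right_mono[of 1 "\<phi>' \<xi>" "\<Lambda> * ?d"] by simp
    also have "\<dots> = \<phi>' \<xi> * (1 + \<Lambda> * ?d)" by (simp add: algebra_simps)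
    also have "\<dots> \<le> \<phi>' \<xi> * exp (\<Lambda> * ?d)"
      using deriv_ge[OF ran(1)] by (intro mult_left_mono exp_ge_add_one_self) auto
    finally have le: "\<phi>' \<zeta> \<le> \<phi>' \<xi> * exp (\<Lambda> * ?d)" .
    have "(?h y - ?h x) * (w - z) = ((?h y - ?h x) * (?h w - ?h z)) * \<phi>' \<zeta>" by (simp add: \<zeta>(2))
    also have "\<dots> \<le> ((?h y - ?h x) * (?h w - ?h z)) * (\<phi>' \<xi> * exp (\<Lambda> * ?d))"
      using h by (intro mult_left_mono le mult_nonneg_nonneg) auto
    also have "\<dots> = exp (\<Lambda> * ?d) * ((?h w - ?h z) * (y - x))" by (simp add: \<xi>(2))
    finally show "(?h y - ?h x) * (w - z) \<le> exp (\<Lambda> * ?d) * ((?h w - ?h z) * (y - x))" .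
  qed
qed

end

text \<open>
  The bounds for the derivative and its Lipschitz constant come from compactness of the closed interval; the
  values at the end points come from continuity and the surjectivity of the open branch.
\<close>

lemma expanding_branch_of_C2:
  fixes f \<phi> :: "real \<Rightarrow> real"
  assumes ab: "0 \<le> a" "a < b" "b \<le> 1" and C2: "C2_on {a..b} \<phi>"
    and agree: "\<And>x. x \<in> {a<..<b} \<Longrightarrow> \<phi> x = f x"
    and expand: "\<And>x. x \<in> {a<..<b} \<Longrightarrow> deriv f x > 1"
    and image: "f ` {a<..<b} = {0<..<1}"
  obtains \<phi>' M D where "expanding_branch \<phi> \<phi>' a b M D" "continuous_on {a..b} \<phi>'"
proof -
  obtain \<phi>' \<phi>'' where d: "\<And>x. x \<in> {a..b} \<Longrightarrow> (\<phi> has_real_derivative \<phi>' x) (at x within {a..b})"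
    and d2: "\<And>x. x \<in> {a..b} \<Longrightarrow> (\<phi>' has_real_derivative \<phi>'' x) (at x within {a..b})"
    and cont2: "continuous_on {a..b} \<phi>''"
    using C2 unfolding C2_on_def by blast
  have cont: "continuous_on {a..b} \<phi>" by (rule DERIV_continuous_on) (rule d)
  have cont1: "continuous_on {a..b} \<phi>'" by (rule DERIV_continuous_on) (rule d2)
  have clos: "closure {a<..<b} = {a..b}" using ab by (intro closure_greaterThanLessThan) auto
  have gt: "1 < \<phi>' x" if x: "x \<in> {a<..<b}" for x
  proof -
    have "DERIV \<phi> x :> \<phi>' x" using d[of x] x by (simp add: at_within_Icc_at)
    moreover have "\<forall>\<^sub>F y in nhds x. \<phi> y = f y"
      using x by (intro eventually_nhds_in_open[of "{a<..<b}", THEN eventually_mono]) (auto simp: agree)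
    ultimately have "DERIV f x :> \<phi>' x"
      using DERIV_cong_ev[of x x \<phi> f "\<phi>' x" "\<phi>' x"] by simp
    then show ?thesis using expand[OF x] DERIV_imp_deriv by metis
  qed
  have ge: "1 \<le> \<phi>' x" if "x \<in> {a..b}" for x
    using continuous_ge_on_closure[of "{a<..<b}" \<phi>' x 1] cont1 gt that clos by (auto intro: less_imp_le)
  have bounded: "\<exists>K. \<forall>x\<in>{a..b}. \<bar>g x\<bar> \<le> K" if "continuous_on {a..b} g" for g :: "real \<Rightarrow> real"
  proof -
    have "bounded (g ` {a..b})"
      using that by (intro compact_imp_bounded compact_continuous_image) auto
    then show ?thesis by (auto simp: bounded_real)
  qed
  obtain D where D: "\<And>x. x \<in> {a..b} \<Longrightarrow> \<bar>\<phi>' x\<bar> \<le> D" using bounded[OF cont1] by blast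
  obtain M where M: "\<And>x. x \<in> {a..b} \<Longrightarrow> \<bar>\<phi>'' x\<bar> \<le> M" using bounded[OF cont2] by blast
  have M0: "M \<ge> 0" using M[of a] ab by (auto intro: order_trans[OF abs_ge_zero])
  have lip: "\<phi>' x \<le> \<phi>' y + M * \<bar>x - y\<bar>" if "x \<in> {a..b}" "y \<in> {a..b}" for x y
  proof -
    have "norm (\<phi>' x - \<phi>' y) \<le> M * norm (x - y)"
      using d2 M that by (intro field_differentiable_bound[of "{a..b}" \<phi>' \<phi>'']) auto
    then show ?thesis by simp
  qed
  have \<phi>_pos: "0 \<le> \<phi> x \<and> \<phi> x \<le> 1" if "x \<in> {a..b}" for x
    using continuous_ge_on_closure[of "{a<..<b}" \<phi> x 0] continuous_le_on_closure[of "{a<..<b}" \<phi> x 1]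
      cont that clos agree image by (fastforce intro: less_imp_le)
  have mono: "\<phi> x \<le> \<phi> y" if "a \<le> x" "x \<le> y" "y \<le> b" for x y
  proof -
    have "\<exists>z\<in>{x..y}. \<phi> y - \<phi> x = \<phi>' z * (y - x)"
    proof (rule mvt_very_simple[of x y \<phi> "\<lambda>z h. \<phi>' z * h"])
      fix z assume "x \<le> z" "z \<le> y"
      then have "(\<phi> has_real_derivative \<phi>' z) (at z within {x..y})"
        using d[of z] that by (auto intro: DERIV_subset)
      then show "(\<phi> has_derivative (\<lambda>h. \<phi>' z * h)) (at z within {x..y})"
        by (simp add: has_field_derivative_def)
    qed fact
    then obtain z where z: "z \<in> {x..y}" "\<phi> y - \<phi> x = \<phi>' z * (y - x)" by blast
    have "\<phi>' z * (y - x) \<ge> 0" using ge[of z] z(1) that by (intro mult_nonneg_nonneg) auto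
    then show ?thesis using z by simp
  qed
  have a_le: "\<phi> a \<le> e" and b_ge: "e \<le> \<phi> b" if e: "0 < e" "e < 1" for e
  proof -
    have "e \<in> f ` {a<..<b}" using image e by simp
    then obtain x where x: "x \<in> {a<..<b}" "f x = e" by blast
    then show "\<phi> a \<le> e" "e \<le> \<phi> b" using mono[of a x] mono[of x b] agree[of x] by simp_all
  qed
  have a0: "\<phi> a = 0"
  proof (rule ccontr)
    assume "\<phi> a \<noteq> 0"
    then have "\<phi> a > 0" using \<phi>_pos[of a] ab by auto
    then obtain e where "0 < e" "e < min (\<phi> a) 1" using dense[of 0 "min (\<phi> a) 1"] by auto
    then show False using a_le[of e] by simp
  qed
  have b1: "\<phi> b = 1"
  proof (rule ccontr)
    assume "\<phi> b \<noteq> 1"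
    then have "\<phi> b < 1" using \<phi>_pos[of b] ab by auto
    then obtain e where "max (\<phi> b) 0 < e" "e < 1" using dense[of "max (\<phi> b) 0" 1] by auto
    then show False using b_ge[of e] by simp
  qed
  have "expanding_branch \<phi> \<phi>' a b M D"
    using ab d ge gt D lip M0 a0 b1 by unfold_locales (auto intro: order_trans[OF abs_ge_self])
  then show thesis using cont1 that by blast
qed

lemma one_sided_derivative_eq:
  assumes "(\<phi> has_real_derivative d) (at x within {x..b})" "(\<phi> has_real_derivative d') (at x within {x..b})" "x < (b::real)"
  shows "d = d'"
proof -
  have "\<not> trivial_limit (at x within {x..b})"
    using assms(3) by (simp add: trivial_limit_within islimpt_Icc)
  then show ?thesis
    using assms(1,2) unfolding has_field_derivative_iff by (rule tendsto_unique)
qed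

text \<open>
  The uniform contraction of \<open>v\<close> on \<open>{0..c}\<close> holds since the derivative of the right branch is greater than one on the compact
  interval \<open>{c..v c}\<close>, including the point \<open>c\<close>.
\<close>

lemma thaler_function_coded:
  assumes "thaler_function f"
  obtains u v \<Lambda> B c \<rho> p where "coded_map u v \<Lambda> B c \<rho> f" "p > 1"
    "regular_contact_at_0 f c p" "comparable_contacts f p"
proof -
  obtain c p fl fr where c: "c \<in> {0<..<1}" and p: "p > 1"
    and fb: "full_branch f c fl fr" and ae: "almost_expanding f c fl fr"
    and reg: "regular_contact_at_0 f c p" and comp: "comparable_contacts f p"
    using assms unfolding thaler_function_def by blast
  have preL: "C2_on {0..c} fl" "\<And>x. x \<in> {0<..<c} \<Longrightarrow> fl x = f x"
    "\<And>x. x \<in> {0<..<c} \<Longrightarrow> deriv f x > 1" "f ` {0<..<c} = {0<..<1}"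
    using fb ae unfolding full_branch_def almost_expanding_def by blast+
  have preR: "C2_on {c..1} fr" "\<And>x. x \<in> {c<..<1} \<Longrightarrow> fr x = f x"
    "\<And>x. x \<in> {c<..<1} \<Longrightarrow> deriv f x > 1" "f ` {c<..<1} = {0<..<1}"
    using fb ae unfolding full_branch_def almost_expanding_def by blast+
  have c01: "0 \<le> (0::real)" "0 < c" "c \<le> 1" "0 \<le> c" "c < 1" "(1::real) \<le> 1" using c by auto
  obtain fl' M1 D1 where L: "expanding_branch fl fl' 0 c M1 D1" "continuous_on {0..c} fl'"
    using expanding_branch_of_C2[OF c01(1-3) preL] by blast
  obtain fr' M2 D2 where R: "expanding_branch fr fr' c 1 M2 D2" "continuous_on {c..1} fr'"
    using expanding_branch_of_C2[OF c01(4-6) preR] by blast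
  interpret l: expanding_branch fl fl' 0 c M1 D1 by (rule L)
  interpret r: expanding_branch fr fr' c 1 M2 D2 by (rule R)
  let ?u = l.inverse_branch and ?v = r.inverse_branch
  define \<Lambda> where "\<Lambda> = max M1 M2"
  define B where "B = max D1 D2"
  interpret u: branch_map ?u \<Lambda> B by (rule l.branch_map_inverse) (auto simp: \<Lambda>_def B_def)
  interpret v: branch_map ?v \<Lambda> B by (rule r.branch_map_inverse) (auto simp: \<Lambda>_def B_def)
  have vc: "c < ?v c" "?v c < 1"
    using r.inverse_less[of 0 c] r.inverse_less[of c 1] r.inverse_ends c by auto
  have "fr' c > 1"
  proof -
    obtain d where "d > 1" "(fr has_real_derivative d) (at c within {c..1})"
      using ae by (auto simp: almost_expanding_def)
    moreover have "(fr has_real_derivative fr' c) (at c within {c..1})" using c by (intro r.deriv) auto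
    ultimately show ?thesis using one_sided_derivative_eq[of fr d c 1 "fr' c"] c by auto
  qed
  then have gt: "fr' x > 1" if "x \<in> {c..?v c}" for x
    using r.deriv_gt[of x] that vc by (cases "x = c") auto
  have "continuous_on {c..?v c} fr'" using R(2) by (rule continuous_on_subset) (use vc in auto)
  then obtain \<xi> where \<xi>: "\<xi> \<in> {c..?v c}" "\<And>x. x \<in> {c..?v c} \<Longrightarrow> fr' \<xi> \<le> fr' x"
    using continuous_attains_inf[of "{c..?v c}" fr'] vc by auto
  have "coded_map ?u ?v \<Lambda> B c (fr' \<xi>) f"
  proof
    show "?u 0 = 0" "?u 1 = c" "?v 0 = c" "?v 1 = 1" by (rule l.inverse_ends r.inverse_ends)+
    show "0 < c" "c < 1" using c by auto
    show "\<Lambda> \<ge> 0" using l.M_nonneg by (simp add: \<Lambda>_def)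
    show "1 < fr' \<xi>" by (rule gt[OF \<xi>(1)])
    fix x :: real assume x: "x \<in> {0<..<1}"
    have ux: "0 < ?u x" "?u x < c" using l.inverse_less[of 0 x] l.inverse_less[of x 1] l.inverse_ends x by auto
    have vx: "c < ?v x" "?v x < 1" using r.inverse_less[of 0 x] r.inverse_less[of x 1] r.inverse_ends x by auto
    show "?u x < x"
      using l.strict_expansion[of 0 "?u x"] l.\<phi>_inverse[of x] l.ends ux x by simp
    show "x < ?v x"
      using r.strict_expansion[of "?v x" 1] r.\<phi>_inverse[of x] r.ends vx x by simp
    show "f (?u x) = x" using fb ux x l.\<phi>_inverse[of x] by (simp add: full_branch_def)
    show "f (?v x) = x" using fb vx x r.\<phi>_inverse[of x] by (simp add: full_branch_def)
  next
    fix x y :: real assume xy: "0 \<le> x" "x \<le> y" "y \<le> c"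
    have y1: "y \<le> 1" using xy c by auto
    show "?v y - ?v x \<le> (y - x) / fr' \<xi>"
    proof (rule r.inverse_contracts[OF xy(1,2) y1])
      show "0 < fr' \<xi>" using gt[OF \<xi>(1)] by simp
      fix z assume "z \<in> {?v x..?v y}"
      moreover have "c \<le> ?v x" using r.inverse_in[of x] xy c by auto
      moreover have "?v y \<le> ?v c" using xy c by (intro r.inverse_le) auto
      ultimately show "fr' \<xi> \<le> fr' z" by (intro \<xi>(2)) auto
    qed
  qed
  then show thesis using p reg comp that by blast
qed

context coded_map
begin

lemma left_contact:
  assumes "x \<in> {0<..<c}"
  shows "f x \<in> {0<..<1}" "x = u (f x)" "x < f x"
proof -
  have "br False 0 < x" "x < br False 1" using assms by (simp_all add: u_0 u_1)
  then obtain y where y: "y \<in> {0<..<1}" "x = br False y"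
    by (rule br_between[rotated 3]) simp_all
  have fx: "f x = y" unfolding y(2) by (rule f_br[OF y(1)])
  show "f x \<in> {0<..<1}" unfolding fx by (rule y(1))
  show "x = u (f x)" unfolding fx using y(2) by simp
  show "x < f x" unfolding fx using u_less[OF y(1)] y(2) by simp
qed

text \<open>
  The two ladders approach the fixed points by the steps \<open>g x = f x - x\<close> and \<open>(1 - x) - f (1 - x)\<close>. These are
  comparable, so \<open>approach_rate\<close> determines the rates of both ladders in terms of the same function \<open>g\<close>. The
  exponent \<open>1 / q\<close> is less than one because \<open>p > 1\<close> leaves room for some \<open>q\<close> with \<open>1 < q < p\<close>.
\<close>

lemma tails_regular:
  assumes p: "p > 1" and reg: "regular_contact_at_0 f c p" and comp: "comparable_contacts f p"
  shows "\<exists>\<gamma> R A. 0 < \<gamma> \<and> \<gamma> < 1 \<and> 0 < R \<and> 0 < A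
    \<and> (\<forall>j s. 1 \<le> j \<longrightarrow> j \<le> s \<longrightarrow> cl j \<le> R * (real s / real j) powr \<gamma> * cl s)
    \<and> (\<forall>n. cl n \<le> A * (1 - dr n)) \<and> (\<forall>n. 1 - dr n \<le> A * cl n)"
proof -
  define g where "g x = f x - x" for x
  have g_pos: "g t > 0" if "0 < t" "t < c" for t
    using left_contact(3)[of t] that by (simp add: g_def)
  have g_mono: "g s \<le> g t" if st: "0 < s" "s \<le> t" "t < c" for s t
  proof -
    have st': "s \<in> {0<..<c}" "t \<in> {0<..<c}" using st by auto
    note s = left_contact(1,2)[OF st'(1)] and t = left_contact(1,2)[OF st'(2)]
    have "f s \<le> f t"
    proof (rule ccontr)
      assume "\<not> f s \<le> f t"
      then have "u (f t) < u (f s)" using s(1) t(1) by (intro left.less) auto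
      then show False unfolding s(2)[symmetric] t(2)[symmetric] using st by simp
    qed
    then have "u (f t) - u (f s) \<le> f t - f s" using s(1) t(1) by (intro left.contraction) auto
    then show ?thesis unfolding s(2)[symmetric] t(2)[symmetric] by (simp add: g_def)
  qed
  obtain h where h: "\<And>x. x \<in> {0<..<c} \<Longrightarrow> g x = h x * x powr (p + 1)"
    and slow: "\<And>k. k > 0 \<Longrightarrow> (\<lambda>x. h (k * x)) \<sim>[at_right 0] h"
    using reg unfolding regular_contact_at_0_def g_def by blast
  obtain a where a: "a > 0" and contacts: "(\<lambda>x. (1 - x) - f (1 - x)) \<sim>[at_right 0] (\<lambda>x. a powr p * g x)"
    using comp unfolding comparable_contacts_def g_def by blast
  have rv: "(\<lambda>x. g (k * x)) \<sim>[at_right 0] (\<lambda>x. k powr (p + 1) * g x)" if "k > 0" for k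
    using regular_variation[OF h c(1) slow[OF that] that] .
  define q where "q = (p + 1) / 2"
  have q: "1 < q" "q < p" using p by (auto simp: q_def)
  have near0: "\<forall>\<^sub>F x in at_right 0. x \<in> {0<..<c}"
    unfolding eventually_at_right_field using c by (intro exI[of _ c]) auto
  have pos_ev: "\<forall>\<^sub>F x in at_right 0. K * g x > 0" if "K > 0" for K
    using near0 by eventually_elim (use that g_pos in auto)
  \<comment> \<open>The gap between \<open>q\<close> and \<open>p\<close> absorbs the error of the asymptotic equivalence.\<close>
  have "\<forall>\<^sub>F x in at_right 0. g (1/2 * x) \<le> 2 powr (p - q) * ((1/2) powr (p + 1) * g x)"
    using q by (intro asymp_equiv_eventually_le(1)[OF rv pos_ev]) auto
  then have halve_ev: "\<forall>\<^sub>F x in at_right 0. g (x / 2) \<le> (1/2) powr (q + 1) * g x"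
    by eventually_elim (simp add: powr_divide powr_diff powr_add field_simps)
  have double_ev: "\<forall>\<^sub>F x in at_right 0. g (2 * x) \<le> 2 * (2 powr (p + 1) * g x)"
    by (intro asymp_equiv_eventually_le(1)[OF rv pos_ev]) auto
  have contact_ev: "\<forall>\<^sub>F x in at_right 0. (1 - x) - f (1 - x) \<le> 2 * (a powr p * g x)"
    "\<forall>\<^sub>F x in at_right 0. a powr p * g x \<le> 2 * ((1 - x) - f (1 - x))"
    using a by (intro asymp_equiv_eventually_le[OF contacts pos_ev]; simp)+
  have "\<forall>\<^sub>F x in at_right 0. g (x / 2) \<le> (1/2) powr (q + 1) * g x \<and> g (2 * x) \<le> 2 * (2 powr (p + 1) * g x)
      \<and> (1 - x) - f (1 - x) \<le> 2 * (a powr p * g x) \<and> a powr p * g x \<le> 2 * ((1 - x) - f (1 - x)) \<and> x \<in> {0<..<c}"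
    using halve_ev double_ev contact_ev near0 by eventually_elim auto
  then obtain r where r: "r > 0" and near: "\<And>x. 0 < x \<Longrightarrow> x < r \<Longrightarrow>
      g (x / 2) \<le> (1/2) powr (q + 1) * g x \<and> g (2 * x) \<le> 2 * (2 powr (p + 1) * g x)
      \<and> (1 - x) - f (1 - x) \<le> 2 * (a powr p * g x) \<and> a powr p * g x \<le> 2 * ((1 - x) - f (1 - x)) \<and> x \<in> {0<..<c}"
    unfolding eventually_at_right_field by auto
  have r_c: "x < c" if "0 < x" "x < r" for x using near[OF that] by simp
  have g_pos': "g t > 0" if "0 < t" "t < r" for t using g_pos[OF that(1) r_c[OF that]] .
  have g_mono': "g s \<le> g t" if "0 < s" "s \<le> t" "t < r" for s t using that r_c[of t] by (intro g_mono) auto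
  have potter: "g s * t powr (q + 1) \<le> 2 powr (q + 1) * (s powr (q + 1) * g t)" if "0 < s" "s \<le> t" "t < r" for s t
    by (rule potter_bound[OF _ _ g_pos' g_mono' that]) (use q near in auto)
  have quad: "g s * t\<^sup>2 \<le> 4 * (s\<^sup>2 * g t)" if st: "0 < s" "s \<le> t" "t < r" for s t
  proof -
    have "g s * t powr 2 \<le> 2 powr 2 * (s powr 2 * g t)"
    proof (rule potter_bound[OF _ _ g_pos' g_mono' st])
      fix x assume x: "0 < x" "x < r"
      have "(1/2) powr (q + 1) \<le> (1/2 :: real) powr 2" using q by (intro powr_mono') auto
      then have "(1/2) powr (q + 1) * g x \<le> (1/2) powr 2 * g x"
        using g_pos'[OF x] by (intro mult_right_mono) auto
      then show "g (x / 2) \<le> (1/2) powr 2 * g x" using near[OF x] by linarith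
    qed auto
    then show ?thesis using st by (simp add: powr_numeral)
  qed
  define A where "A = max 2 (max (2 * a powr p) (2 / a powr p))"
  have A: "A > 0" "A \<ge> 1" "A \<ge> 2 * a powr p" "A \<ge> 2 / a powr p" by (auto simp: A_def)
  have dbl: "g (2 * t) \<le> (2 * 2 powr (p + 1)) * g t" if "0 < t" "2 * t < r" for t
    using near[of t] that by auto
  define y where "y n = 1 - dr n" for n
  have y_lim: "y \<longlonglongrightarrow> 0"
    unfolding y_def using tendsto_diff[OF tendsto_const[of 1] dr_limit] by simp
  have y_pos: "y n > 0" for n using dr_less_1[of n] by (simp add: y_def)
  have "\<forall>\<^sub>F n in sequentially. cl n < r \<and> y n < r \<and> n \<ge> 1"
    using order_tendstoD(2)[OF cl_limit r] order_tendstoD(2)[OF y_lim r] eventually_ge_at_top[of 1]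
    by eventually_elim auto
  then obtain N where N: "\<And>n. n \<ge> N \<Longrightarrow> cl n < r \<and> y n < r \<and> n \<ge> 1"
    by (auto simp: eventually_sequentially)
  have cl_step: "cl n - cl (Suc n) = g (cl (Suc n))" if "n \<ge> 1" for n
    using f_u[of "cl n"] cl_open[of "n - 1"] that by (simp add: g_def cl_simps)
  have y_step: "y n - y (Suc n) = (1 - y (Suc n)) - f (1 - y (Suc n))" if "n \<ge> 1" for n
    using f_v[of "dr n"] dr_open[of "n - 1"] that by (simp add: y_def dr_simps)
  obtain b1 where b1: "b1 > 0" "\<forall>\<^sub>F n in sequentially. comparable_rate g cl b1 n"
  proof -
    have "\<exists>b>0. \<forall>\<^sub>F n in sequentially. comparable_rate g cl b n"
    proof (rule approach_rate[of N cl r A B 4 "2 * 2 powr (p + 1)"])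
      fix n assume n: "n \<ge> N"
      then have n': "0 < g (cl (Suc n))" "n \<ge> 1" using g_pos'[of "cl (Suc n)"] N[of "Suc n"] N[of n] cl_pos by auto
      show "0 < cl n \<and> cl n < r" using N[OF n] cl_pos by simp
      have "1 * g (cl (Suc n)) \<le> A * g (cl (Suc n))" using n' A by (intro mult_right_mono) auto
      then show "g (cl (Suc n)) \<le> A * (cl n - cl (Suc n))" "cl n - cl (Suc n) \<le> A * g (cl (Suc n))"
        using cl_step[OF n'(2)] by simp_all
      show "cl n \<le> B * cl (Suc n)"
        using left.lower[of 0 "cl n"] cl_pos[of n] cl_le_1[of n] by (simp add: u_0 cl_simps)
    qed (use cl_limit A B_pos g_pos' g_mono' quad dbl in auto)
    then show thesis using that by blast
  qed
  obtain b2 where b2: "b2 > 0" "\<forall>\<^sub>F n in sequentially. comparable_rate g y b2 n"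
  proof -
    have "\<exists>b>0. \<forall>\<^sub>F n in sequentially. comparable_rate g y b n"
    proof (rule approach_rate[of N y r A B 4 "2 * 2 powr (p + 1)"])
      fix n assume n: "n \<ge> N"
      then have n': "0 < g (y (Suc n))" "n \<ge> 1" using g_pos'[of "y (Suc n)"] N[of "Suc n"] N[of n] y_pos by auto
      show "0 < y n \<and> y n < r" using N[OF n] y_pos by simp
      have nr: "y n - y (Suc n) \<le> 2 * (a powr p * g (y (Suc n)))" "a powr p * g (y (Suc n)) \<le> 2 * (y n - y (Suc n))"
        using near[of "y (Suc n)"] y_pos[of "Suc n"] N[of "Suc n"] n y_step[OF n'(2)] by auto
      have diff: "y n - y (Suc n) \<ge> 0" using dr_Suc_greater[of n] by (simp add: y_def)
      have "g (y (Suc n)) \<le> (2 / a powr p) * (y n - y (Suc n))"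
        using nr(2) a by (simp add: field_simps)
      also have "\<dots> \<le> A * (y n - y (Suc n))" using diff A by (intro mult_right_mono) auto
      finally show "g (y (Suc n)) \<le> A * (y n - y (Suc n))" .
      have "y n - y (Suc n) \<le> (2 * a powr p) * g (y (Suc n))" using nr(1) by simp
      also have "\<dots> \<le> A * g (y (Suc n))" using n' A by (intro mult_right_mono) auto
      finally show "y n - y (Suc n) \<le> A * g (y (Suc n))" .
      show "y n \<le> B * y (Suc n)"
        using right.lower[of "dr n" 1] dr_nonneg[of n] dr_less_1[of n] by (simp add: v_1 y_def dr_simps)
    qed (use y_lim A B_pos g_pos' g_mono' quad dbl in auto)
    then show thesis using that by blast
  qed
  have good: "\<forall>\<^sub>F n in sequentially. comparable_rate g cl b1 n \<and> comparable_rate g y b2 n \<and> n \<ge> N"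
    using b1(2) b2(2) eventually_ge_at_top[of N] by eventually_elim auto
  have "\<forall>\<^sub>F n in sequentially. cl n \<le> max 1 (b1 * b2 * 4) * y n"
    using good by eventually_elim
      (intro comparable_rate_compare[where r = r and g = g] ; use b1(1) b2(1) N cl_pos y_pos quad in auto)
  then obtain A1 where A1: "A1 > 0" "\<And>n. cl n \<le> A1 * y n"
    using eventually_comparable_all[of cl y "max 1 (b1 * b2 * 4)"] cl_pos y_pos
    by (auto simp: less_max_iff_disj)
  have "\<forall>\<^sub>F n in sequentially. y n \<le> max 1 (b2 * b1 * 4) * cl n"
    using good by eventually_elim
      (intro comparable_rate_compare[where r = r and g = g] ; use b1(1) b2(1) N cl_pos y_pos quad in auto)
  then obtain A2 where A2: "A2 > 0" "\<And>n. y n \<le> A2 * cl n"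
    using eventually_comparable_all[of y cl "max 1 (b2 * b1 * 4)"] cl_pos y_pos
    by (auto simp: less_max_iff_disj)
  obtain N1 where N1: "\<And>n. n \<ge> N1 \<Longrightarrow> comparable_rate g cl b1 n \<and> n \<ge> N"
    using good unfolding eventually_sequentially by blast
  have "\<exists>R'>0. \<forall>j s. 1 \<le> j \<longrightarrow> j \<le> s \<longrightarrow> cl j \<le> R' * (real s / real j) powr (1 / q) * cl s"
  proof (rule regular_from_start[where N = N1 and R = "(b1\<^sup>2 * 2 powr (q + 1)) powr (1 / q)"])
    fix j s assume js: "N1 \<le> j" "1 \<le> j" "j \<le> s"
    show "cl j \<le> (b1\<^sup>2 * 2 powr (q + 1)) powr (1 / q) * (real s / real j) powr (1 / q) * cl s"
      by (rule comparable_rate_regular[where r = r and g = g])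
         (use js N1 N cl_pos cl_le b1(1) q potter in auto)
  qed (use cl_pos cl_le q b1(1) in auto)
  then obtain R where R: "R > 0" "\<And>j s. 1 \<le> j \<Longrightarrow> j \<le> s \<Longrightarrow> cl j \<le> R * (real s / real j) powr (1 / q) * cl s"
    by blast
  have "cl n \<le> max A1 A2 * (1 - dr n)" "1 - dr n \<le> max A1 A2 * cl n" for n
  proof -
    have "A1 * y n \<le> max A1 A2 * y n" using y_pos[of n] by (intro mult_right_mono) auto
    then show "cl n \<le> max A1 A2 * (1 - dr n)" using A1(2)[of n] by (simp add: y_def)
    have "A2 * cl n \<le> max A1 A2 * cl n" using cl_pos[of n] by (intro mult_right_mono) auto
    then show "1 - dr n \<le> max A1 A2 * cl n" using A2(2)[of n] by (simp add: y_def)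
  qed
  then show ?thesis
    using q R A1(1) by (intro exI[of _ "1 / q"] exI[of _ R] exI[of _ "max A1 A2"]) (simp add: less_max_iff_disj)
qed

lemma wandering_oscillates:
  assumes x: "x \<in> G" "wandering x"
  shows "historical_point f x \<and> limit_measures f x = {endpoint_mixture l | l. l \<in> {0..1}}"
proof -
  define r where "r n = rights n x / real n" for n
  note w = x(2)[unfolded wandering_def]
  have orbit: "(f ^^ j) x \<in> {0..1}" for j using G_open[OF f_pow_G[OF x(1)], of j] by simp
  have step: "r (Suc n) \<le> r n + 1 / real (Suc n)" if "n \<ge> 1" for n
  proof -
    have nonneg: "rights n x \<ge> 0" by (simp add: bsum_def sum_nonneg)
    have "rights (Suc n) x \<le> rights n x + 1" by (simp add: bsum_def indicator_def)
    then have "r (Suc n) \<le> (rights n x + 1) / real (Suc n)" unfolding r_def by (intro divide_right_mono) auto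
    also have "\<dots> = rights n x / real (Suc n) + 1 / real (Suc n)" by (simp add: add_divide_distrib)
    also have "\<dots> \<le> r n + 1 / real (Suc n)"
      unfolding r_def using that nonneg by (intro add_right_mono divide_left_mono) auto
    finally show ?thesis .
  qed
  have low: "\<exists>\<^sub>\<infinity>n. r n \<le> \<epsilon>" if "\<epsilon> > 0" for \<epsilon>
  proof (rule INFM_mono)
    show "\<exists>\<^sub>\<infinity>n. rights n x \<le> \<epsilon> * real n" using w that by blast
    fix n assume "rights n x \<le> \<epsilon> * real n"
    then show "r n \<le> \<epsilon>" using that by (cases "n = 0") (auto simp: r_def field_simps)
  qed
  have high: "\<exists>\<^sub>\<infinity>n. r n \<ge> 1 - \<epsilon>" if "\<epsilon> > 0" for \<epsilon>
    unfolding INFM_nat_le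
  proof
    fix N
    have "\<exists>\<^sub>\<infinity>n. real n - rights n x \<le> \<epsilon> * real n" using w that by blast
    then obtain n where n: "n \<ge> max N 1" "real n - rights n x \<le> \<epsilon> * real n"
      unfolding INFM_nat_le by blast
    then show "\<exists>n\<ge>N. r n \<ge> 1 - \<epsilon>" by (intro exI[of _ n]) (auto simp: r_def field_simps)
  qed
  have avg: "(\<lambda>n. (\<Sum>j<n. \<phi> ((f ^^ j) x)) / real n - ((1 - r n) * \<phi> 0 + r n * \<phi> 1)) \<longlonglongrightarrow> 0"
    if "continuous_on {0..1} \<phi>" for \<phi> :: "real \<Rightarrow> real"
    using averages_near_mixture[OF x(1) _ that] w unfolding r_def bsum_def by blast
  show ?thesis
    using oscillating_orbit[OF orbit step low high avg] by blast
qed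

lemma negligible_non_oscillating:
  assumes p: "p > 1" and reg: "regular_contact_at_0 f c p" and comp: "comparable_contacts f p"
  shows "negligible {x \<in> {0<..<1}. \<not> (historical_point f x \<and> limit_measures f x = {endpoint_mixture l | l. l \<in> {0..1}})}"
proof -
  obtain \<gamma> R A where t: "0 < \<gamma>" "\<gamma> < 1" "R > 0" "A > 0"
    "\<And>j s. 1 \<le> j \<Longrightarrow> j \<le> s \<Longrightarrow> cl j \<le> R * (real s / real j) powr \<gamma> * cl s"
    "\<And>n. cl n \<le> A * (1 - dr n)" "\<And>n. 1 - dr n \<le> A * cl n"
    using tails_regular[OF p reg comp] by blast
  have "AE x in MZ. dominating_excursions x"
    by (rule excursions_dominate[of \<gamma> R A]) (use t in auto)
  then have "AE x in MZ. wandering x"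
  proof (rule AE_mp, intro AE_I2 impI)
    fix x assume "x \<in> space MZ"
      and *: "dominating_excursions x"
    then have x: "x \<in> Z" by simp
    show "wandering x"
      unfolding wandering_def using *[unfolded dominating_excursions_def] visits_sublinear[OF x] rights_rare[OF x] lefts_rare[OF x] by blast
  qed
  then have "negligible {x \<in> {0<..<1}. \<not> (x \<in> G \<and> wandering x)}" by (rule negligible_non_wandering)
  then show ?thesis by (rule negligible_subset) (use wandering_oscillates in blast)
qed

end

lemma AE_lebesgue_on_negligible:
  fixes S :: "real set"
  assumes "S \<in> sets lebesgue" "negligible {x \<in> S. \<not> P x}"
  shows "AE x in lebesgue_on S. P x"
proof -
  have "AE x in lebesgue. x \<in> S \<longrightarrow> P x"
    by (rule AE_I'[of "{x \<in> S. \<not> P x}"]) (use assms in \<open>auto simp: negligible_iff_null_sets\<close>)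
  then show ?thesis using assms(1) by (subst AE_restrict_space_iff) auto
qed

theorem corollary11:
  fixes f :: "real \<Rightarrow> real"
  assumes "thaler_function f"
  shows "(AE x in lebesgue_on {0..1}. historical_point f x) \<and>
         (AE x in lebesgue_on {0<..<1}.
            limit_measures f x = {endpoint_mixture l | l. l \<in> {0..1}})"
proof -
  obtain u v \<Lambda> B c \<rho> p where "coded_map u v \<Lambda> B c \<rho> f" and p: "p > 1"
    "regular_contact_at_0 f c p" "comparable_contacts f p"
    using thaler_function_coded[OF assms] .
  then interpret coded_map u v \<Lambda> B c \<rho> f by simp
  let ?N = "{x \<in> {0<..<1}. \<not> (historical_point f x \<and> limit_measures f x = {endpoint_mixture l | l. l \<in> {0..1}})}"
  have N: "negligible ?N" by (rule negligible_non_oscillating[OF p])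
  have "AE x in lebesgue_on {0..1}. historical_point f x"
  proof (rule AE_lebesgue_on_negligible)
    have "negligible (?N \<union> {0, 1})" using N by (intro negligible_Un) auto
    then show "negligible {x \<in> {0..1}. \<not> historical_point f x}" by (rule negligible_subset) force
  qed simp
  moreover have "AE x in lebesgue_on {0<..<1}. limit_measures f x = {endpoint_mixture l | l. l \<in> {0..1}}"
    by (rule AE_lebesgue_on_negligible) (auto intro: negligible_subset[OF N])
  ultimately show ?thesis by blast
qed

end
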